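(* Let $d\ge1$. Suppose that $\{g_n\}_{n\in\mathbb{Z}}\in\ell^1(\mathbb{Z})$, $g_0=0$, and $g_1\neq0$. Let $T\in\mathbb{R}$ and let $u(t)$ be a solution to $i\partial_tu+\Delta u=F(u)$ on $[T,\infty)$. If $u$ satisfies $$\lim_{t\to\infty}\|u(t)-U(t)u_+\|_{L^2(\mathbb{R}^d)}=0,$$ $$\lim_{t\to\infty}t^{\frac{d}{2(d+2)}}\,\|u-U(\cdot)u_+\|_{L^{\frac{2(d+2)}{d}}_{t,x}([t,\infty)\times\mathbb{R}^d)}=0$$ for some $u_+\in H^{0,\frac{d}{d+2}}(\mathbb{R}^d)$, then $u_+\equiv0$.
   Context: Nonlinearity: $F:\mathbb{C}\to\mathbb{C}$ is homogeneous of degree $1+2/d$, i.e. $F(\lambda z)=\lambda^{1+2/d}F(z)$ for all $z\in\mathbb{C}$, $\lambda>0$. Its coefficients are $g_n=\frac1{2\pi}\int_0^{2\pi}F(e^{i\theta})e^{-in\theta}\,d\theta$, $n\in\mathbb{Z}$ (complex numbers), and $F$ is decomposed as $F(u)=\sum_{n\in\mathbb{Z}}g_nF_n(u)$ with $F_n(u)=|u|^{1+\frac2d-n}u^n$. Solution: for an interval $I\subset\mathbb{R}$, a function $u:I\times\mathbb{R}^d\to\mathbb{C}$ is a solution to $i\partial_tu+\Delta u=F(u)$ on $I$ if $u\in C_t(I;L^2_x(\mathbb{R}^d))\cap L^{\frac{2(d+2)}{d}}_{t,\mathrm{loc}}(I;L_x^{\frac{2(d+2)}{d}}(\mathbb{R}^d))$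 and $u(t_2)=U(t_2-t_1)u(t_1)-i\int_{t_1}^{t_2}U(t_2-s)F(u(s))\,ds$ in $L^2(\mathbb{R}^d)$ for all $t_1,t_2\in I$, where $U(t)=e^{it\Delta}$ is the free Schrödinger group. Weighted Sobolev space: $H^{m,s}=\{u\in\mathcal{S}'(\mathbb{R}^d):\langle i\nabla\rangle^m\langle x\rangle^su\in L^2(\mathbb{R}^d)\}$, where $\langle a\rangle=(1+|a|^2)^{1/2}$. *)

theory Defs
  imports "HOL-Analysis.Analysis"
begin

definition square_integrable :: "('a::euclidean_space \<Rightarrow> complex) \<Rightarrow> bool" where
  "square_integrable f \<longleftrightarrow>
     f \<in> borel_measurable lborel \<and> integrable lborel (\<lambda>x. (norm (f x))\<^sup>2)"

definition L2_rel :: "('a::euclidean_space \<Rightarrow> complex) \<Rightarrow> ('a \<Rightarrow> complex) \<Rightarrow> bool" where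
  "L2_rel f g \<longleftrightarrow>
     square_integrable f \<and> square_integrable g \<and> (AE x in lborel. f x = g x)"

lemma square_integrable_meas: "square_integrable f \<Longrightarrow> f \<in> borel_measurable lborel"
  by (simp add: square_integrable_def)

lemma square_integrable_borel [measurable_dest]: "square_integrable f \<Longrightarrow> f \<in> borel_measurable borel"
  by (simp add: square_integrable_def)

lemma square_integrable_bound:
  assumes "f \<in> borel_measurable lborel" "integrable lborel g" "AE x in lborel. (norm (f x))\<^sup>2 \<le> g x"
  shows "square_integrable f"
  unfolding square_integrable_def
  using assms by (auto intro!: Bochner_Integration.integrable_bound[OF assms(2)] elim!: AE_mp)

lemma square_integrable_zero: "square_integrable (\<lambda>x. 0)"
  by (simp add: square_integrable_def)

lemma square_integrable_add:
  assumes f: "square_integrable f" and g: "square_integrable g"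
  shows "square_integrable (\<lambda>x. f x + g x)"
proof (rule square_integrable_bound)
  show "(\<lambda>x. f x + g x) \<in> borel_measurable lborel"
    using f g by (auto simp: square_integrable_def)
  show "integrable lborel (\<lambda>x. 2 * (norm (f x))\<^sup>2 + 2 * (norm (g x))\<^sup>2)"
    using f g by (simp add: square_integrable_def)
  have "(norm (f x + g x))\<^sup>2 \<le> 2 * (norm (f x))\<^sup>2 + 2 * (norm (g x))\<^sup>2" for x
  proof -
    have "(norm (f x + g x))\<^sup>2 \<le> (norm (f x) + norm (g x))\<^sup>2"
      by (intro power_mono norm_triangle_ineq) auto
    also have "\<dots> \<le> 2 * (norm (f x))\<^sup>2 + 2 * (norm (g x))\<^sup>2"
      using sum_squares_bound[of "norm (f x)" "norm (g x)"] by (simp add: power2_sum)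
    finally show ?thesis .
  qed
  then show "AE x in lborel. (norm (f x + g x))\<^sup>2 \<le> 2 * (norm (f x))\<^sup>2 + 2 * (norm (g x))\<^sup>2"
    by simp
qed

lemma square_integrable_cmult:
  "square_integrable f \<Longrightarrow> square_integrable (\<lambda>x. c * f x)"
  by (auto simp: square_integrable_def norm_mult power_mult_distrib)

lemma square_integrable_scaleR:
  "square_integrable f \<Longrightarrow> square_integrable (\<lambda>x. c *\<^sub>R f x)"
  using square_integrable_cmult[of f "of_real c"] by (simp add: scaleR_conv_of_real)

lemma square_integrable_uminus:
  "square_integrable f \<Longrightarrow> square_integrable (\<lambda>x. - f x)"
  using square_integrable_cmult[of f "-1"] by simp

lemma square_integrable_diff:
  "square_integrable f \<Longrightarrow> square_integrable g \<Longrightarrow> square_integrable (\<lambda>x. f x - g x)"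
  using square_integrable_add[OF _ square_integrable_uminus, of f g] by simp

lemma square_integrable_inner:
  assumes f: "square_integrable f" and g: "square_integrable g"
  shows "integrable lborel (\<lambda>x. f x \<bullet> g x)"
proof (rule Bochner_Integration.integrable_bound)
  show "integrable lborel (\<lambda>x. (norm (f x))\<^sup>2 + (norm (g x))\<^sup>2)"
    using f g by (simp add: square_integrable_def)
  show "(\<lambda>x. f x \<bullet> g x) \<in> borel_measurable lborel"
    using f g by (auto simp: square_integrable_def)
  have "norm (f x \<bullet> g x) \<le> norm ((norm (f x))\<^sup>2 + (norm (g x))\<^sup>2)" for x
  proof -
    have "norm (f x \<bullet> g x) \<le> norm (f x) * norm (g x)"
      by (simp add: Cauchy_Schwarz_ineq2)
    also have "\<dots> \<le> 2 * norm (f x) * norm (g x)"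
      by simp
    also have "\<dots> \<le> (norm (f x))\<^sup>2 + (norm (g x))\<^sup>2"
      using sum_squares_bound[of "norm (f x)" "norm (g x)"] by simp
    finally show ?thesis by simp
  qed
  then show "AE x in lborel. norm (f x \<bullet> g x) \<le> norm ((norm (f x))\<^sup>2 + (norm (g x))\<^sup>2)"
    by simp
qed

text \<open>
  The Hilbert space of square integrable complex functions on \<open>'a\<close>, modulo equality almost
  everywhere. Every Lebesgue class has a Borel representative, so Borel functions suffice.
  The dimension of the space is \<open>DIM('a)\<close>. The instances proved below are those that
  the Bochner integral of \<open>L\<^sup>2\<close>-valued curves requires.
\<close>

quotient_type (overloaded) 'a L2 = "'a::euclidean_space \<Rightarrow> complex" / partial: L2_rel
proof (rule part_equivpI)
  show "\<exists>f. L2_rel f f"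
    using square_integrable_zero by (auto simp: L2_rel_def)
  show "symp (L2_rel :: ('a \<Rightarrow> complex) \<Rightarrow> _)"
    by (auto simp: symp_def L2_rel_def)
  show "transp (L2_rel :: ('a \<Rightarrow> complex) \<Rightarrow> _)"
    by (auto simp: transp_def L2_rel_def)
qed

lemma square_integrable_rep [simp]: "square_integrable (rep_L2 f)"
  using Quotient3_rep_reflp[OF Quotient3_L2] by (auto simp: L2_rel_def)

lemma rep_L2_borel [measurable]: "rep_L2 f \<in> borel_measurable borel"
  using square_integrable_rep[of f] by (simp add: square_integrable_def)

lemma abs_rep_L2 [simp]: "abs_L2 (rep_L2 f) = f"
  by (rule Quotient3_abs_rep[OF Quotient3_L2])

lemma rep_abs_L2_AE: "square_integrable f \<Longrightarrow> AE x in lborel. rep_L2 (abs_L2 f) x = f x"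
  using Quotient3_rep_abs[OF Quotient3_L2, of f] by (auto simp: L2_rel_def)

lemma abs_L2_cong:
  "square_integrable f \<Longrightarrow> square_integrable g \<Longrightarrow> AE x in lborel. f x = g x \<Longrightarrow> abs_L2 f = abs_L2 g"
  using Quotient3_rel_abs[OF Quotient3_L2, of f g] by (auto simp: L2_rel_def)

lemma L2_eqI: "AE x in lborel. rep_L2 f x = rep_L2 g x \<Longrightarrow> f = g"
  using abs_L2_cong[of "rep_L2 f" "rep_L2 g"] by simp

instantiation L2 :: (euclidean_space) real_vector
begin

lift_definition zero_L2 :: "'a L2" is "\<lambda>x. 0"
  by (simp add: L2_rel_def square_integrable_zero)

lift_definition plus_L2 :: "'a L2 \<Rightarrow> 'a L2 \<Rightarrow> 'a L2" is "\<lambda>f g x. f x + g x"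
  by (auto simp: L2_rel_def square_integrable_add elim!: AE_mp)

lift_definition uminus_L2 :: "'a L2 \<Rightarrow> 'a L2" is "\<lambda>f x. - f x"
  by (auto simp: L2_rel_def square_integrable_uminus elim!: AE_mp)

lift_definition minus_L2 :: "'a L2 \<Rightarrow> 'a L2 \<Rightarrow> 'a L2" is "\<lambda>f g x. f x - g x"
  by (auto simp: L2_rel_def square_integrable_diff elim!: AE_mp)

lift_definition scaleR_L2 :: "real \<Rightarrow> 'a L2 \<Rightarrow> 'a L2" is "\<lambda>c f x. c *\<^sub>R f x"
  by (auto simp: L2_rel_def square_integrable_scaleR elim!: AE_mp)

instance
proof
  fix f g h :: "'a L2" and a b :: real
  show "f + g + h = f + (g + h)"
    by transfer (auto simp: L2_rel_def square_integrable_add add.assoc)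
  show "f + g = g + f"
    by transfer (auto simp: L2_rel_def square_integrable_add add.commute)
  show "0 + f = f"
    by transfer (auto simp: L2_rel_def)
  show "- f + f = 0"
    by transfer (auto simp: L2_rel_def square_integrable_zero)
  show "f - g = f + - g"
    by transfer (auto simp: L2_rel_def square_integrable_diff)
  show "a *\<^sub>R (f + g) = a *\<^sub>R f + a *\<^sub>R g"
    by transfer (auto simp: L2_rel_def square_integrable_add square_integrable_scaleR scaleR_add_right)
  show "(a + b) *\<^sub>R f = a *\<^sub>R f + b *\<^sub>R f"
    by transfer (auto simp: L2_rel_def square_integrable_add square_integrable_scaleR scaleR_add_left)
  show "a *\<^sub>R b *\<^sub>R f = (a * b) *\<^sub>R f"
    by transfer (auto simp: L2_rel_def square_integrable_scaleR mult.assoc)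
  show "1 *\<^sub>R f = f"
    by transfer (auto simp: L2_rel_def)
qed

end

instantiation L2 :: (euclidean_space) real_inner
begin

lift_definition inner_L2 :: "'a L2 \<Rightarrow> 'a L2 \<Rightarrow> real" is "\<lambda>f g. \<integral>x. f x \<bullet> g x \<partial>lborel"
  by (rule integral_cong_AE) (auto simp: L2_rel_def square_integrable_def elim!: AE_mp)

definition norm_L2 :: "'a L2 \<Rightarrow> real" where "norm_L2 f = sqrt (f \<bullet> f)"

definition dist_L2 :: "'a L2 \<Rightarrow> 'a L2 \<Rightarrow> real" where "dist_L2 f g = norm (f - g)"

definition sgn_L2 :: "'a L2 \<Rightarrow> 'a L2" where "sgn_L2 f = f /\<^sub>R norm f"

definition uniformity_L2 :: "('a L2 \<times> 'a L2) filter" where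
  "uniformity_L2 = (INF e\<in>{0<..}. principal {(x, y). dist x y < e})"

definition open_L2 :: "'a L2 set \<Rightarrow> bool" where
  "open_L2 U = (\<forall>x\<in>U. \<forall>\<^sub>F (x', y) in uniformity. x' = x \<longrightarrow> y \<in> U)"

instance
proof
  fix f g h :: "'a L2" and a :: real
  show "dist f g = norm (f - g)" by (rule dist_L2_def)
  show "sgn f = f /\<^sub>R norm f" by (rule sgn_L2_def)
  show "uniformity = (INF e\<in>{0<..}. principal {(x :: 'a L2, y). dist x y < e})"
    by (rule uniformity_L2_def)
  show "open U = (\<forall>x\<in>U. \<forall>\<^sub>F (x', y) in uniformity. x' = x \<longrightarrow> y \<in> U)" for U :: "'a L2 set"
    by (rule open_L2_def)
  show "f \<bullet> g = g \<bullet> f"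
    by transfer (simp add: inner_commute)
  show "(f + g) \<bullet> h = f \<bullet> h + g \<bullet> h"
    by transfer (simp add: L2_rel_def inner_add_left square_integrable_inner)
  show "(a *\<^sub>R f) \<bullet> g = a * (f \<bullet> g)"
    by transfer simp
  show "0 \<le> f \<bullet> f"
    by transfer simp
  show "f \<bullet> f = 0 \<longleftrightarrow> f = 0"
  proof transfer
    fix f :: "'a \<Rightarrow> complex"
    assume "L2_rel f f"
    then have f: "square_integrable f" by (simp add: L2_rel_def)
    have "(\<integral>x. f x \<bullet> f x \<partial>lborel) = 0 \<longleftrightarrow> (AE x in lborel. f x \<bullet> f x = 0)"
      by (rule integral_nonneg_eq_0_iff_AE[OF square_integrable_inner[OF f f]]) simp
    then show "(\<integral>x. f x \<bullet> f x \<partial>lborel) = 0 \<longleftrightarrow> L2_rel f (\<lambda>x. 0)"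
      using f by (simp add: L2_rel_def square_integrable_zero)
  qed
  show "norm f = sqrt (f \<bullet> f)" by (rule norm_L2_def)
qed

end

lemma norm_L2_abs:
  assumes "square_integrable f"
  shows "norm (abs_L2 f) = sqrt (\<integral>x. (norm (f x))\<^sup>2 \<partial>lborel)"
  using assms unfolding norm_L2_def
  by (simp add: inner_L2.abs_eq L2_rel_def power2_norm_eq_inner)

lemma norm_L2_eq: "norm f = sqrt (\<integral>x. (norm (rep_L2 f x))\<^sup>2 \<partial>lborel)"
  using norm_L2_abs[of "rep_L2 f"] by simp

lemma abs_L2_add: "square_integrable f \<Longrightarrow> square_integrable g \<Longrightarrow>
    abs_L2 (\<lambda>x. f x + g x) = abs_L2 f + abs_L2 g"
  by (simp add: plus_L2.abs_eq L2_rel_def)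

lemma abs_L2_diff: "square_integrable f \<Longrightarrow> square_integrable g \<Longrightarrow>
    abs_L2 (\<lambda>x. f x - g x) = abs_L2 f - abs_L2 g"
  by (simp add: minus_L2.abs_eq L2_rel_def)

lemma abs_L2_scaleR: "square_integrable f \<Longrightarrow> abs_L2 (\<lambda>x. c *\<^sub>R f x) = c *\<^sub>R abs_L2 f"
  by (simp add: scaleR_L2.abs_eq L2_rel_def)

lemma abs_L2_zero: "abs_L2 (\<lambda>x. 0) = 0"
  by (simp add: zero_L2_def)

lemma norm_L2_nn:
  assumes "square_integrable f"
  shows "(\<integral>\<^sup>+x. ennreal ((norm (f x))\<^sup>2) \<partial>lborel) = ennreal ((norm (abs_L2 f))\<^sup>2)"
proof -
  have "(\<integral>\<^sup>+x. ennreal ((norm (f x))\<^sup>2) \<partial>lborel) = ennreal (\<integral>x. (norm (f x))\<^sup>2 \<partial>lborel)"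
    using assms by (intro nn_integral_eq_integral) (auto simp: square_integrable_def)
  also have "(\<integral>x. (norm (f x))\<^sup>2 \<partial>lborel) = (norm (abs_L2 f))\<^sup>2"
    by (simp add: norm_L2_abs[OF assms])
  finally show ?thesis .
qed

lemma square_integrable_nn:
  assumes [measurable]: "f \<in> borel_measurable borel"
    and "(\<integral>\<^sup>+x. ennreal ((norm (f x))\<^sup>2) \<partial>lborel) < \<infinity>"
  shows "square_integrable f"
  using assms by (auto simp: square_integrable_def intro!: integrableI_bounded)

instance L2 :: (euclidean_space) banach
proof
  fix X :: "nat \<Rightarrow> 'a L2"
  assume "Cauchy X"
  then have "\<forall>k. \<exists>N. \<forall>m\<ge>N. \<forall>n\<ge>N. norm (X m - X n) < (1/8) ^ k"
    by (auto simp: Cauchy_iff)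
  then obtain N where N: "\<And>k m n. m \<ge> N k \<Longrightarrow> n \<ge> N k \<Longrightarrow> norm (X m - X n) < (1/8) ^ k"
    by metis
  define r where "r k = (\<Sum>j\<le>k. N j)" for k
  have r_ge: "r j \<ge> N k" if "k \<le> j" for j k
    unfolding r_def using that by (intro member_le_sum) auto
  define Y where "Y k = rep_L2 (X (r k))" for k
  have [measurable]: "Y k \<in> borel_measurable borel" for k
    by (simp add: Y_def)
  have XY: "(\<integral>\<^sup>+x. ennreal ((norm (rep_L2 (X n) x - Y j x))\<^sup>2) \<partial>lborel) \<le> ennreal ((1/64) ^ k)"
    if "n \<ge> N k" "j \<ge> k" for n j k
  proof -
    have "(\<integral>\<^sup>+x. ennreal ((norm (rep_L2 (X n) x - Y j x))\<^sup>2) \<partial>lborel) = ennreal ((norm (X n - X (r j)))\<^sup>2)"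
      unfolding Y_def by (subst norm_L2_nn) (simp_all add: square_integrable_diff abs_L2_diff)
    also have "(norm (X n - X (r j)))\<^sup>2 \<le> ((1/8) ^ k)\<^sup>2"
      using N[OF that(1) r_ge[OF that(2)]] by (intro power_mono) auto
    also have "((1/8::real) ^ k)\<^sup>2 = (1/64) ^ k"
      by (simp add: power2_eq_square flip: power_mult_distrib)
    finally show ?thesis by (simp add: ennreal_leI)
  qed
  have Y_conv: "AE x in lborel. convergent (\<lambda>k. Y k x)"
  proof -
    let ?d = "\<lambda>k x. ennreal (4 ^ k * (norm (Y (Suc k) x - Y k x))\<^sup>2)"
    have "(\<integral>\<^sup>+x. (\<Sum>k. ?d k x) \<partial>lborel) = (\<Sum>k. \<integral>\<^sup>+x. ?d k x \<partial>lborel)"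
      by (rule nn_integral_suminf) simp
    also have "\<dots> \<le> (\<Sum>k. ennreal ((1/16) ^ k))"
    proof (rule suminf_le)
      fix k
      have "(\<integral>\<^sup>+x. ?d k x \<partial>lborel) = ennreal (4 ^ k) * (\<integral>\<^sup>+x. ennreal ((norm (Y (Suc k) x - Y k x))\<^sup>2) \<partial>lborel)"
        by (subst nn_integral_cmult[symmetric]) (simp_all add: ennreal_mult)
      also have "\<dots> \<le> ennreal (4 ^ k) * ennreal ((1/64) ^ k)"
        using XY[where n="r (Suc k)" and j=k and k=k] r_ge[of k "Suc k"]
        by (intro mult_left_mono) (simp_all add: Y_def)
      also have "\<dots> = ennreal ((1/16) ^ k)"
        by (simp add: ennreal_mult[symmetric] power_mult_distrib[symmetric])
      finally show "(\<integral>\<^sup>+x. ?d k x \<partial>lborel) \<le> ennreal ((1/16) ^ k)" .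
    qed auto
    also have "\<dots> = ennreal (\<Sum>k. (1/16) ^ k)"
      by (intro suminf_ennreal2) (auto intro!: summable_geometric)
    also have "\<dots> < \<infinity>" by simp
    finally have "AE x in lborel. (\<Sum>k. ?d k x) \<noteq> \<infinity>"
      by (intro nn_integral_noteq_infinite) auto
    then show ?thesis
    proof (rule AE_mp, intro AE_I2 impI)
      fix x assume "(\<Sum>k. ?d k x) \<noteq> \<infinity>"
      then have "summable (\<lambda>k. 4 ^ k * (norm (Y (Suc k) x - Y k x))\<^sup>2)"
        by (intro summable_suminf_not_top) auto
      then have "(\<lambda>k. 4 ^ k * (norm (Y (Suc k) x - Y k x))\<^sup>2) \<longlonglongrightarrow> 0"
        by (rule summable_LIMSEQ_zero)
      then have "\<forall>\<^sub>F k in sequentially. 4 ^ k * (norm (Y (Suc k) x - Y k x))\<^sup>2 < 1"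
        by (rule order_tendstoD) simp
      then have ev: "\<forall>\<^sub>F k in sequentially. norm (Y (Suc k) x - Y k x) \<le> (1/2) ^ k"
      proof eventually_elim
        fix k assume "4 ^ k * (norm (Y (Suc k) x - Y k x))\<^sup>2 < 1"
        also have "4 ^ k * (norm (Y (Suc k) x - Y k x))\<^sup>2 = (2 ^ k * norm (Y (Suc k) x - Y k x))\<^sup>2"
          by (simp add: power_mult_distrib flip: power_mult) (simp add: mult.commute[of k] power_mult)
        finally have "2 ^ k * norm (Y (Suc k) x - Y k x) \<le> 1"
          by (metis less_imp_le abs_square_le_1 abs_le_D1)
        then show "norm (Y (Suc k) x - Y k x) \<le> (1/2) ^ k"
          by (simp add: power_divide field_simps)
      qed
      have "summable (\<lambda>k. Y (Suc k) x - Y k x)"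
        by (rule summable_comparison_test_ev[OF ev]) (simp add: summable_geometric)
      then have "convergent (\<lambda>n. \<Sum>k<n. Y (Suc k) x - Y k x)"
        by (simp add: summable_iff_convergent)
      then have "convergent (\<lambda>n. Y n x - Y 0 x)"
        unfolding sum_lessThan_telescope[of "\<lambda>k. Y k x"] .
      then show "convergent (\<lambda>k. Y k x)"
        using convergent_add[OF _ convergent_const[of "Y 0 x"], of "\<lambda>n. Y n x - Y 0 x"] by simp
    qed
  qed
  define f where "f x = lim (\<lambda>k. Y k x)" for x
  have f_meas [measurable]: "f \<in> borel_measurable borel"
    unfolding f_def by (rule borel_measurable_lim_metric) simp
  have Xf: "(\<integral>\<^sup>+x. ennreal ((norm (rep_L2 (X n) x - f x))\<^sup>2) \<partial>lborel) \<le> ennreal ((1/64) ^ k)"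
    if n: "n \<ge> N k" for n k
  proof -
    have "AE x in lborel. ennreal ((norm (rep_L2 (X n) x - f x))\<^sup>2)
        = liminf (\<lambda>j. ennreal ((norm (rep_L2 (X n) x - Y j x))\<^sup>2))"
      using Y_conv
    proof (rule AE_mp, intro AE_I2 impI)
      fix x assume "convergent (\<lambda>k. Y k x)"
      then have "(\<lambda>k. Y k x) \<longlonglongrightarrow> f x"
        by (simp add: f_def convergent_LIMSEQ_iff)
      then have "(\<lambda>j. ennreal ((norm (rep_L2 (X n) x - Y j x))\<^sup>2)) \<longlonglongrightarrow>
          ennreal ((norm (rep_L2 (X n) x - f x))\<^sup>2)"
        by (intro tendsto_intros)
      then show "ennreal ((norm (rep_L2 (X n) x - f x))\<^sup>2)
          = liminf (\<lambda>j. ennreal ((norm (rep_L2 (X n) x - Y j x))\<^sup>2))"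
        by (intro lim_imp_Liminf[symmetric]) auto
    qed
    then have "(\<integral>\<^sup>+x. ennreal ((norm (rep_L2 (X n) x - f x))\<^sup>2) \<partial>lborel)
        = (\<integral>\<^sup>+x. liminf (\<lambda>j. ennreal ((norm (rep_L2 (X n) x - Y j x))\<^sup>2)) \<partial>lborel)"
      by (rule nn_integral_cong_AE)
    also have "\<dots> \<le> liminf (\<lambda>j. \<integral>\<^sup>+x. ennreal ((norm (rep_L2 (X n) x - Y j x))\<^sup>2) \<partial>lborel)"
      by (rule nn_integral_liminf) simp
    also have "\<dots> \<le> liminf (\<lambda>j. ennreal ((1/64) ^ k))"
      by (intro Liminf_mono) (auto simp: eventually_sequentially intro!: exI[of _ k] XY[OF n])
    also have "\<dots> = ennreal ((1/64) ^ k)"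
      by (simp add: Liminf_const)
    finally show ?thesis .
  qed
  have Xf_sq: "square_integrable (\<lambda>x. rep_L2 (X n) x - f x)" if "n \<ge> N k" for n k
    using Xf[OF that] by (intro square_integrable_nn) (auto intro: le_less_trans)
  have f_sq: "square_integrable f"
    using square_integrable_diff[OF square_integrable_rep[of "X (N 0)"] Xf_sq[OF order_refl, of 0]]
    by simp
  have bd: "norm (X n - abs_L2 f) \<le> (1/8) ^ k" if n: "n \<ge> N k" for n k
  proof -
    have "ennreal ((norm (X n - abs_L2 f))\<^sup>2) \<le> ennreal ((1/64) ^ k)"
      using Xf[OF n] f_sq by (subst (asm) norm_L2_nn) (simp_all add: square_integrable_diff abs_L2_diff)
    then have "(norm (X n - abs_L2 f))\<^sup>2 \<le> ((1/8) ^ k)\<^sup>2"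
      by (simp add: power2_eq_square flip: power_mult_distrib)
    then show ?thesis
      by (rule power2_le_imp_le) simp
  qed
  have "X \<longlonglongrightarrow> abs_L2 f"
  proof (rule LIMSEQ_I)
    fix e :: real assume "0 < e"
    then obtain k where "(1/8) ^ k < e"
      using real_arch_pow_inv[of e "1/8"] by auto
    then show "\<exists>no. \<forall>n\<ge>no. norm (X n - abs_L2 f) < e"
      using bd by (intro exI[of _ "N k"]) (auto intro: le_less_trans)
  qed
  then show "convergent X"
    by (auto simp: convergent_def)
qed

lemma square_integrable_indicator:
  assumes [measurable]: "A \<in> sets borel" and "emeasure lborel A < \<infinity>"
  shows "square_integrable (\<lambda>x. indicator A x *\<^sub>R c)"
proof (rule square_integrable_nn)
  have "(\<integral>\<^sup>+x. ennreal ((norm (indicator A x *\<^sub>R c))\<^sup>2) \<partial>lborel)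
      = (\<integral>\<^sup>+x. ennreal ((norm c)\<^sup>2) * indicator A x \<partial>lborel)"
    by (intro nn_integral_cong) (auto simp: indicator_def)
  also have "\<dots> = ennreal ((norm c)\<^sup>2) * emeasure lborel A"
    by (simp add: nn_integral_cmult_indicator)
  also have "\<dots> < \<infinity>"
    using assms(2) by (simp add: ennreal_mult_less_top)
  finally show "(\<integral>\<^sup>+x. ennreal ((norm (indicator A x *\<^sub>R c))\<^sup>2) \<partial>lborel) < \<infinity>" .
qed simp

lemma L2_tendsto_dominated:
  fixes f :: "'a::euclidean_space \<Rightarrow> complex"
  assumes [measurable]: "\<And>n. s n \<in> borel_measurable borel"
    and f: "square_integrable f"
    and w: "integrable lborel w"
    and bound: "\<And>n. AE x in lborel. (norm (f x - s n x))\<^sup>2 \<le> w x"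
    and lim: "AE x in lborel. (\<lambda>n. s n x) \<longlonglongrightarrow> f x"
  shows "(\<lambda>n. abs_L2 (s n)) \<longlonglongrightarrow> abs_L2 f" "square_integrable (s n)"
proof -
  have [measurable]: "f \<in> borel_measurable borel" using f by (rule square_integrable_borel)
  have d: "square_integrable (\<lambda>x. f x - s n x)" for n
    by (rule square_integrable_bound[OF _ w bound]) simp
  have s: "square_integrable (s n)" for n
    using square_integrable_diff[OF f d[of n]] by simp
  show "square_integrable (s n)" by (rule s)
  have "(\<lambda>n. \<integral>x. (norm (f x - s n x))\<^sup>2 \<partial>lborel) \<longlonglongrightarrow> (\<integral>x. 0 \<partial>(lborel :: 'a measure))"
  proof (rule integral_dominated_convergence[OF _ _ w])
    show "AE x in lborel. (\<lambda>n. (norm (f x - s n x))\<^sup>2) \<longlonglongrightarrow> 0"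
      using lim
    proof (rule AE_mp, intro AE_I2 impI)
      fix x assume "(\<lambda>n. s n x) \<longlonglongrightarrow> f x"
      then have "(\<lambda>n. (norm (f x - s n x))\<^sup>2) \<longlonglongrightarrow> (norm (f x - f x))\<^sup>2"
        by (intro tendsto_intros)
      then show "(\<lambda>n. (norm (f x - s n x))\<^sup>2) \<longlonglongrightarrow> 0" by simp
    qed
  qed (use bound in simp_all)
  then have "(\<lambda>n. sqrt (\<integral>x. (norm (f x - s n x))\<^sup>2 \<partial>lborel)) \<longlonglongrightarrow> sqrt 0"
    by (intro tendsto_intros) simp
  then have "(\<lambda>n. norm (abs_L2 f - abs_L2 (s n))) \<longlonglongrightarrow> 0"
    using f s d by (simp add: norm_L2_abs flip: abs_L2_diff)
  then show "(\<lambda>n. abs_L2 (s n)) \<longlonglongrightarrow> abs_L2 f"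
    by (simp add: tendsto_iff dist_norm norm_minus_commute)
qed

lemma closure_subspace:
  fixes S :: "'v::real_normed_vector set"
  assumes S: "subspace S"
  shows "subspace (closure S)"
proof (rule subspaceI)
  show "0 \<in> closure S" using subspace_0[OF S] closure_subset by blast
next
  fix a b assume "a \<in> closure S" "b \<in> closure S"
  then obtain f g where "\<And>n. f n \<in> S" "f \<longlonglongrightarrow> a" "\<And>n. g n \<in> S" "g \<longlonglongrightarrow> b"
    unfolding closure_sequential by metis
  then have "\<And>n. f n + g n \<in> S" "(\<lambda>n. f n + g n) \<longlonglongrightarrow> a + b"
    using subspace_add[OF S] by (auto intro: tendsto_add)
  then show "a + b \<in> closure S"
    unfolding closure_sequential by (intro exI[of _ "\<lambda>n. f n + g n"]) auto
next
  fix a and c :: real assume "a \<in> closure S"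
  then obtain f where "\<And>n. f n \<in> S" "f \<longlonglongrightarrow> a"
    unfolding closure_sequential by metis
  then have "\<And>n. c *\<^sub>R f n \<in> S" "(\<lambda>n. c *\<^sub>R f n) \<longlonglongrightarrow> c *\<^sub>R a"
    using subspace_scale[OF S] by (auto intro: tendsto_scaleR)
  then show "c *\<^sub>R a \<in> closure S"
    unfolding closure_sequential by (intro exI[of _ "\<lambda>n. c *\<^sub>R f n"]) auto
qed

lemma L2_sum_subspace:
  fixes g :: "'b \<Rightarrow> 'a::euclidean_space \<Rightarrow> complex"
  assumes V: "subspace V" and "finite Y"
    and g: "\<And>y. y \<in> Y \<Longrightarrow> abs_L2 (g y) \<in> V \<and> square_integrable (g y)"
  shows "abs_L2 (\<lambda>x. \<Sum>y\<in>Y. g y x) \<in> V \<and> square_integrable (\<lambda>x. \<Sum>y\<in>Y. g y x)"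
  using assms(2,3)
proof (induction Y)
  case empty
  then show ?case using subspace_0[OF V] by (simp add: abs_L2_zero square_integrable_zero)
next
  case (insert y Y)
  then show ?case
    using subspace_add[OF V] by (simp add: abs_L2_add square_integrable_add)
qed

lemma L2_dense_span:
  fixes B :: "'a::euclidean_space set set"
  assumes B: "topological_basis B" "countable B"
  defines "E \<equiv> (\<lambda>(G, n::nat, c). abs_L2 (\<lambda>x. indicator (\<Inter>G \<inter> ball 0 (real n)) x *\<^sub>R c)) `
      ({G. finite G \<and> G \<subseteq> B} \<times> UNIV \<times> {1, \<i>})"
  shows "closure (span E) = UNIV"
proof -
  let ?V = "closure (span E)"
  have V: "subspace ?V" by (intro closure_subspace subspace_span)
  have ball: "emeasure lborel (A \<inter> ball 0 (real n)) < \<infinity>" for A :: "'a set" and n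
  proof -
    have "emeasure lborel (A \<inter> ball 0 (real n)) \<le> emeasure lborel (ball (0::'a) (real n))"
      by (intro emeasure_mono) auto
    also have "\<dots> < \<infinity>" by (rule emeasure_lborel_ball_finite)
    finally show ?thesis .
  qed
  let ?i = "\<lambda>n c A. abs_L2 (\<lambda>x. indicator (A \<inter> ball 0 (real n)) x *\<^sub>R c)"
  have sq: "square_integrable (\<lambda>x. indicator (A \<inter> ball 0 (real n)) x *\<^sub>R c)"
    if "A \<in> sets borel" for A :: "'a set" and n c
    using that ball by (intro square_integrable_indicator) auto
  let ?G = "Inter ` {G. finite G \<and> G \<subseteq> B}"
  have opB: "open b" if "b \<in> B" for b
    using B(1) that by (rule topological_basis_open)
  have borelG: "sets borel = sigma_sets UNIV ?G"
  proof -
    have 1: "sets borel = sigma_sets UNIV B"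
      unfolding borel_eq_countable_basis[OF B(2,1)] by (rule sets_measure_of) simp
    have "sigma_sets UNIV B = sigma_sets UNIV ?G"
    proof (rule sigma_sets_eqI)
      fix b assume "b \<in> B"
      then have "\<Inter>{b} \<in> ?G" by (intro imageI) auto
      then show "b \<in> sigma_sets UNIV ?G" by (intro sigma_sets.Basic) simp
    next
      fix g assume "g \<in> ?G"
      then obtain H where "finite H" "H \<subseteq> B" "g = \<Inter>H" by auto
      then have "open g" using opB by (auto intro!: open_Inter)
      then have "g \<in> sets borel" by simp
      then show "g \<in> sigma_sets UNIV B" using 1 by simp
    qed
    with 1 show ?thesis by simp
  qed
  have ind: "?i n c A \<in> ?V" if A: "A \<in> sets borel" and c: "c \<in> {1, \<i>}" for A n c
  proof -
    have "Int_stable ?G"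
    proof (rule Int_stableI)
      fix a b assume "a \<in> ?G" "b \<in> ?G"
      then obtain H K where "finite H" "H \<subseteq> B" "a = \<Inter>H" "finite K" "K \<subseteq> B" "b = \<Inter>K" by auto
      then have "a \<inter> b = \<Inter>(H \<union> K)" "finite (H \<union> K)" "H \<union> K \<subseteq> B" by auto
      then show "a \<inter> b \<in> ?G" by blast
    qed
    moreover have "?G \<subseteq> Pow UNIV" by simp
    moreover have "A \<in> sigma_sets UNIV ?G" using A borelG by simp
    ultimately show ?thesis
    proof (induction rule: sigma_sets_induct_disjoint)
      case (basic A)
      then obtain H where H: "finite H" "H \<subseteq> B" "A = \<Inter>H" by auto
      then have "?i n c A \<in> E"
        unfolding E_def using c by (intro image_eqI[of _ _ "(H, n, c)"]) auto
      then show ?case using closure_subset span_base by blast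
    next
      case empty
      show ?case using subspace_0[OF V] by (simp add: abs_L2_zero)
    next
      case (compl A)
      have A': "A \<in> sets borel" using compl(1) borelG by simp
      have "\<Inter>{} \<in> ?G" by blast
      then have "?i n c UNIV \<in> E" unfolding E_def using c by (auto intro!: image_eqI[of _ _ "({}, n, c)"])
      then have "?i n c UNIV \<in> ?V" using closure_subset span_base by blast
      then have "?i n c UNIV - ?i n c A \<in> ?V"
        using compl(2) by (rule subspace_diff[OF V])
      also have "?i n c UNIV - ?i n c A = ?i n c (UNIV - A)"
        using sq[OF A'] sq[of UNIV] by (subst abs_L2_diff[symmetric])
          (auto simp: indicator_def fun_eq_iff intro!: arg_cong[where f=abs_L2])
      finally show ?case .
    next
      case (union A)
      have A' [measurable]: "A k \<in> sets borel" for k using union(2) borelG by auto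
      let ?s = "\<lambda>m x. \<Sum>k<m. indicator (A k \<inter> ball 0 (real n)) x *\<^sub>R c"
      have s_eq: "?s m x = indicator ((\<Union>k<m. A k) \<inter> ball 0 (real n)) x *\<^sub>R c" for m x
      proof -
        have "indicator (\<Union>k<m. A k \<inter> ball 0 (real n)) x
            = (\<Sum>k<m. indicator (A k \<inter> ball 0 (real n)) x :: real)"
          using union(1) by (intro indicator_UN_disjoint) (auto simp: disjoint_family_on_def)
        moreover have "(\<Union>k<m. A k \<inter> ball 0 (real n)) = (\<Union>k<m. A k) \<inter> ball 0 (real n)" by auto
        ultimately show ?thesis by (simp add: scaleR_sum_left)
      qed
      have part: "abs_L2 (?s m) \<in> ?V \<and> square_integrable (?s m)" for m
        by (rule L2_sum_subspace[OF V]) (use union(3) sq[OF A'] in auto)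
      have "(\<lambda>m. abs_L2 (?s m)) \<longlonglongrightarrow> ?i n c (\<Union>k. A k)"
      proof (rule L2_tendsto_dominated(1)[where w="\<lambda>x. (norm (indicator ((\<Union>k. A k) \<inter> ball 0 (real n)) x *\<^sub>R c))\<^sup>2"])
        show "square_integrable (\<lambda>x. indicator ((\<Union>k. A k) \<inter> ball 0 (real n)) x *\<^sub>R c)"
          by (rule sq) simp
        then show "integrable lborel (\<lambda>x. (norm (indicator ((\<Union>k. A k) \<inter> ball 0 (real n)) x *\<^sub>R c))\<^sup>2)"
          by (simp add: square_integrable_def)
        show "AE x in lborel. (norm (indicator ((\<Union>k. A k) \<inter> ball 0 (real n)) x *\<^sub>R c - ?s m x))\<^sup>2
            \<le> (norm (indicator ((\<Union>k. A k) \<inter> ball 0 (real n)) x *\<^sub>R c))\<^sup>2" for m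
          unfolding s_eq by (auto simp: indicator_def)
        show "AE x in lborel. (\<lambda>m. ?s m x) \<longlonglongrightarrow> indicator ((\<Union>k. A k) \<inter> ball 0 (real n)) x *\<^sub>R c"
        proof (intro AE_I2)
          fix x
          show "(\<lambda>m. ?s m x) \<longlonglongrightarrow> indicator ((\<Union>k. A k) \<inter> ball 0 (real n)) x *\<^sub>R c"
          proof (cases "x \<in> (\<Union>k. A k)")
            case True
            then obtain j where j: "x \<in> A j" by auto
            have "\<forall>\<^sub>F m in sequentially. ?s m x = indicator ((\<Union>k. A k) \<inter> ball 0 (real n)) x *\<^sub>R c"
              unfolding s_eq using eventually_gt_at_top[of j]
              by eventually_elim (use j in \<open>auto simp: indicator_def\<close>)
            then show ?thesis by (rule tendsto_eventually)
          next
            case False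
            then show ?thesis unfolding s_eq by (auto simp: indicator_def)
          qed
        qed
      qed simp
      then show ?case
        by (rule closed_sequentially[OF closed_closure, rotated]) (use part in auto)
    qed
  qed
  have ind': "?i n c A \<in> ?V" if A: "A \<in> sets borel" for A n c
  proof -
    have "?i n c A = abs_L2 (\<lambda>x. Re c *\<^sub>R indicator (A \<inter> ball 0 (real n)) x *\<^sub>R 1
        + Im c *\<^sub>R indicator (A \<inter> ball 0 (real n)) x *\<^sub>R \<i>)"
      by (rule arg_cong[where f=abs_L2]) (auto simp: fun_eq_iff indicator_def complex_eq_iff)
    also have "\<dots> = Re c *\<^sub>R ?i n 1 A + Im c *\<^sub>R ?i n \<i> A"
      using abs_L2_add[OF square_integrable_scaleR[OF sq[OF A]] square_integrable_scaleR[OF sq[OF A]]]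
      by (simp only: abs_L2_scaleR[OF sq[OF A]])
    finally show ?thesis
      using ind[OF A] by (auto intro!: subspace_add[OF V] subspace_scale[OF V])
  qed
  show ?thesis
  proof (intro set_eqI iffI UNIV_I)
    fix F :: "'a L2"
    let ?f = "rep_L2 F"
    obtain s where s: "\<And>i. simple_function lborel (s i)" "\<And>x. (\<lambda>i. s i x) \<longlonglongrightarrow> ?f x"
        "\<And>i x. norm (s i x) \<le> 2 * norm (?f x)"
      using borel_measurable_implies_sequence_metric[of ?f lborel 0] by auto
    have s_borel [measurable]: "s i \<in> borel_measurable borel" for i
      using borel_measurable_simple_function[OF s(1)[of i]] by simp
    let ?s = "\<lambda>i x. indicator (ball 0 (real i)) x *\<^sub>R s i x"
    have part: "abs_L2 (?s i) \<in> ?V" for i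
    proof -
      let ?g = "\<lambda>y x. indicator (s i -` {y} \<inter> ball 0 (real i)) x *\<^sub>R y"
      have fin: "finite (range (s i))"
        using simple_functionD(1)[OF s(1)[of i]] by simp
      have eq: "?s i = (\<lambda>x. \<Sum>y\<in>range (s i). ?g y x)"
      proof
        fix x
        have "(\<Sum>y\<in>range (s i). ?g y x) = (\<Sum>y\<in>range (s i). if y = s i x then ?s i x else 0)"
          by (intro sum.cong) (auto simp: indicator_def)
        also have "\<dots> = ?s i x" using fin by simp
        finally show "?s i x = (\<Sum>y\<in>range (s i). ?g y x)" by simp
      qed
      have pre: "s i -` {y} \<in> sets borel" for y
        using measurable_sets[of "s i" borel borel "{y}"] by simp
      have "abs_L2 (?g y) \<in> ?V \<and> square_integrable (?g y)" for y
        using ind'[OF pre] sq[OF pre] by blast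
      then show ?thesis
        unfolding eq using L2_sum_subspace[OF V fin, of ?g] by blast
    qed
    have "(\<lambda>i. abs_L2 (?s i)) \<longlonglongrightarrow> abs_L2 ?f"
    proof (rule L2_tendsto_dominated(1)[where w="\<lambda>x. 9 * (norm (?f x))\<^sup>2"])
      show "integrable lborel (\<lambda>x. 9 * (norm (?f x))\<^sup>2)"
        using square_integrable_rep[of F] by (simp add: square_integrable_def)
      show "AE x in lborel. (norm (?f x - ?s i x))\<^sup>2 \<le> 9 * (norm (?f x))\<^sup>2" for i
      proof (intro AE_I2)
        fix x
        have "norm (?f x - ?s i x) \<le> norm (?f x) + norm (?s i x)" by (rule norm_triangle_ineq4)
        also have "\<dots> \<le> 3 * norm (?f x)" using s(3)[of i x] by (auto simp: indicator_def)
        finally have "(norm (?f x - ?s i x))\<^sup>2 \<le> (3 * norm (?f x))\<^sup>2" by (intro power_mono) auto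
        then show "(norm (?f x - ?s i x))\<^sup>2 \<le> 9 * (norm (?f x))\<^sup>2" by (simp add: power_mult_distrib)
      qed
      show "AE x in lborel. (\<lambda>i. ?s i x) \<longlonglongrightarrow> ?f x"
      proof (intro AE_I2)
        fix x :: 'a
        obtain k :: nat where k: "norm x < real k" using reals_Archimedean2 by blast
        have "\<forall>\<^sub>F i in sequentially. s i x = ?s i x"
          using eventually_ge_at_top[of k] by eventually_elim (use k in \<open>auto simp: indicator_def\<close>)
        then show "(\<lambda>i. ?s i x) \<longlonglongrightarrow> ?f x"
          using s(2)[of x] by (rule Lim_transform_eventually[rotated])
      qed
      show "?s i \<in> borel_measurable borel" for i
        using s_borel[of i] by (intro borel_measurable_scaleR borel_measurable_indicator) auto
    qed simp
    then have "abs_L2 ?f \<in> ?V"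
      by (rule closed_sequentially[OF closed_closure, rotated]) (rule part)
    then show "F \<in> ?V" by simp
  qed
qed

lemma countable_dense_closure_span:
  fixes E :: "'v::real_normed_vector set"
  assumes "countable E"
  shows "\<exists>D. countable D \<and> span E \<subseteq> closure D"
proof -
  define D where "D = (\<lambda>xs. \<Sum>(q, e)\<leftarrow>xs. of_rat q *\<^sub>R e) ` lists ((UNIV :: rat set) \<times> E)"
  have "countable D"
    unfolding D_def using assms by (intro countable_image countable_lists countable_SIGMA) auto
  have D0: "0 \<in> D" unfolding D_def by (rule image_eqI[of _ _ "[]"]) auto
  have D_add: "a + b \<in> D" if "a \<in> D" "b \<in> D" for a b
  proof -
    obtain xs ys where "xs \<in> lists (UNIV \<times> E)" "a = (\<Sum>(q, e)\<leftarrow>xs. of_rat q *\<^sub>R e)"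
       "ys \<in> lists (UNIV \<times> E)" "b = (\<Sum>(q, e)\<leftarrow>ys. of_rat q *\<^sub>R e)"
      using \<open>a \<in> D\<close> \<open>b \<in> D\<close> unfolding D_def by blast
    then show ?thesis unfolding D_def by (intro image_eqI[of _ _ "xs @ ys"]) auto
  qed
  have scal: "r *\<^sub>R e \<in> closure D" if "e \<in> E" for r e
  proof -
    have "of_rat q *\<^sub>R e \<in> D" for q
      unfolding D_def using that by (intro image_eqI[of _ _ "[(q, e)]"]) auto
    then have sub: "(\<lambda>r. r *\<^sub>R e) ` \<rat> \<subseteq> D" by (auto simp: Rats_def)
    have rat: "closure \<rat> = (UNIV :: real set)"
    proof -
      have "\<exists>y\<in>\<rat>. dist y x < d" if "d > 0" for x d :: real
      proof -
        obtain y where "y \<in> \<rat>" "x < y" "y < x + d"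
          using Rats_dense_in_real[of x "x + d"] \<open>d > 0\<close> by (metis less_add_same_cancel1)
        then show ?thesis by (intro bexI[of _ y]) (auto simp: dist_real_def)
      qed
      then show ?thesis by (auto simp: closure_approachable)
    qed
    have "(\<lambda>r. r *\<^sub>R e) ` closure \<rat> \<subseteq> closure ((\<lambda>r. r *\<^sub>R e) ` \<rat>)"
      by (intro continuous_image_closure_subset[where A=UNIV] continuous_intros) simp
    also have "\<dots> \<subseteq> closure D" using sub by (rule closure_mono)
    finally show ?thesis using rat by auto
  qed
  have clD_add: "a + b \<in> closure D" if "a \<in> closure D" "b \<in> closure D" for a b
  proof -
    obtain f g where "\<And>n. f n \<in> D" "f \<longlonglongrightarrow> a" "\<And>n. g n \<in> D" "g \<longlonglongrightarrow> b"
      using \<open>a \<in> closure D\<close> \<open>b \<in> closure D\<close> unfolding closure_sequential by metis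
    then have "\<And>n. f n + g n \<in> D" "(\<lambda>n. f n + g n) \<longlonglongrightarrow> a + b"
      using D_add by (auto intro: tendsto_add)
    then show ?thesis unfolding closure_sequential by (intro exI[of _ "\<lambda>n. f n + g n"]) auto
  qed
  have "v \<in> closure D" if "v \<in> span E" for v
    using that
  proof (induction rule: span_induct_alt)
    case base
    then show ?case using D0 closure_subset by blast
  next
    case (step c x y)
    then show ?case using clD_add scal by blast
  qed
  with \<open>countable D\<close> show ?thesis by blast
qed

instance L2 :: (euclidean_space) second_countable_topology
proof
  obtain B :: "'a set set" where B: "countable B" "topological_basis B"
    using ex_countable_basis by blast
  define E where "E = (\<lambda>(G, n::nat, c). abs_L2 (\<lambda>x. indicator (\<Inter>G \<inter> ball 0 (real n)) x *\<^sub>R c)) `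
      ({G. finite G \<and> G \<subseteq> B} \<times> UNIV \<times> {1, \<i>})"
  have "countable {G. finite G \<and> G \<subseteq> B}"
    using B(1) by (rule countable_Collect_finite_subset)
  then have "countable E" unfolding E_def by (intro countable_image countable_SIGMA) auto
  then obtain D where D: "countable D" "span E \<subseteq> closure D"
    using countable_dense_closure_span by blast
  have "closure (span E) = UNIV"
    unfolding E_def using B by (intro L2_dense_span)
  with D(2) have cD: "closure D = UNIV"
    by (metis closed_closure closure_minimal top.extremum_uniqueI)
  let ?B = "(\<lambda>(x, n). ball x (1 / real (Suc n))) ` (D \<times> UNIV)"
  have "countable ?B" using D(1) by auto
  moreover have "topological_basis ?B"
  proof (rule topological_basisI)
    fix b assume "b \<in> ?B" then show "open b" by auto
  next
    fix U :: "'a L2 set" and f assume "open U" "f \<in> U"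
    then obtain e where e: "e > 0" "ball f e \<subseteq> U" by (meson open_contains_ball)
    then obtain n where n: "1 / real (Suc n) < e / 2" using nat_approx_posE[of "e/2"] by auto
    have "f \<in> closure D" using cD by simp
    then obtain d where d: "d \<in> D" "dist d f < 1 / real (Suc n)"
      unfolding closure_approachable by (metis of_nat_0_less_iff zero_less_Suc zero_less_divide_1_iff)
    have "ball d (1 / real (Suc n)) \<subseteq> ball f e"
    proof
      fix y assume "y \<in> ball d (1 / real (Suc n))"
      then have "dist d y < e / 2" "dist f d < e / 2" using n d by (auto simp: dist_commute)
      then show "y \<in> ball f e" using dist_triangle[of f y d] by simp
    qed
    then show "\<exists>b\<in>?B. f \<in> b \<and> b \<subseteq> U"
      using d e by (intro bexI[of _ "ball d (1 / real (Suc n))"]) auto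
  qed
  ultimately show "\<exists>B::'a L2 set set. countable B \<and> open = generate_topology B"
    by (metis topological_basis_imp_subbasis)
qed

lift_definition scaleC_L2 :: "complex \<Rightarrow> 'a::euclidean_space L2 \<Rightarrow> 'a L2" (infixr \<open>*\<^sub>C\<close> 75)
  is "\<lambda>c f x. c * f x"
  unfolding L2_rel_def
  by (elim conjE, intro conjI square_integrable_cmult, assumption, assumption, erule eventually_mono, simp)

text \<open>The value \<open>0\<close> for functions that are not square integrable is a dummy.\<close>

definition L2_of :: "('a::euclidean_space \<Rightarrow> complex) \<Rightarrow> 'a L2" where
  "L2_of f = (if square_integrable f then abs_L2 f else 0)"

lemma L2_of_AE: "square_integrable f \<Longrightarrow> AE x in lborel. rep_L2 (L2_of f) x = f x"
  by (simp add: L2_of_def rep_abs_L2_AE)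

lemma L2_of_rep [simp]: "L2_of (rep_L2 f) = f"
  by (simp add: L2_of_def)

lemma L2_of_cong: "square_integrable f \<Longrightarrow> square_integrable g \<Longrightarrow>
    AE x in lborel. f x = g x \<Longrightarrow> L2_of f = L2_of g"
  by (simp add: L2_of_def) (rule abs_L2_cong)

lemma scaleC_L2_of: "square_integrable f \<Longrightarrow> c *\<^sub>C L2_of f = L2_of (\<lambda>x. c * f x)"
  by (simp add: L2_of_def scaleC_L2.abs_eq L2_rel_def square_integrable_cmult)

text \<open>
  The Fourier transform on \<open>L\<^sup>2\<close> is the \<open>L\<^sup>2\<close>-limit of the transforms of the truncations to balls,
  which are in \<open>L\<^sup>1\<close> and \<open>L\<^sup>2\<close>; the limit exists by Plancherel's theorem.
  The unitary normalisation is used: \<open>\<sigma> = -1\<close> gives the transform and \<open>\<sigma> = 1\<close> its inverse.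
\<close>

definition truncated_fourier :: "real \<Rightarrow> nat \<Rightarrow> 'a::euclidean_space L2 \<Rightarrow> 'a \<Rightarrow> complex" where
  "truncated_fourier \<sigma> n f \<xi> =
     complex_of_real ((2 * pi) powr (- (real DIM('a) / 2))) *
     (LINT x:cball 0 (real n)|lborel. exp (\<i> * complex_of_real (\<sigma> * (x \<bullet> \<xi>))) * rep_L2 f x)"

definition fourier_L2 :: "'a::euclidean_space L2 \<Rightarrow> 'a L2" where
  "fourier_L2 f = lim (\<lambda>n. L2_of (truncated_fourier (- 1) n f))"

definition inverse_fourier_L2 :: "'a::euclidean_space L2 \<Rightarrow> 'a L2" where
  "inverse_fourier_L2 f = lim (\<lambda>n. L2_of (truncated_fourier 1 n f))"

text \<open>\<open>U(t) = e\<^bsup>it\<Delta>\<^esup>\<close> is the Fourier multiplier with symbol \<open>exp (- i t |\<xi>|\<^sup>2)\<close>.\<close>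

definition schroedinger_group :: "real \<Rightarrow> 'a::euclidean_space L2 \<Rightarrow> 'a L2" where
  "schroedinger_group t f =
     inverse_fourier_L2 (L2_of (\<lambda>\<xi>. exp (- \<i> * complex_of_real (t * (norm \<xi>)\<^sup>2)) * rep_L2 (fourier_L2 f) \<xi>))"

text \<open>Powers with a positive exponent; in particular \<open>\<infinity>\<^sup>p = \<infinity>\<close>.\<close>

definition ennreal_powr :: "ennreal \<Rightarrow> real \<Rightarrow> ennreal" where
  "ennreal_powr x p = (if x = \<infinity> then \<infinity> else ennreal (enn2real x powr p))"

definition Lp_norm :: "real \<Rightarrow> 'b measure \<Rightarrow> ('b \<Rightarrow> ennreal) \<Rightarrow> ennreal" where
  "Lp_norm p M f = ennreal_powr (\<integral>\<^sup>+x. ennreal_powr (f x) p \<partial>M) (1 / p)"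

text \<open>The norm of \<open>L\<^sup>p\<^sub>t(J; L\<^sup>q\<^sub>x)\<close>, for a curve of \<open>L\<^sup>2\<close> functions of \<open>x\<close>.\<close>

definition mixed_norm :: "real \<Rightarrow> real \<Rightarrow> real set \<Rightarrow> (real \<Rightarrow> 'a::euclidean_space L2) \<Rightarrow> ennreal" where
  "mixed_norm p q J v =
     Lp_norm p (restrict_space lborel J)
       (\<lambda>t. Lp_norm q lborel (\<lambda>x. ennreal (norm (rep_L2 (v t) x))))"

text \<open>
  The weighted space \<open>H\<^bsup>0,s\<^esup>\<close> for \<open>s \<ge> 0\<close>. As \<open>\<langle>x\<rangle>\<^sup>s \<ge> 1\<close>, a tempered distribution \<open>f\<close>
  with \<open>\<langle>x\<rangle>\<^sup>s f \<in> L\<^sup>2\<close> is in \<open>L\<^sup>2\<close>, so that no distributions are needed.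
\<close>

definition weighted_L2 :: "real \<Rightarrow> 'a::euclidean_space L2 set" where
  "weighted_L2 s =
     {f. square_integrable (\<lambda>x. complex_of_real (sqrt (1 + (norm x)\<^sup>2) powr s) * rep_L2 f x)}"

definition homogeneous_of_degree :: "real \<Rightarrow> (complex \<Rightarrow> complex) \<Rightarrow> bool" where
  "homogeneous_of_degree p F \<longleftrightarrow>
     (\<forall>z. \<forall>r>0. F (complex_of_real r * z) = complex_of_real (r powr p) * F z)"

definition nonlin_coeff :: "(complex \<Rightarrow> complex) \<Rightarrow> int \<Rightarrow> complex" where
  "nonlin_coeff F n =
     complex_of_real (1 / (2 * pi)) *
     (LINT \<theta>:{0..2 * pi}|lborel.
        F (exp (\<i> * complex_of_real \<theta>)) * exp (- \<i> * of_int n * complex_of_real \<theta>))"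

text \<open>\<open>F\<^sub>n(z) = |z|\<^bsup>1+2/d-n\<^esup> z\<^sup>n\<close>, which is \<open>0\<close> at \<open>z = 0\<close> for every \<open>n\<close> because \<open>0 powr a = 0\<close>.\<close>

definition nonlin_mode :: "nat \<Rightarrow> int \<Rightarrow> complex \<Rightarrow> complex" where
  "nonlin_mode d n z = complex_of_real (norm z powr (1 + 2 / real d - real_of_int n)) * z powi n"

text \<open>
  A solution is a curve in \<open>L\<^sup>2\<close>; its values outside \<open>I\<close> are irrelevant. The \<open>L\<^sup>q\<^sub>t\<^sub>,\<^sub>x\<close> bound
  with \<open>q = 2(d+2)/d\<close> makes \<open>F(u(s))\<close> square integrable for almost every \<open>s\<close> if \<open>F\<close> grows like
  \<open>|z|\<^bsup>1+2/d\<^esup>\<close>, so the integral in Duhamel's formula is a Bochner integral in \<open>L\<^sup>2\<close>. Its existence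
  is part of the formula, since the library integral of a non-integrable function is \<open>0\<close>.
\<close>

definition NLS_solution ::
    "(complex \<Rightarrow> complex) \<Rightarrow> real set \<Rightarrow> (real \<Rightarrow> 'a::euclidean_space L2) \<Rightarrow> bool" where
  "NLS_solution F I u \<longleftrightarrow>
     continuous_on I u \<and>
     (\<forall>K. compact K \<and> K \<subseteq> I \<longrightarrow>
        mixed_norm (2 * (real DIM('a) + 2) / real DIM('a)) (2 * (real DIM('a) + 2) / real DIM('a)) K u < \<infinity>) \<and>
     (\<forall>t1\<in>I. \<forall>t2\<in>I.
        interval_lebesgue_integrable lborel (ereal t1) (ereal t2)
          (\<lambda>s. schroedinger_group (t2 - s) (L2_of (\<lambda>x. F (rep_L2 (u s) x)))) \<and>
        u t2 = schroedinger_group (t2 - t1) (u t1) -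
          \<i> *\<^sub>C (LBINT s=ereal t1..ereal t2.
                 schroedinger_group (t2 - s) (L2_of (\<lambda>x. F (rep_L2 (u s) x)))))"

end

theory Submission
  imports Defs
    "HOL-Probability.Characteristic_Functions"
    "HOL-Complex_Analysis.Conformal_Mappings"
    "HOL-Real_Asymp.Real_Asymp"
begin

text \<open>
  Let \<open>\<phi> = \<F> u\<^sub>+\<close>. Pairing Duhamel's formula on \<open>[t, 2t]\<close> with \<open>U(2t) \<eta>\<close> shows that
  \<open>\<integral> \<langle>F(u(s)), U(s) \<eta>\<rangle> ds\<close> over \<open>[t, 2t]\<close> tends to \<open>0\<close> for every \<open>\<eta>\<close> in \<open>L\<^sup>2\<close>.
  By the factorisation \<open>U(s) = M(s) D(s) \<F> M(s)\<close> and the endpoint Sobolev inequality, \<open>u(s)\<close> may be replaced by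
  \<open>M(s) D(s) \<phi>\<close> and \<open>U(s) \<eta>\<close> by \<open>M(s) D(s) \<F> \<eta>\<close>. After rescaling \<open>x = 2sy\<close> the integrand becomes
  \<open>(2s)\<^sup>-\<^sup>1 \<Sum>\<^sub>n g\<^sub>n \<integral> exp (i (n - 1) s |y|\<^sup>2) F\<^sub>n(\<phi>) (\<F> \<eta>)\<^sup>* dy\<close> up to constant phases, and all modes but the
  resonant one \<open>n = 1\<close> average out. Hence \<open>ln 2 / 2\<close> times the pairing of \<open>g\<^sub>1 |\<phi>|\<^bsup>2/d\<^esup> \<phi>\<close> with \<open>\<F> \<eta>\<close> vanishes
  for all \<open>\<eta>\<close>, so \<open>\<phi> = 0\<close>.
\<close>

section \<open>Gaussian integrals\<close>

text \<open>All exponents are critical. Put p = 1 + 2/d and q = 2p = 2(d+2)/d. A free wave has an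
  L^q mass (the q-th power of the norm) of order s^(-2), so its image under F has L2 norm of order
  1/s. Over a dyadic interval this neither decays nor diverges: 1/(2s) has integral ln 2 / 2 over
  [t, 2t] for every t. The rate t^(d/(2(d+2))) = t^(1/q) in the hypothesis says that the mass of u -
  U(s) u_+ on [t, \<infinity>) is o(1/t), hence o(s^(-2)) on average over [t, 2t]. This is just
  small enough to replace u by the profile. The weight exponent d/(d+2) = d(1/2 - 1/q) is the
  Sobolev exponent that puts \<phi> into L^q. Then |\<phi>|^p is in L2, every pairing makes sense
  for arbitrary \<eta> in L2, and at the end the transform of \<eta> can be taken to be the resonant
  term itself. F is only known to be continuous and homogeneous, so differences of F are controlled
  by uniform continuity on the unit circle instead of a Lipschitz bound.\<close>

lemma has_bochner_integral_gaussian_real: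
  fixes a x :: real
  assumes a: "a > 0"
  shows "has_bochner_integral lborel (\<lambda>\<xi>. exp (- complex_of_real a * complex_of_real (\<xi>\<^sup>2) + \<i> * complex_of_real (x * \<xi>)))
    (complex_of_real (sqrt (pi / a) * exp (- x\<^sup>2 / (4 * a))))"
proof -
  \<comment> \<open>Substituting y = \<open>?s\<close> \<xi> turns the Gaussian into the standard
    normal density, so up to normalisation the integral is the characteristic function of that law
    at x / \<open>?s\<close>.\<close>
  let ?s = "sqrt (2 * a)"
  have s: "?s > 0" using a by simp
  interpret real_distribution std_normal_distribution by (rule real_dist_normal_dist)
  have int: "integrable lborel (\<lambda>y. std_normal_density y *\<^sub>R iexp (x / ?s * y))"
  proof -
    have "integrable std_normal_distribution (\<lambda>y. iexp (x / ?s * y))" by (rule integrable_iexp) auto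
    then show "integrable lborel (\<lambda>y. std_normal_density y *\<^sub>R iexp (x / ?s * y))"
      by (subst (asm) integrable_density) auto
  qed
  have "(LBINT y. std_normal_density y *\<^sub>R iexp (x / ?s * y)) = char std_normal_distribution (x / ?s)"
    unfolding char_def by (subst integral_density) auto
  also have "\<dots> = exp (- ((x / ?s)\<^sup>2) / 2)" by (simp add: char_std_normal_distribution)
  finally have "has_bochner_integral lborel (\<lambda>y. std_normal_density y *\<^sub>R iexp (x / ?s * y))
      (complex_of_real (exp (- ((x / ?s)\<^sup>2) / 2)))"
    using int by (simp add: has_bochner_integral_iff)
  then have "has_bochner_integral lborel (\<lambda>\<xi>. std_normal_density (0 + ?s * \<xi>) *\<^sub>R iexp (x / ?s * (0 + ?s * \<xi>)))
      (complex_of_real (exp (- ((x / ?s)\<^sup>2) / 2)) /\<^sub>R \<bar>?s\<bar>)"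
    using s by (subst (asm) lborel_has_bochner_integral_real_affine_iff[where c="?s" and t=0]) auto
  then have "has_bochner_integral lborel (\<lambda>\<xi>. sqrt (2 * pi) *\<^sub>R (std_normal_density (0 + ?s * \<xi>) *\<^sub>R iexp (x / ?s * (0 + ?s * \<xi>))))
      (sqrt (2 * pi) *\<^sub>R (complex_of_real (exp (- ((x / ?s)\<^sup>2) / 2)) /\<^sub>R \<bar>?s\<bar>))"
    by (rule has_bochner_integral_scaleR_right)
  also have "(\<lambda>\<xi>. sqrt (2 * pi) *\<^sub>R (std_normal_density (0 + ?s * \<xi>) *\<^sub>R iexp (x / ?s * (0 + ?s * \<xi>))))
      = (\<lambda>\<xi>. exp (- complex_of_real a * complex_of_real (\<xi>\<^sup>2) + \<i> * complex_of_real (x * \<xi>)))"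
  proof
    fix \<xi> :: real
    have "- (?s * \<xi>)\<^sup>2 / 2 = - a * \<xi>\<^sup>2" using a by (simp add: power_mult_distrib)
    moreover have "sqrt (2 * pi) * std_normal_density (?s * \<xi>) = exp (- (?s * \<xi>)\<^sup>2 / 2)"
      unfolding std_normal_density_def by (simp add: real_sqrt_mult)
    ultimately have e: "sqrt (2 * pi) * std_normal_density (?s * \<xi>) = exp (- a * \<xi>\<^sup>2)" by simp
    have "sqrt (2 * pi) *\<^sub>R (std_normal_density (0 + ?s * \<xi>) *\<^sub>R iexp (x / ?s * (0 + ?s * \<xi>)))
      = complex_of_real (sqrt (2 * pi) * std_normal_density (?s * \<xi>)) * iexp (x * \<xi>)"
      using s by (simp add: scaleR_conv_of_real)
    also have "\<dots> = complex_of_real (exp (- a * \<xi>\<^sup>2)) * iexp (x * \<xi>)" unfolding e by simp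
    finally show "sqrt (2 * pi) *\<^sub>R (std_normal_density (0 + ?s * \<xi>) *\<^sub>R iexp (x / ?s * (0 + ?s * \<xi>)))
      = exp (- complex_of_real a * complex_of_real (\<xi>\<^sup>2) + \<i> * complex_of_real (x * \<xi>))"
      by (simp add: exp_of_real[symmetric] mult_exp_exp)
  qed
  also have "sqrt (2 * pi) *\<^sub>R (complex_of_real (exp (- ((x / ?s)\<^sup>2) / 2)) /\<^sub>R \<bar>?s\<bar>)
     = complex_of_real (sqrt (pi / a) * exp (- x\<^sup>2 / (4 * a)))"
  proof -
    have "sqrt (2 * pi) / ?s = sqrt (pi / a)" using a by (simp add: real_sqrt_divide[symmetric])
    moreover have "- ((x / ?s)\<^sup>2) / 2 = - x\<^sup>2 / (4 * a)" using a by (simp add: power_divide)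
    ultimately show ?thesis using s
      by (simp add: scaleR_conv_of_real field_simps flip: of_real_mult of_real_divide)
  qed
  finally show ?thesis .
qed

text \<open>Lebesgue measure on the Euclidean space is the image of the product measure over
  \<open>Basis\<close> under the coordinate map. Fubini then reduces separable integrands, the
  Gaussian among them, to one dimension.\<close>

lemma
  fixes f :: "'a::euclidean_space \<Rightarrow> real \<Rightarrow> complex"
  assumes f: "\<And>b. b \<in> Basis \<Longrightarrow> integrable lborel (f b)"
  shows integrable_lborel_prod: "integrable lborel (\<lambda>x::'a. \<Prod>b\<in>Basis. f b (x \<bullet> b))"
    and integral_lborel_prod: "(LBINT x. (\<Prod>b\<in>Basis. f b (x \<bullet> b))) = (\<Prod>b\<in>Basis. \<integral>x. f b x \<partial>lborel)"
proof -
  interpret product_sigma_finite "\<lambda>b::'a. lborel :: real measure" by standard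
  have meas: "(\<lambda>x::'a. \<Prod>b\<in>Basis. f b (x \<bullet> b)) \<in> borel_measurable borel"
    using f by (intro borel_measurable_prod measurable_compose[OF _ borel_measurable_integrable[OF f, unfolded measurable_lborel1 measurable_lborel2]]) auto
  have T: "(\<lambda>g. \<Sum>b\<in>Basis. g b *\<^sub>R b) \<in> measurable (\<Pi>\<^sub>M b\<in>Basis. lborel) (borel :: 'a measure)"
    by measurable
  have eq: "(\<Prod>b\<in>Basis. f b ((\<Sum>c\<in>Basis. g c *\<^sub>R c) \<bullet> b)) = (\<Prod>b\<in>Basis. f b (g b))" for g :: "'a \<Rightarrow> real"
    by (intro prod.cong refl) simp
  show "integrable lborel (\<lambda>x::'a. \<Prod>b\<in>Basis. f b (x \<bullet> b))"
    by (subst lborel_eq, subst integrable_distr_eq[OF T]) (use meas f in \<open>auto simp: eq intro!: product_integrable_prod\<close>)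
  show "(LBINT x. (\<Prod>b\<in>Basis. f b (x \<bullet> b))) = (\<Prod>b\<in>Basis. \<integral>x. f b x \<partial>lborel)"
    by (subst lborel_eq, subst integral_distr[OF T]) (use meas f in \<open>auto simp: eq intro!: product_integral_prod\<close>)
qed

lemma
  fixes x :: "'a::euclidean_space" and a :: real
  assumes a: "a > 0"
  shows integrable_gaussian_iexp: "integrable lborel (\<lambda>\<xi>::'a. exp (- complex_of_real a * (norm \<xi>)\<^sup>2 + \<i> * complex_of_real (x \<bullet> \<xi>)))"
   and integral_gaussian_iexp: "(LBINT \<xi>. exp (- complex_of_real a * (norm \<xi>)\<^sup>2 + \<i> * complex_of_real (x \<bullet> \<xi>)))
       = complex_of_real (sqrt (pi / a) ^ DIM('a) * exp (- (norm x)\<^sup>2 / (4 * a)))"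
proof -
  let ?f = "\<lambda>b \<xi>. exp (- complex_of_real a * complex_of_real (\<xi>\<^sup>2) + \<i> * complex_of_real ((x \<bullet> b) * \<xi>))"
  have norm2: "(norm \<xi>)\<^sup>2 = (\<Sum>b\<in>Basis. (\<xi> \<bullet> b)\<^sup>2)" for \<xi> :: 'a
    unfolding power2_norm_eq_inner by (subst euclidean_inner) (simp add: power2_eq_square)
  have eq: "exp (- complex_of_real a * (norm \<xi>)\<^sup>2 + \<i> * complex_of_real (x \<bullet> \<xi>)) = (\<Prod>b\<in>Basis. ?f b (\<xi> \<bullet> b))" for \<xi> :: 'a
    by (subst exp_sum[symmetric], simp)
      (simp add: norm2 euclidean_inner[of x \<xi>] sum_subtractf sum.distrib sum_negf sum_distrib_left flip: of_real_power)
  note h = has_bochner_integral_gaussian_real[OF a, unfolded has_bochner_integral_iff]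
  show "integrable lborel (\<lambda>\<xi>::'a. exp (- complex_of_real a * (norm \<xi>)\<^sup>2 + \<i> * complex_of_real (x \<bullet> \<xi>)))"
    unfolding eq using h by (intro integrable_lborel_prod) auto
  have "(LBINT \<xi>. exp (- complex_of_real a * (norm \<xi>)\<^sup>2 + \<i> * complex_of_real (x \<bullet> \<xi>)))
     = (\<Prod>b\<in>(Basis::'a set). complex_of_real (sqrt (pi / a) * exp (- (x \<bullet> b)\<^sup>2 / (4 * a))))"
    unfolding eq using h by (subst integral_lborel_prod) (auto intro!: prod.cong)
  also have "\<dots> = complex_of_real (\<Prod>b\<in>(Basis::'a set). sqrt (pi / a) * exp (- (x \<bullet> b)\<^sup>2 / (4 * a)))" by simp
  also have "(\<Prod>b\<in>(Basis::'a set). sqrt (pi / a) * exp (- (x \<bullet> b)\<^sup>2 / (4 * a))) =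
      sqrt (pi / a) ^ DIM('a) * exp (- (norm x)\<^sup>2 / (4 * a))"
    by (simp add: prod.distrib norm2 exp_sum[symmetric] sum_negf sum_divide_distrib)
  finally show "(LBINT \<xi>. exp (- complex_of_real a * (norm \<xi>)\<^sup>2 + \<i> * complex_of_real (x \<bullet> \<xi>)))
       = complex_of_real (sqrt (pi / a) ^ DIM('a) * exp (- (norm x)\<^sup>2 / (4 * a)))" .
qed

lemma
  fixes a :: real
  assumes a: "a > 0"
  shows integrable_gaussian: "integrable lborel (\<lambda>\<xi>::'a::euclidean_space. exp (- a * (norm \<xi>)\<^sup>2))"
   and integral_gaussian: "(\<integral>\<xi>. exp (- a * (norm \<xi>)\<^sup>2) \<partial>(lborel :: 'a measure)) = sqrt (pi / a) ^ DIM('a)"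
proof -
  have eq: "exp (- complex_of_real a * (norm \<xi>)\<^sup>2 + \<i> * complex_of_real (0 \<bullet> \<xi>)) = complex_of_real (exp (- a * (norm \<xi>)\<^sup>2))" for \<xi> :: 'a
    by (simp add: exp_of_real[symmetric])
  show "integrable lborel (\<lambda>\<xi>::'a. exp (- a * (norm \<xi>)\<^sup>2))"
    using integrable_gaussian_iexp[OF a, of "0::'a"] unfolding eq complex_of_real_integrable_eq .
  show "(\<integral>\<xi>. exp (- a * (norm \<xi>)\<^sup>2) \<partial>(lborel :: 'a measure)) = sqrt (pi / a) ^ DIM('a)"
    using integral_gaussian_iexp[OF a, of "0::'a"] unfolding eq integral_complex_of_real of_real_eq_iff by simp
qed

text \<open>Mean value inequality on the half-plane Re z >= r, where the derivative in z has modulus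
  at most a exp (- r a). It dominates the difference quotients when Gaussian integrals are
  differentiated in z.\<close>

lemma exp_mult_diff_bound:
  fixes w z :: complex and a r :: real
  assumes "a \<ge> 0" "r > 0" "Re w \<ge> r" "Re z \<ge> r"
  shows "norm (exp (- w * complex_of_real a) - exp (- z * complex_of_real a)) \<le> norm (w - z) * (a * exp (- r * a))"
proof -
  have "norm (exp (- w * complex_of_real a) - exp (- z * complex_of_real a)) \<le> (a * exp (- r * a)) * norm (w - z)"
  proof (rule field_differentiable_bound[where S="{z. Re z \<ge> r}" and f'="\<lambda>z. - complex_of_real a * exp (- z * complex_of_real a)"])
    show "convex {z. Re z \<ge> r}" by (rule convex_halfspace_Re_ge)
    fix y assume "y \<in> {z. Re z \<ge> r}"
    then have "norm (exp (- y * complex_of_real a)) \<le> exp (- r * a)" 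
      using assms by (simp add: norm_exp_eq_Re mult_right_mono)
    then show "norm (- complex_of_real a * exp (- y * complex_of_real a)) \<le> a * exp (- r * a)"
      using assms by (simp add: norm_mult mult_left_mono)
    show "((\<lambda>z. exp (- z * complex_of_real a)) has_field_derivative - complex_of_real a * exp (- y * complex_of_real a)) (at y within {z. Re z \<ge> r})"
      by (auto intro!: derivative_eq_intros)
  qed (use assms in auto)
  then show ?thesis by (simp add: mult.commute)
qed

text \<open>Both sides are holomorphic in z on the right half-plane and agree for real z, so the
  identity theorem applies. Complex z are needed because the free evolution is the limit z
  \<rightarrow> i t. The principal root is holomorphic here since pi / z stays in the right
  half-plane.\<close>

lemma integral_gaussian_iexp_complex:
  fixes x :: "'a::euclidean_space" and z :: complex
  assumes z: "Re z > 0"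
  shows "integrable lborel (\<lambda>\<xi>::'a. exp (- z * complex_of_real ((norm \<xi>)\<^sup>2)) * iexp (x \<bullet> \<xi>))" (is "integrable _ (?f z)")
    and "(LBINT \<xi>. exp (- z * complex_of_real ((norm \<xi>)\<^sup>2)) * iexp (x \<bullet> \<xi>))
       = csqrt (complex_of_real pi / z) ^ DIM('a) * exp (- complex_of_real ((norm x)\<^sup>2) / (4 * z))" (is "?I z = ?J z")
proof -
  let ?H = "{z::complex. Re z > 0}"
  have int: "integrable lborel (?f z)" if "z \<in> ?H" for z
  proof (rule Bochner_Integration.integrable_bound)
    show "integrable lborel (\<lambda>\<xi>::'a. exp (- Re z * (norm \<xi>)\<^sup>2))"
      using that by (intro integrable_gaussian) simp
    show "AE \<xi> in lborel. norm (?f z \<xi>) \<le> norm (exp (- Re z * (norm \<xi>)\<^sup>2))"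
      by (simp add: norm_mult norm_exp_eq_Re)
  qed simp
  show "integrable lborel (?f z)" using int z by simp
  have der: "(?I has_field_derivative (LBINT \<xi>. - complex_of_real ((norm \<xi>)\<^sup>2) * ?f z \<xi>)) (at z)" if z: "z \<in> ?H" for z
    unfolding has_field_derivative_iff
  proof (subst tendsto_at_iff_sequentially, intro allI impI)
    fix X :: "nat \<Rightarrow> complex" assume X: "\<forall>i. X i \<in> UNIV - {z}" "X \<longlonglongrightarrow> z"
    \<comment> \<open>All but finitely many \<open>X n\<close> have real part above half of Re z,
      which leaves the decay exp (- r |\<xi>|^2) for the domination.\<close>
    define r where "r = Re z / 2"
    have r: "r > 0" using z by (simp add: r_def)
    have "eventually (\<lambda>n. Re (X n) > r) sequentially"
      using X(2) z by (intro order_tendstoD(1)[OF tendsto_Re]) (auto simp: r_def)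
    then obtain N where N: "\<And>n. n \<ge> N \<Longrightarrow> Re (X n) > r" by (auto simp: eventually_sequentially)
    let ?q = "\<lambda>n \<xi>. (?f (X n) \<xi> - ?f z \<xi>) / (X n - z)"
    have "(\<lambda>n. \<integral>\<xi>. ?q (n + N) \<xi> \<partial>lborel) \<longlonglongrightarrow> (LBINT \<xi>. - complex_of_real ((norm \<xi>)\<^sup>2) * ?f z \<xi>)"
    proof (rule integral_dominated_convergence)
      show "integrable lborel (\<lambda>\<xi>::'a. (2 / r) * exp (- (r / 2) * (norm \<xi>)\<^sup>2))"
        using r by (intro integrable_mult_right integrable_gaussian) simp
      show "AE \<xi> in lborel. norm (?q (n + N) \<xi>) \<le> (2 / r) * exp (- (r / 2) * (norm \<xi>)\<^sup>2)" for n
      proof (intro AE_I2)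
        fix \<xi> :: 'a
        let ?a = "(norm \<xi>)\<^sup>2"
        have "norm (?q (n + N) \<xi>) = norm (exp (- X (n + N) * complex_of_real ?a) - exp (- z * complex_of_real ?a)) / norm (X (n + N) - z)"
          by (simp add: norm_mult norm_divide flip: left_diff_distrib)
        also have "\<dots> \<le> ?a * exp (- r * ?a)"
          using exp_mult_diff_bound[of ?a r "X (n + N)" z] r N[of "n + N"] X(1)
          by (simp add: divide_le_eq mult.commute r_def)
        \<comment> \<open>The polynomial factor is absorbed at the price of half the decay
          rate.\<close>
        also have "\<dots> \<le> (2 / r) * exp ((r / 2) * ?a) * exp (- r * ?a)"
        proof (rule mult_right_mono)
          have "(r / 2) * ?a \<le> exp ((r / 2) * ?a)" using exp_ge_add_one_self[of "(r / 2) * ?a"] by linarith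
          then show "?a \<le> (2 / r) * exp ((r / 2) * ?a)" using r by (simp add: field_simps)
        qed simp
        also have "\<dots> = (2 / r) * exp (- (r / 2) * ?a)" by (simp add: mult_exp_exp algebra_simps)
        finally show "norm (?q (n + N) \<xi>) \<le> (2 / r) * exp (- (r / 2) * (norm \<xi>)\<^sup>2)" .
      qed
      show "AE \<xi> in lborel. (\<lambda>n. ?q (n + N) \<xi>) \<longlonglongrightarrow> - complex_of_real ((norm \<xi>)\<^sup>2) * ?f z \<xi>"
      proof (intro AE_I2)
        fix \<xi> :: 'a
        have "((\<lambda>z. ?f z \<xi>) has_field_derivative - complex_of_real ((norm \<xi>)\<^sup>2) * ?f z \<xi>) (at z)"
          by (auto intro!: derivative_eq_intros)
        then have "((\<lambda>w. (?f w \<xi> - ?f z \<xi>) / (w - z)) \<longlongrightarrow> - complex_of_real ((norm \<xi>)\<^sup>2) * ?f z \<xi>) (at z)"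
          by (simp add: has_field_derivative_iff)
        then have "(\<lambda>n. ?q n \<xi>) \<longlonglongrightarrow> - complex_of_real ((norm \<xi>)\<^sup>2) * ?f z \<xi>"
          using X unfolding tendsto_at_iff_sequentially by (auto simp: o_def)
        then show "(\<lambda>n. ?q (n + N) \<xi>) \<longlonglongrightarrow> - complex_of_real ((norm \<xi>)\<^sup>2) * ?f z \<xi>" by (rule LIMSEQ_ignore_initial_segment)
      qed
    qed simp_all
    also have "(\<lambda>n. \<integral>\<xi>. ?q (n + N) \<xi> \<partial>lborel) = (\<lambda>n. (?I (X (n + N)) - ?I z) / (X (n + N) - z))"
    proof
      fix n
      have "X (n + N) \<in> ?H" using N[of "n + N"] r by simp
      then show "(LBINT \<xi>. ?q (n + N) \<xi>) = (?I (X (n + N)) - ?I z) / (X (n + N) - z)"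
        using z by (subst integral_divide_zero, subst Bochner_Integration.integral_diff) (intro int refl | assumption)+
    qed
    finally show "((\<lambda>y. (?I y - ?I z) / (y - z)) \<circ> X) \<longlonglongrightarrow> (LBINT \<xi>. - complex_of_real ((norm \<xi>)\<^sup>2) * ?f z \<xi>)"
      unfolding o_def by (rule LIMSEQ_offset)
  qed
  have "?I z - ?J z = 0"
  proof (rule analytic_continuation[where S="?H" and U="complex_of_real ` {0<..}" and f="\<lambda>z. ?I z - ?J z" and \<xi>=1])
    show "open ?H" by (rule open_halfspace_Re_gt)
    show "connected ?H" by (intro convex_connected convex_halfspace_Re_gt)
    have "?I holomorphic_on ?H" using der
      unfolding holomorphic_on_open[OF \<open>open ?H\<close>] by blast
    moreover have "?J holomorphic_on ?H"
    proof (intro holomorphic_intros)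
      fix z assume "z \<in> ?H"
      then have "z \<noteq> 0" "Re z > 0" by auto
      then have "Re (complex_of_real pi / z) > 0" by (simp add: Re_divide sum_power2_gt_zero_iff complex_eq_iff)
      then show "complex_of_real pi / z \<notin> \<real>\<^sub>\<le>\<^sub>0" by (auto simp: complex_nonpos_Reals_iff)
    qed auto
    ultimately show "(\<lambda>z. ?I z - ?J z) holomorphic_on ?H" by (rule holomorphic_on_diff)
    show "1 islimpt complex_of_real ` {0<..}"
      unfolding islimpt_approachable
    proof (intro allI impI)
      fix e :: real assume "e > 0"
      then show "\<exists>x'\<in>complex_of_real ` {0<..}. x' \<noteq> 1 \<and> dist x' 1 < e"
        by (intro bexI[of _ "complex_of_real (1 + e / 2)"] imageI) (auto simp: dist_norm)
    qed
    show "?I w - ?J w = 0" if w: "w \<in> complex_of_real ` {0<..}" for w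
    proof -
      obtain a where a: "a > 0" "w = complex_of_real a" using w by auto
      have csq: "csqrt (complex_of_real pi / complex_of_real a) = complex_of_real (sqrt (pi / a))"
        using a by (simp add: csqrt_of_real_nonneg flip: of_real_divide)
      have "?I w = (LBINT \<xi>. exp (- complex_of_real a * complex_of_real ((norm \<xi>)\<^sup>2) + \<i> * complex_of_real (x \<bullet> \<xi>)))"
        by (simp only: a(2) exp_add)
      also have "\<dots> = ?J w"
        unfolding integral_gaussian_iexp[OF a(1)] by (simp add: exp_of_real[symmetric] csq a(2))
      finally show ?thesis by simp
    qed
  qed (use z in auto)
  then show "?I z = ?J z" by simp
qed

section \<open>The Fourier integral and Plancherel's theorem\<close>

lemma cnj_measurable [measurable]: "cnj \<in> borel_measurable borel"
  by (intro borel_measurable_continuous_onI continuous_intros)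

abbreviation L2_mass :: "('a::euclidean_space \<Rightarrow> complex) \<Rightarrow> ennreal" where
  "L2_mass f \<equiv> (\<integral>\<^sup>+x. ennreal ((norm (f x))\<^sup>2) \<partial>lborel)"

abbreviation Lp_mass :: "real \<Rightarrow> ('a::euclidean_space \<Rightarrow> complex) \<Rightarrow> ennreal" where
  "Lp_mass q f \<equiv> (\<integral>\<^sup>+x. ennreal (norm (f x) powr q) \<partial>lborel)"

lemma norm_integral_le_nn_integral:
  fixes f :: "'b \<Rightarrow> 'c::{banach, second_countable_topology}"
  shows "ennreal (norm (\<integral>x. f x \<partial>M)) \<le> (\<integral>\<^sup>+x. ennreal (norm (f x)) \<partial>M)"
  by (cases "integrable M f") (simp_all add: integral_norm_bound_ennreal not_integrable_integral_eq)

lemma integrable_pair_mult_bounded: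
  fixes f :: "'a::euclidean_space \<Rightarrow> complex" and g :: "'b::euclidean_space \<Rightarrow> complex"
  assumes f: "integrable lborel f" and g: "integrable lborel g"
    and h [measurable]: "(\<lambda>(x, y). h x y) \<in> borel_measurable (borel \<Otimes>\<^sub>M borel)"
    and h_le: "\<And>x y. norm (h x y) \<le> 1"
  shows "integrable (lborel \<Otimes>\<^sub>M lborel) (\<lambda>(x, y). f x * g y * h x y)"
proof (rule integrableI_bounded)
  have [measurable]: "f \<in> borel_measurable borel" "g \<in> borel_measurable borel"
    using f g by auto
  show "(\<lambda>(x, y). f x * g y * h x y) \<in> borel_measurable (lborel \<Otimes>\<^sub>M lborel)" by measurable
  have "(\<integral>\<^sup>+p. ennreal (norm (case p of (x, y) \<Rightarrow> f x * g y * h x y)) \<partial>(lborel \<Otimes>\<^sub>M lborel))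
     = (\<integral>\<^sup>+x. \<integral>\<^sup>+y. ennreal (norm (f x * g y * h x y)) \<partial>lborel \<partial>lborel)"
    by (subst lborel.nn_integral_fst[symmetric]) auto
  also have "\<dots> \<le> (\<integral>\<^sup>+x. \<integral>\<^sup>+y. ennreal (norm (f x)) * ennreal (norm (g y)) \<partial>lborel \<partial>lborel)"
    using h_le by (intro nn_integral_mono) (auto simp: norm_mult ennreal_mult[symmetric] intro!: ennreal_leI mult_left_le)
  also have "\<dots> = (\<integral>\<^sup>+x. ennreal (norm (f x)) \<partial>lborel) * (\<integral>\<^sup>+y. ennreal (norm (g y)) \<partial>lborel)"
    by (simp add: nn_integral_cmult nn_integral_multc)
  also have "\<dots> < \<infinity>"
    using f g by (simp add: integrable_iff_bounded ennreal_mult_less_top)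
  finally show "(\<integral>\<^sup>+p. ennreal (norm (case p of (x, y) \<Rightarrow> f x * g y * h x y)) \<partial>(lborel \<Otimes>\<^sub>M lborel)) < \<infinity>" .
qed

section \<open>The Fourier integral of an integrable function\<close>

definition fourier_const :: "'a::euclidean_space itself \<Rightarrow> real" where
  "fourier_const _ = (2 * pi) powr (- (real DIM('a) / 2))"

definition fourier_integral :: "real \<Rightarrow> ('a::euclidean_space \<Rightarrow> complex) \<Rightarrow> 'a \<Rightarrow> complex" where
  "fourier_integral \<sigma> f \<xi> = complex_of_real (fourier_const TYPE('a)) *
     (LBINT x. iexp (\<sigma> * (x \<bullet> \<xi>)) * f x)"

lemma fourier_const_pos [simp]: "fourier_const TYPE('a::euclidean_space) > 0"
  by (simp add: fourier_const_def)

lemma fourier_integral_measurable [measurable]: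
  assumes [measurable]: "f \<in> borel_measurable borel"
  shows "fourier_integral \<sigma> f \<in> borel_measurable borel"
  unfolding fourier_integral_def[abs_def] by measurable

lemma integrable_iexp_mult:
  fixes f :: "'a::euclidean_space \<Rightarrow> complex"
  assumes "integrable lborel f"
  shows "integrable lborel (\<lambda>x. iexp (\<sigma> * (x \<bullet> \<xi>)) * f x)"
  by (rule Bochner_Integration.integrable_bound[OF assms]) (use assms in \<open>auto simp: norm_mult norm_exp_eq_Re\<close>)

lemma norm_fourier_integral_le:
  fixes f :: "'a::euclidean_space \<Rightarrow> complex"
  assumes "integrable lborel f"
  shows "norm (fourier_integral \<sigma> f \<xi>) \<le> fourier_const TYPE('a) * (LBINT x. norm (f x))"
proof -
  have "norm (LBINT x. iexp (\<sigma> * (x \<bullet> \<xi>)) * f x)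
    \<le> (LBINT x. norm (iexp (\<sigma> * (x \<bullet> \<xi>)) * f x))"
    by (rule integral_norm_bound)
  also have "\<dots> = (LBINT x. norm (f x))" by (simp add: norm_mult norm_exp_eq_Re)
  finally show ?thesis
    unfolding fourier_integral_def by (simp add: norm_mult mult_left_mono less_imp_le)
qed

lemma fourier_integral_add:
  assumes "integrable lborel f" "integrable lborel g"
  shows "fourier_integral \<sigma> (\<lambda>x. f x + g x) \<xi> = fourier_integral \<sigma> f \<xi> + fourier_integral \<sigma> g \<xi>"
  unfolding fourier_integral_def distrib_left
  by (simp only: Bochner_Integration.integral_add integrable_iexp_mult[OF assms(1)] integrable_iexp_mult[OF assms(2)] distrib_left)

lemma fourier_integral_cmult:
  "fourier_integral \<sigma> (\<lambda>x. c * f x) \<xi> = c * fourier_integral \<sigma> f \<xi>"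
  by (simp add: fourier_integral_def mult.left_commute)

lemma fourier_integral_diff:
  assumes "integrable lborel f" "integrable lborel g"
  shows "fourier_integral \<sigma> (\<lambda>x. f x - g x) \<xi> = fourier_integral \<sigma> f \<xi> - fourier_integral \<sigma> g \<xi>"
  unfolding fourier_integral_def right_diff_distrib
  by (simp only: Bochner_Integration.integral_diff integrable_iexp_mult[OF assms(1)] integrable_iexp_mult[OF assms(2)] right_diff_distrib)

lemma fourier_integral_cong_AE:
  assumes "f \<in> borel_measurable borel" "g \<in> borel_measurable borel" "AE x in lborel. f x = g x"
  shows "fourier_integral \<sigma> f \<xi> = fourier_integral \<sigma> g \<xi>"
  unfolding fourier_integral_def using assms by (intro arg_cong2[where f="(*)"] integral_cong_AE refl) auto

lemma cnj_fourier_integral: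
  "cnj (fourier_integral \<sigma> f \<xi>) = fourier_integral (- \<sigma>) (\<lambda>x. cnj (f x)) \<xi>"
  by (simp add: fourier_integral_def exp_cnj flip: Bochner_Integration.integral_cnj)

text \<open>Fubini: the kernel is unimodular and symmetric in x and \<xi>, so the transform is its
  own transpose for the bilinear pairing.\<close>

lemma fourier_integral_mult_formula:
  fixes f g :: "'a::euclidean_space \<Rightarrow> complex"
  assumes f: "integrable lborel f" and g: "integrable lborel g"
  shows "(LBINT \<xi>. fourier_integral \<sigma> f \<xi> * g \<xi>) = (LBINT x. f x * fourier_integral \<sigma> g x)"
proof -
  let ?c = "complex_of_real (fourier_const TYPE('a))"
  let ?h = "\<lambda>x \<xi>. iexp (\<sigma> * (x \<bullet> \<xi>))"
  have int: "integrable (lborel \<Otimes>\<^sub>M lborel) (\<lambda>(x, \<xi>). f x * g \<xi> * ?h x \<xi>)"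
    using f g by (intro integrable_pair_mult_bounded) (auto simp: norm_exp_eq_Re)
  have "(LBINT \<xi>. fourier_integral \<sigma> f \<xi> * g \<xi>) = (LBINT \<xi>. ?c * (LBINT x. f x * g \<xi> * ?h x \<xi>))"
    unfolding fourier_integral_def by (simp add: mult_ac flip: integral_mult_right_zero)
  also have "\<dots> = ?c * (LBINT x. (LBINT \<xi>. f x * g \<xi> * ?h x \<xi>))"
    using lborel_pair.Fubini_integral[OF int] by simp
  also have "\<dots> = (LBINT x. f x * fourier_integral \<sigma> g x)"
    unfolding fourier_integral_def by (simp add: mult_ac inner_commute flip: integral_mult_right_zero)
  finally show ?thesis .
qed

lemma fourier_const_square: "fourier_const TYPE('a::euclidean_space) * fourier_const TYPE('a) = (1 / (2 * pi)) ^ DIM('a)"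
proof -
  have "fourier_const TYPE('a) * fourier_const TYPE('a) = (2 * pi) powr (- real DIM('a))"
    by (simp add: fourier_const_def flip: powr_add)
  also have "\<dots> = (1 / (2 * pi)) ^ DIM('a)" by (simp add: powr_minus powr_realpow power_divide inverse_eq_divide)
  finally show ?thesis .
qed

text \<open>The multiplication formula moves the outer transform onto the Gaussian, whose transform
  is explicit; a Gaussian multiplier is therefore convolution with a Gaussian. Real z yields the
  heat kernel used for Plancherel's theorem, z near i t the kernel of the free evolution.\<close>

lemma fourier_multiplier_gaussian:
  fixes f :: "'a::euclidean_space \<Rightarrow> complex" and z :: complex
  assumes f: "integrable lborel f" and z: "Re z > 0" and \<sigma>: "\<sigma> = 1 \<or> \<sigma> = - 1"
  shows "fourier_integral \<sigma> (\<lambda>\<xi>. exp (- z * complex_of_real ((norm \<xi>)\<^sup>2)) * fourier_integral (- \<sigma>) f \<xi>) x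
    = (1 / (2 * pi)) ^ DIM('a) * csqrt (pi / z) ^ DIM('a) *
       (LBINT y. exp (- complex_of_real ((norm (x - y))\<^sup>2) / (4 * z)) * f y)"
proof -
  let ?c = "complex_of_real (fourier_const TYPE('a))"
  let ?h = "\<lambda>\<xi>. exp (- z * complex_of_real ((norm \<xi>)\<^sup>2)) * iexp (\<sigma> * (\<xi> \<bullet> x))"
  have h: "integrable lborel ?h"
    using integral_gaussian_iexp_complex(1)[OF z, of "\<sigma> *\<^sub>R x"] by (simp add: inner_commute)
  have hF: "fourier_integral (- \<sigma>) ?h y = ?c * (csqrt (pi / z) ^ DIM('a) * exp (- complex_of_real ((norm (x - y))\<^sup>2) / (4 * z)))" for y
  proof -
    have "iexp (- \<sigma> * (\<xi> \<bullet> y)) * ?h \<xi>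
        = exp (- z * complex_of_real ((norm \<xi>)\<^sup>2)) * iexp ((\<sigma> *\<^sub>R (x - y)) \<bullet> \<xi>)" for \<xi>
      by (simp add: mult_exp_exp inner_diff_left inner_commute algebra_simps)
    then have "fourier_integral (- \<sigma>) ?h y
       = ?c * (LBINT \<xi>. exp (- z * complex_of_real ((norm \<xi>)\<^sup>2)) * iexp ((\<sigma> *\<^sub>R (x - y)) \<bullet> \<xi>))"
      unfolding fourier_integral_def by (simp only:)
    also have "\<dots> = ?c * (csqrt (pi / z) ^ DIM('a) * exp (- complex_of_real ((norm (\<sigma> *\<^sub>R (x - y)))\<^sup>2) / (4 * z)))"
      by (subst integral_gaussian_iexp_complex(2)[OF z]) simp
    also have "norm (\<sigma> *\<^sub>R (x - y)) = norm (x - y)" using \<sigma> by auto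
    finally show ?thesis .
  qed
  have "fourier_integral \<sigma> (\<lambda>\<xi>. exp (- z * complex_of_real ((norm \<xi>)\<^sup>2)) * fourier_integral (- \<sigma>) f \<xi>) x
     = ?c * (LBINT \<xi>. fourier_integral (- \<sigma>) f \<xi> * ?h \<xi>)"
    unfolding fourier_integral_def[of \<sigma>] by (simp add: mult_ac)
  also have "\<dots> = ?c * (LBINT y. f y * fourier_integral (- \<sigma>) ?h y)"
    by (subst fourier_integral_mult_formula[OF f h]) simp
  also have "\<dots> = ?c * (LBINT y. (?c * csqrt (pi / z) ^ DIM('a)) * (exp (- complex_of_real ((norm (x - y))\<^sup>2) / (4 * z)) * f y))"
    unfolding hF by (simp add: mult_ac)
  also have "\<dots> = (?c * ?c) * csqrt (pi / z) ^ DIM('a) * (LBINT y. exp (- complex_of_real ((norm (x - y))\<^sup>2) / (4 * z)) * f y)"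
    by (simp only: integral_mult_right_zero mult.assoc)
  also have "?c * ?c = (1 / (2 * pi)) ^ DIM('a)"
    by (simp only: fourier_const_square of_real_mult[symmetric])
  finally show ?thesis .
qed

section \<open>Gaussian regularisation and the two bounds behind Plancherel's theorem\<close>

definition heat_kernel :: "real \<Rightarrow> 'a::euclidean_space \<Rightarrow> real" where
  "heat_kernel a x = (1 / (2 * pi)) ^ DIM('a) * sqrt (pi / a) ^ DIM('a) * exp (- (norm x)\<^sup>2 / (4 * a))"

lemma heat_kernel_measurable [measurable]: "heat_kernel a \<in> borel_measurable borel"
  unfolding heat_kernel_def[abs_def] by measurable

lemma heat_kernel_nonneg: "a > 0 \<Longrightarrow> heat_kernel a x \<ge> 0"
  by (simp add: heat_kernel_def)

lemma heat_kernel_minus_commute: "heat_kernel a (x - y) = heat_kernel a (y - x)"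
  by (simp add: heat_kernel_def norm_minus_commute)

lemma
  assumes a: "a > 0"
  shows integrable_heat_kernel: "integrable lborel (heat_kernel a :: 'a::euclidean_space \<Rightarrow> real)"
    and integral_heat_kernel: "(\<integral>x. heat_kernel a x \<partial>(lborel :: 'a measure)) = 1"
proof -
  have eq: "heat_kernel a = (\<lambda>x::'a. (1 / (2 * pi)) ^ DIM('a) * sqrt (pi / a) ^ DIM('a) * exp (- (1 / (4 * a)) * (norm x)\<^sup>2))"
    by (simp add: heat_kernel_def fun_eq_iff)
  show "integrable lborel (heat_kernel a :: 'a \<Rightarrow> real)"
    unfolding eq using a by (intro integrable_mult_right integrable_gaussian) simp
  have "(1 / (2 * pi)) * (sqrt (pi / a) * sqrt (pi / (1 / (4 * a)))) = 1"
  proof -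
    have "sqrt (pi / a) * sqrt (pi / (1 / (4 * a))) = sqrt ((2 * pi)\<^sup>2)"
      using a by (simp add: real_sqrt_mult[symmetric] power2_eq_square field_simps)
    then show ?thesis unfolding real_sqrt_abs by simp
  qed
  then have "((1 / (2 * pi)) * (sqrt (pi / a) * sqrt (pi / (1 / (4 * a))))) ^ DIM('a) = 1" by (simp only: power_one)
  then show "(\<integral>x. heat_kernel a x \<partial>(lborel :: 'a measure)) = 1"
    unfolding eq using a by (subst integral_mult_right_zero, subst integral_gaussian) (use a in \<open>auto simp: mult.assoc simp flip: power_mult_distrib\<close>)
qed

text \<open>The factor exp (- a |\<xi>|^2) makes the mass of the transform finite for every
  integrable f. Since the conjugate of the transform is the transform of the conjugate with the
  opposite sign, the multiplication formula turns this damped mass into the quadratic form of the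
  heat kernel. The upper and the lower bound both start from this identity.\<close>

lemma integral_gaussian_fourier_square:
  fixes f :: "'a::euclidean_space \<Rightarrow> complex"
  assumes f: "integrable lborel f" and a: "a > 0" and \<sigma>: "\<sigma> = 1 \<or> \<sigma> = - 1"
  shows "complex_of_real (LBINT \<xi>. exp (- a * (norm \<xi>)\<^sup>2) * (norm (fourier_integral \<sigma> f \<xi>))\<^sup>2)
     = (LBINT x. f x * (LBINT y. heat_kernel a (x - y) *\<^sub>R cnj (f y)))"
proof -
  have fm [measurable]: "f \<in> borel_measurable borel" using f by simp
  have [measurable]: "(\<lambda>x. cnj (f x)) \<in> borel_measurable borel" by (intro borel_measurable_continuous_on[where f=cnj] fm continuous_intros)
  let ?k = "\<lambda>x. cnj (f x)"
  let ?g = "\<lambda>\<xi>. exp (- complex_of_real a * complex_of_real ((norm \<xi>)\<^sup>2)) * fourier_integral (- \<sigma>) ?k \<xi>"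
  have k: "integrable lborel ?k" using f by simp
  have g: "integrable lborel ?g"
  proof (rule Bochner_Integration.integrable_bound)
    show "integrable lborel (\<lambda>\<xi>::'a. exp (- a * (norm \<xi>)\<^sup>2) * (fourier_const TYPE('a) * (LBINT x. norm (?k x))))"
      using a by (intro integrable_mult_left integrable_gaussian) simp
    show "AE \<xi> in lborel. norm (?g \<xi>) \<le> norm (exp (- a * (norm \<xi>)\<^sup>2) * (fourier_const TYPE('a) * (LBINT x. norm (?k x))))"
    proof (intro AE_I2)
      fix \<xi> :: 'a
      have "norm (?g \<xi>) = exp (- a * (norm \<xi>)\<^sup>2) * norm (fourier_integral (- \<sigma>) ?k \<xi>)"
        by (simp add: norm_mult norm_exp_eq_Re)
      also have "\<dots> \<le> exp (- a * (norm \<xi>)\<^sup>2) * (fourier_const TYPE('a) * (LBINT x. norm (?k x)))"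
        by (intro mult_left_mono norm_fourier_integral_le[OF k]) simp
      also have "\<dots> \<le> norm \<dots>" by simp
      finally show "norm (?g \<xi>) \<le> norm (exp (- a * (norm \<xi>)\<^sup>2) * (fourier_const TYPE('a) * (LBINT x. norm (?k x))))" .
    qed
  qed simp
  have "complex_of_real (LBINT \<xi>. exp (- a * (norm \<xi>)\<^sup>2) * (norm (fourier_integral \<sigma> f \<xi>))\<^sup>2)
    = (LBINT \<xi>. complex_of_real (exp (- a * (norm \<xi>)\<^sup>2) * (norm (fourier_integral \<sigma> f \<xi>))\<^sup>2))"
    by (simp only: integral_complex_of_real)
  also have "\<dots> = (LBINT \<xi>. fourier_integral \<sigma> f \<xi> * ?g \<xi>)"
    by (intro Bochner_Integration.integral_cong refl)
      (simp add: cnj_fourier_integral[symmetric] exp_of_real[symmetric] complex_norm_square[symmetric] mult_ac del: complex_cnj_cnj)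
  also have "\<dots> = (LBINT x. f x * fourier_integral \<sigma> ?g x)"
    by (rule fourier_integral_mult_formula[OF f g])
  also have "\<dots> = (LBINT x. f x * (LBINT y. heat_kernel a (x - y) *\<^sub>R cnj (f y)))"
  proof (intro Bochner_Integration.integral_cong refl arg_cong2[where f="(*)"])
    fix x
    have "fourier_integral \<sigma> ?g x = (1 / (2 * pi)) ^ DIM('a) * csqrt (pi / complex_of_real a) ^ DIM('a) *
       (LBINT y. exp (- complex_of_real ((norm (x - y))\<^sup>2) / (4 * complex_of_real a)) * ?k y)"
      using a by (intro fourier_multiplier_gaussian[OF k _ \<sigma>]) simp
    also have "csqrt (pi / complex_of_real a) = complex_of_real (sqrt (pi / a))"
      using a by (simp add: csqrt_of_real_nonneg flip: of_real_divide)
    also have "(1 / (2 * pi)) ^ DIM('a) * complex_of_real (sqrt (pi / a)) ^ DIM('a) *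
       (LBINT y. exp (- complex_of_real ((norm (x - y))\<^sup>2) / (4 * complex_of_real a)) * ?k y)
      = (LBINT y. heat_kernel a (x - y) *\<^sub>R cnj (f y))"
      by (subst integral_mult_right_zero[symmetric])
       (intro Bochner_Integration.integral_cong refl, simp add: heat_kernel_def scaleR_conv_of_real exp_of_real[symmetric])
    finally show "fourier_integral \<sigma> ?g x = (LBINT y. heat_kernel a (x - y) *\<^sub>R cnj (f y))" .
  qed
  finally show ?thesis .
qed

lemma lborel_integral_affine:
  fixes f :: "'a::euclidean_space \<Rightarrow> 'c::{banach, second_countable_topology}"
  assumes [measurable]: "f \<in> borel_measurable borel" and c: "c \<noteq> 0"
  shows "(LBINT x. f x) = \<bar>c\<bar> ^ DIM('a) *\<^sub>R (LBINT x. f (t + c *\<^sub>R x))"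
proof -
  have "(LBINT x. f x) = (\<integral>x. f x \<partial>density (distr lborel borel (\<lambda>x. t + c *\<^sub>R x)) (\<lambda>_. ennreal (\<bar>c\<bar> ^ DIM('a))))"
    using lborel_affine[OF c, of t] by simp
  also have "\<dots> = (\<integral>x. \<bar>c\<bar> ^ DIM('a) *\<^sub>R f x \<partial>distr lborel borel (\<lambda>x. t + c *\<^sub>R x))"
    by (rule integral_density) auto
  also have "\<dots> = (LBINT x. \<bar>c\<bar> ^ DIM('a) *\<^sub>R f (t + c *\<^sub>R x))"
    by (rule integral_distr) auto
  finally show ?thesis by simp
qed

lemma lborel_nn_integral_affine:
  fixes f :: "'a::euclidean_space \<Rightarrow> ennreal"
  assumes [measurable]: "f \<in> borel_measurable borel" and c: "c \<noteq> 0"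
  shows "(\<integral>\<^sup>+x. f x \<partial>lborel) = ennreal (\<bar>c\<bar> ^ DIM('a)) * (\<integral>\<^sup>+x. f (t + c *\<^sub>R x) \<partial>lborel)"
proof -
  have "(\<integral>\<^sup>+x. f x \<partial>lborel) = (\<integral>\<^sup>+x. f x \<partial>density (distr lborel borel (\<lambda>x. t + c *\<^sub>R x)) (\<lambda>_. ennreal (\<bar>c\<bar> ^ DIM('a))))"
    using lborel_affine[OF c, of t] by simp
  also have "\<dots> = (\<integral>\<^sup>+x. ennreal (\<bar>c\<bar> ^ DIM('a)) * f x \<partial>distr lborel borel (\<lambda>x. t + c *\<^sub>R x))"
    by (rule nn_integral_density) auto
  also have "\<dots> = (\<integral>\<^sup>+x. ennreal (\<bar>c\<bar> ^ DIM('a)) * f (t + c *\<^sub>R x) \<partial>lborel)"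
    by (rule nn_integral_distr) auto
  finally show ?thesis by (simp add: nn_integral_cmult)
qed

lemma nn_integral_heat_kernel:
  assumes "a > 0" shows "(\<integral>\<^sup>+y. ennreal (heat_kernel a (x - y)) \<partial>lborel) = 1"
proof -
  have "(\<integral>\<^sup>+y. ennreal (heat_kernel a y) \<partial>(lborel :: 'a measure)) = 1"
    using assms integral_heat_kernel[OF assms, where 'a='a]
    by (subst nn_integral_eq_integral[OF integrable_heat_kernel]) (auto simp: heat_kernel_nonneg)
  then show ?thesis
    by (subst (asm) lborel_nn_integral_affine[where c="-1" and t=x]) auto
qed

text \<open>Schur's test: |f x| |f y| is at most half the sum of the squares and the heat kernel has
  integral 1 in each variable, so the damped mass is at most \<open>L2_mass f\<close> for every a >
  0. Fatou's lemma removes the damping.\<close>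

lemma fourier_integral_contraction:
  fixes f :: "'a::euclidean_space \<Rightarrow> complex"
  assumes f: "integrable lborel f" and \<sigma>: "\<sigma> = 1 \<or> \<sigma> = - 1"
  shows "L2_mass (fourier_integral \<sigma> f) \<le> L2_mass f"
proof -
  have [measurable]: "f \<in> borel_measurable borel" using f by simp
  let ?B = "\<integral>\<^sup>+x. ennreal ((norm (f x))\<^sup>2) \<partial>lborel"
  have bd: "(\<integral>\<^sup>+\<xi>. ennreal (exp (- a * (norm \<xi>)\<^sup>2) * (norm (fourier_integral \<sigma> f \<xi>))\<^sup>2) \<partial>lborel) \<le> ?B"
    if a: "a > 0" for a
  proof -
    let ?I = "\<lambda>\<xi>. exp (- a * (norm \<xi>)\<^sup>2) * (norm (fourier_integral \<sigma> f \<xi>))\<^sup>2"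
    let ?C = "fourier_const TYPE('a) * (LBINT x. norm (f x))"
    have "integrable lborel ?I"
    proof (rule Bochner_Integration.integrable_bound)
      show "integrable lborel (\<lambda>\<xi>::'a. exp (- a * (norm \<xi>)\<^sup>2) * ?C\<^sup>2)"
        using a by (intro integrable_mult_left integrable_gaussian) simp
      show "AE \<xi> in lborel. norm (?I \<xi>) \<le> norm (exp (- a * (norm \<xi>)\<^sup>2) * ?C\<^sup>2)"
        by (auto intro!: mult_left_mono power_mono norm_fourier_integral_le[OF f])
    qed measurable
    then have "(\<integral>\<^sup>+\<xi>. ennreal (?I \<xi>) \<partial>lborel) = ennreal (LBINT \<xi>. ?I \<xi>)"
      by (intro nn_integral_eq_integral) auto
    also have "(LBINT \<xi>. ?I \<xi>) = norm (complex_of_real (LBINT \<xi>. ?I \<xi>))"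
      by (simp add: Bochner_Integration.integral_nonneg)
    also have "ennreal \<dots> \<le> (\<integral>\<^sup>+x. ennreal (norm (f x * (LBINT y. heat_kernel a (x - y) *\<^sub>R cnj (f y)))) \<partial>lborel)"
      unfolding integral_gaussian_fourier_square[OF f a \<sigma>] by (rule norm_integral_le_nn_integral)
    also have "\<dots> \<le> (\<integral>\<^sup>+x. \<integral>\<^sup>+y. ennreal (norm (f x * heat_kernel a (x - y) *\<^sub>R cnj (f y))) \<partial>lborel \<partial>lborel)"
      by (intro nn_integral_mono, subst integral_mult_right_zero[symmetric]) (rule norm_integral_le_nn_integral)
    also have "\<dots> \<le> (\<integral>\<^sup>+x. \<integral>\<^sup>+y. ennreal ((norm (f x))\<^sup>2 / 2) * ennreal (heat_kernel a (x - y))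
        + ennreal ((norm (f y))\<^sup>2 / 2) * ennreal (heat_kernel a (x - y)) \<partial>lborel \<partial>lborel)"
    proof (intro nn_integral_mono)
      fix x y :: 'a
      have "norm (f x * heat_kernel a (x - y) *\<^sub>R cnj (f y)) = (norm (f x) * norm (f y)) * heat_kernel a (x - y)"
        using heat_kernel_nonneg[OF a, of "x - y"] by (simp add: norm_mult)
      also have "\<dots> \<le> ((norm (f x))\<^sup>2 / 2 + (norm (f y))\<^sup>2 / 2) * heat_kernel a (x - y)"
        using sum_squares_bound[of "norm (f x)" "norm (f y)"]
        by (intro mult_right_mono heat_kernel_nonneg[OF a]) auto
      finally show "ennreal (norm (f x * heat_kernel a (x - y) *\<^sub>R cnj (f y)))
         \<le> ennreal ((norm (f x))\<^sup>2 / 2) * ennreal (heat_kernel a (x - y)) + ennreal ((norm (f y))\<^sup>2 / 2) * ennreal (heat_kernel a (x - y))"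
        using heat_kernel_nonneg[OF a, of "x - y"]
        by (simp add: ennreal_mult[symmetric] ennreal_plus[symmetric] distrib_right ennreal_leI del: ennreal_plus)
    qed
    also have "\<dots> = (\<integral>\<^sup>+x. \<integral>\<^sup>+y. ennreal ((norm (f x))\<^sup>2 / 2) * ennreal (heat_kernel a (x - y)) \<partial>lborel \<partial>lborel)
       + (\<integral>\<^sup>+x. \<integral>\<^sup>+y. ennreal ((norm (f y))\<^sup>2 / 2) * ennreal (heat_kernel a (x - y)) \<partial>lborel \<partial>lborel)"
      by (simp add: nn_integral_add)
    also have "(\<integral>\<^sup>+x. \<integral>\<^sup>+y. ennreal ((norm (f y))\<^sup>2 / 2) * ennreal (heat_kernel a (x - y)) \<partial>lborel \<partial>lborel)
       = (\<integral>\<^sup>+y. \<integral>\<^sup>+x. ennreal ((norm (f y))\<^sup>2 / 2) * ennreal (heat_kernel a (y - x)) \<partial>lborel \<partial>lborel)"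
      by (subst lborel_pair.Fubini') (simp_all add: heat_kernel_minus_commute)
    also have "(\<integral>\<^sup>+x. \<integral>\<^sup>+y. ennreal ((norm (f x))\<^sup>2 / 2) * ennreal (heat_kernel a (x - y)) \<partial>lborel \<partial>lborel)
        = (\<integral>\<^sup>+x. ennreal ((norm (f x))\<^sup>2 / 2) \<partial>lborel)"
      by (simp add: nn_integral_cmult nn_integral_heat_kernel[OF a])
    also have "(\<integral>\<^sup>+x. ennreal ((norm (f x))\<^sup>2 / 2) \<partial>lborel) + (\<integral>\<^sup>+x. ennreal ((norm (f x))\<^sup>2 / 2) \<partial>lborel) = ?B"
      by (subst nn_integral_add[symmetric]) (simp_all flip: ennreal_plus)
    finally show ?thesis .
  qed
  have "L2_mass (fourier_integral \<sigma> f)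
     = (\<integral>\<^sup>+\<xi>. liminf (\<lambda>n. ennreal (exp (- (1 / real (Suc n)) * (norm \<xi>)\<^sup>2) * (norm (fourier_integral \<sigma> f \<xi>))\<^sup>2)) \<partial>lborel)"
  proof (intro nn_integral_cong, rule lim_imp_Liminf[symmetric])
    fix \<xi> :: 'a
    have "(\<lambda>n. exp (- (1 / real (Suc n)) * (norm \<xi>)\<^sup>2) * (norm (fourier_integral \<sigma> f \<xi>))\<^sup>2)
      \<longlonglongrightarrow> exp (- 0 * (norm \<xi>)\<^sup>2) * (norm (fourier_integral \<sigma> f \<xi>))\<^sup>2"
      using LIMSEQ_inverse_real_of_nat by (intro tendsto_intros) (simp add: inverse_eq_divide)
    then show "(\<lambda>n. ennreal (exp (- (1 / real (Suc n)) * (norm \<xi>)\<^sup>2) * (norm (fourier_integral \<sigma> f \<xi>))\<^sup>2))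
       \<longlonglongrightarrow> ennreal ((norm (fourier_integral \<sigma> f \<xi>))\<^sup>2)"
      by (intro tendsto_ennrealI) simp
  qed simp
  also have "\<dots> \<le> liminf (\<lambda>n. \<integral>\<^sup>+\<xi>. ennreal (exp (- (1 / real (Suc n)) * (norm \<xi>)\<^sup>2) * (norm (fourier_integral \<sigma> f \<xi>))\<^sup>2) \<partial>lborel)"
    by (rule nn_integral_liminf) simp
  also have "\<dots> \<le> liminf (\<lambda>n. ?B)" by (intro Liminf_mono always_eventually allI bd) simp
  also have "\<dots> = ?B" by (simp add: Liminf_const)
  finally show ?thesis .
qed

text \<open>The heat average of the indicator tends to 1 at each point of the open set W, so the
  quadratic form converges to the measure of W while it stays below the mass of the transform.
  Openness gives this convergence at every point of W directly, without Lebesgue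
  differentiation.\<close>

lemma fourier_integral_indicator_lower_bound:
  fixes W :: "'a::euclidean_space set"
  assumes W: "open W" "bounded W" and \<sigma>: "\<sigma> = 1 \<or> \<sigma> = - 1"
  shows "emeasure lborel W \<le> L2_mass (fourier_integral \<sigma> (\<lambda>x. indicator W x))"
proof -
  let ?f = "\<lambda>x. indicator W x :: complex"
  have [measurable]: "W \<in> sets borel" using W by simp
  have fin: "emeasure lborel W < \<infinity>" using emeasure_bounded_finite[OF W(2)] by simp
  have r: "integrable lborel (\<lambda>x. indicator W x :: real)" using fin by simp
  have "(\<lambda>x. complex_of_real (indicator W x)) = ?f" by (auto simp: indicator_def fun_eq_iff)
  then have f: "integrable lborel ?f" using integrable_of_real[OF r, where 'a=complex] by simp
  \<comment> \<open>A square, so that y = x + z / (n + 1) rescales \<open>heat_kernel (a n)\<close>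
    to \<open>heat_kernel 1\<close>.\<close>
  define a where "a n = (1 / real (Suc n))\<^sup>2" for n
  have a: "a n > 0" for n by (simp add: a_def)
  have sub: "(LBINT y. heat_kernel (a n) (x - y) * indicator W y)
      = (LBINT z. heat_kernel 1 z * indicator W (x + (1 / real (Suc n)) *\<^sub>R z))" for x n
  proof -
    let ?c = "1 / real (Suc n)"
    have "(LBINT y. heat_kernel (a n) (x - y) * indicator W y)
       = \<bar>?c\<bar> ^ DIM('a) *\<^sub>R (LBINT z. heat_kernel (a n) (x - (x + ?c *\<^sub>R z)) * indicator W (x + ?c *\<^sub>R z))"
      by (rule lborel_integral_affine) auto
    also have "\<dots> = (LBINT z. \<bar>?c\<bar> ^ DIM('a) * (heat_kernel (a n) (- ?c *\<^sub>R z) * indicator W (x + ?c *\<^sub>R z)))"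
      by simp
    also have "(\<lambda>z. \<bar>?c\<bar> ^ DIM('a) * (heat_kernel (a n) (- ?c *\<^sub>R z) * indicator W (x + ?c *\<^sub>R z)))
        = (\<lambda>z. heat_kernel 1 z * indicator W (x + ?c *\<^sub>R z))"
    proof
      fix z :: 'a
      have c: "?c > 0" by simp
      have e: "- (norm (- ?c *\<^sub>R z))\<^sup>2 / (4 * a n) = - (norm z)\<^sup>2 / (4 * 1)"
        by (simp add: a_def power_divide power_mult_distrib)
      have s: "?c ^ DIM('a) * sqrt (pi / a n) ^ DIM('a) = sqrt (pi / 1) ^ DIM('a)"
        by (subst power_mult_distrib[symmetric]) (simp add: a_def real_sqrt_divide real_sqrt_mult power_divide)
      have "\<bar>?c\<bar> ^ DIM('a) * heat_kernel (a n) (- ?c *\<^sub>R z) =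
         (1 / (2 * pi)) ^ DIM('a) * (?c ^ DIM('a) * sqrt (pi / a n) ^ DIM('a)) * exp (- (norm (- ?c *\<^sub>R z))\<^sup>2 / (4 * a n))"
        by (simp only: heat_kernel_def abs_of_pos[OF c] mult_ac)
      also have "\<dots> = heat_kernel 1 z" unfolding s e heat_kernel_def ..
      finally show "\<bar>?c\<bar> ^ DIM('a) * (heat_kernel (a n) (- ?c *\<^sub>R z) * indicator W (x + ?c *\<^sub>R z))
          = heat_kernel 1 z * indicator W (x + ?c *\<^sub>R z)" by (simp add: mult.assoc[symmetric])
    qed
    finally show ?thesis .
  qed
  let ?K = "\<lambda>n x. \<integral>z. heat_kernel 1 z * indicator W (x + (1 / real (Suc n)) *\<^sub>R z) \<partial>lborel"
  have hk: "integrable lborel (heat_kernel 1 :: 'a \<Rightarrow> real)" by (rule integrable_heat_kernel) simp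
  have K_le: "0 \<le> ?K n x" "?K n x \<le> 1" for n x
  proof -
    show "0 \<le> ?K n x" by (intro Bochner_Integration.integral_nonneg) (auto simp: heat_kernel_nonneg)
    have "?K n x \<le> (\<integral>z. heat_kernel 1 z \<partial>(lborel::'a measure))"
      by (intro integral_mono' hk) (auto simp: heat_kernel_nonneg indicator_def)
    then show "?K n x \<le> 1" by (simp add: integral_heat_kernel)
  qed
  have K_lim: "(\<lambda>n. ?K n x) \<longlonglongrightarrow> 1" if x: "x \<in> W" for x
  proof -
    have "(\<lambda>n. ?K n x) \<longlonglongrightarrow> (\<integral>z. heat_kernel 1 z \<partial>(lborel::'a measure))"
    proof (rule integral_dominated_convergence[OF _ _ hk])
      show "AE z in lborel. (\<lambda>n. heat_kernel 1 z * indicator W (x + (1 / real (Suc n)) *\<^sub>R z)) \<longlonglongrightarrow> heat_kernel 1 z"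
      proof (intro AE_I2)
        fix z :: 'a
        have "(\<lambda>n. x + (1 / real (Suc n)) *\<^sub>R z) \<longlonglongrightarrow> x + 0 *\<^sub>R z"
          using LIMSEQ_inverse_real_of_nat by (intro tendsto_intros) (simp add: inverse_eq_divide)
        then have "\<forall>\<^sub>F n in sequentially. x + (1 / real (Suc n)) *\<^sub>R z \<in> W"
          using W(1) x by (intro topological_tendstoD[where l=x]) auto
        then have "\<forall>\<^sub>F n in sequentially. heat_kernel 1 z = heat_kernel 1 z * indicator W (x + (1 / real (Suc n)) *\<^sub>R z)"
          by eventually_elim auto
        then show "(\<lambda>n. heat_kernel 1 z * indicator W (x + (1 / real (Suc n)) *\<^sub>R z)) \<longlonglongrightarrow> heat_kernel 1 z"
          by (rule Lim_transform_eventually[rotated]) simp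
      qed
    qed (auto simp: heat_kernel_nonneg indicator_def)
    then show ?thesis by (simp add: integral_heat_kernel)
  qed
  have le: "ennreal (LBINT x. indicator W x * ?K n x) \<le> L2_mass (fourier_integral \<sigma> ?f)" for n
  proof -
    have "complex_of_real (LBINT \<xi>. exp (- a n * (norm \<xi>)\<^sup>2) * (norm (fourier_integral \<sigma> ?f \<xi>))\<^sup>2)
      = (LBINT x. ?f x * (LBINT y. heat_kernel (a n) (x - y) *\<^sub>R cnj (?f y)))"
      by (rule integral_gaussian_fourier_square[OF f a \<sigma>])
    also have "\<dots> = (LBINT x. complex_of_real (indicator W x * (LBINT y. heat_kernel (a n) (x - y) * indicator W y)))"
    proof (intro Bochner_Integration.integral_cong refl)
      fix x
      have "(LBINT y. heat_kernel (a n) (x - y) *\<^sub>R cnj (?f y)) = (LBINT y. complex_of_real (heat_kernel (a n) (x - y) * indicator W y))"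
        by (intro Bochner_Integration.integral_cong refl) (auto simp: indicator_def scaleR_conv_of_real)
      then show "?f x * (LBINT y. heat_kernel (a n) (x - y) *\<^sub>R cnj (?f y))
         = complex_of_real (indicator W x * (LBINT y. heat_kernel (a n) (x - y) * indicator W y))"
        by (simp only: integral_complex_of_real) (auto simp: indicator_def)
    qed
    finally have eq: "(LBINT \<xi>. exp (- a n * (norm \<xi>)\<^sup>2) * (norm (fourier_integral \<sigma> ?f \<xi>))\<^sup>2) = (LBINT x. indicator W x * ?K n x)"
      unfolding sub integral_complex_of_real of_real_eq_iff .
    have "0 \<le> (LBINT \<xi>. exp (- a n * (norm \<xi>)\<^sup>2) * (norm (fourier_integral \<sigma> ?f \<xi>))\<^sup>2)"
      by (intro Bochner_Integration.integral_nonneg) simp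
    then have "ennreal (LBINT x. indicator W x * ?K n x) =
       ennreal (norm (LBINT \<xi>. exp (- a n * (norm \<xi>)\<^sup>2) * (norm (fourier_integral \<sigma> ?f \<xi>))\<^sup>2))"
      unfolding eq[symmetric] by (simp only: real_norm_def abs_of_nonneg)
    also have "\<dots> \<le> (\<integral>\<^sup>+\<xi>. ennreal (norm (exp (- a n * (norm \<xi>)\<^sup>2) * (norm (fourier_integral \<sigma> ?f \<xi>))\<^sup>2)) \<partial>lborel)"
      by (rule norm_integral_le_nn_integral)
    also have "\<dots> = (\<integral>\<^sup>+\<xi>. ennreal (exp (- a n * (norm \<xi>)\<^sup>2) * (norm (fourier_integral \<sigma> ?f \<xi>))\<^sup>2) \<partial>lborel)"
      by simp
    also have "\<dots> \<le> L2_mass (fourier_integral \<sigma> ?f)"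
      using a[of n] by (intro nn_integral_mono ennreal_leI mult_left_le_one_le) (auto simp: less_imp_le)
    finally show ?thesis .
  qed
  have "(\<lambda>n. \<integral>x. indicator W x * ?K n x \<partial>lborel) \<longlonglongrightarrow> (LBINT x. indicator W x)"
    by (rule integral_dominated_convergence[OF _ _ r]) (use K_lim K_le in \<open>auto simp: indicator_def\<close>)
  then have "(\<lambda>n. ennreal (LBINT x. indicator W x * ?K n x)) \<longlonglongrightarrow> ennreal (LBINT x. indicator W x)"
    by (rule tendsto_ennrealI)
  then have "ennreal (LBINT x. indicator W x) \<le> L2_mass (fourier_integral \<sigma> ?f)"
    by (rule LIMSEQ_le_const2) (use le in auto)
  also have "ennreal (LBINT x. indicator W x) = emeasure lborel W"
    using fin by (simp add: emeasure_eq_ennreal_measure)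
  finally show ?thesis .
qed

section \<open>Algebra of \<open>L2\<close> classes and their representatives\<close>

lemma scaleC_L2_add: "c *\<^sub>C (f + g) = c *\<^sub>C f + c *\<^sub>C g"
  by transfer (auto simp: L2_rel_def square_integrable_add square_integrable_cmult distrib_left)

lemma L2_of_add: "square_integrable f \<Longrightarrow> square_integrable g \<Longrightarrow> L2_of (\<lambda>x. f x + g x) = L2_of f + L2_of g"
  by (simp add: L2_of_def square_integrable_add abs_L2_add)

lemma L2_of_diff: "square_integrable f \<Longrightarrow> square_integrable g \<Longrightarrow> L2_of (\<lambda>x. f x - g x) = L2_of f - L2_of g"
  by (simp add: L2_of_def square_integrable_diff abs_L2_diff)

lemma norm_L2_of_nn:
  "square_integrable f \<Longrightarrow> (L2_mass f) = ennreal ((norm (L2_of f))\<^sup>2)"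
  by (simp add: L2_of_def norm_L2_nn)

lemma norm_rep_L2_nn:
  "L2_mass (rep_L2 f) = ennreal ((norm f)\<^sup>2)"
  using norm_L2_of_nn[of "rep_L2 f"] by simp

lemma inner_L2_of:
  "square_integrable f \<Longrightarrow> square_integrable g \<Longrightarrow> L2_of f \<bullet> L2_of g = (LBINT x. f x \<bullet> g x)"
  by (simp add: L2_of_def inner_L2.abs_eq L2_rel_def)

lemma rep_L2_add: "AE x in lborel. rep_L2 (f + g) x = rep_L2 f x + rep_L2 g x"
  using L2_of_AE[OF square_integrable_add[of "rep_L2 f" "rep_L2 g"]] by (simp add: L2_of_add)

lemma rep_L2_diff: "AE x in lborel. rep_L2 (f - g) x = rep_L2 f x - rep_L2 g x"
  using L2_of_AE[OF square_integrable_diff[of "rep_L2 f" "rep_L2 g"]] by (simp add: L2_of_diff)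

lemma rep_scaleC_L2: "AE x in lborel. rep_L2 (c *\<^sub>C f) x = c * rep_L2 f x"
  using L2_of_AE[OF square_integrable_cmult[of "rep_L2 f" c]] by (simp flip: scaleC_L2_of)

lemma scaleR_scaleC_L2: "r *\<^sub>R f = complex_of_real r *\<^sub>C f"
  by transfer (auto simp: L2_rel_def square_integrable_cmult scaleR_conv_of_real)

lemma norm_scaleC_L2: "norm (c *\<^sub>C f) = norm c * norm f"
proof -
  have "norm (c *\<^sub>C L2_of (rep_L2 f)) = sqrt (LBINT x. (norm c)\<^sup>2 * (norm (rep_L2 f x))\<^sup>2)"
    by (subst scaleC_L2_of) (simp_all add: L2_of_def norm_L2_abs square_integrable_cmult norm_mult power_mult_distrib)
  then show ?thesis by (simp add: norm_L2_eq[of f] real_sqrt_mult)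
qed

lemma norm_L2_of_le:
  assumes "square_integrable f" "square_integrable g"
    and "L2_mass f \<le> L2_mass g"
  shows "norm (L2_of f) \<le> norm (L2_of g)"
  using assms(3) by (simp add: norm_L2_of_nn assms power2_le_iff_abs_le)

text \<open>The class on which the integral formula makes sense and the contraction bound keeps the
  transform in L2. Truncations to balls belong to it.\<close>

definition L1_L2 :: "('a::euclidean_space \<Rightarrow> complex) \<Rightarrow> bool" where
  "L1_L2 f \<longleftrightarrow> integrable lborel f \<and> square_integrable f"

lemma L1_L2_diff: "L1_L2 f \<Longrightarrow> L1_L2 g \<Longrightarrow> L1_L2 (\<lambda>x. f x - g x)"
  by (simp add: L1_L2_def square_integrable_diff)

lemma L1_L2_bounded_support:
  fixes f :: "'a::euclidean_space \<Rightarrow> complex"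
  assumes f: "square_integrable f" and A [measurable]: "A \<in> sets borel" and fin: "emeasure lborel A < \<infinity>"
  shows "L1_L2 (\<lambda>x. indicator A x *\<^sub>R f x)"
proof -
  have [measurable]: "f \<in> borel_measurable borel" using f by (rule square_integrable_borel)
  have "integrable lborel (\<lambda>x. indicator A x *\<^sub>R f x)"
  proof (rule Bochner_Integration.integrable_bound)
    show "integrable lborel (\<lambda>x. indicator A x + (norm (f x))\<^sup>2 :: real)"
      using f fin by (auto simp: square_integrable_def)
    have "norm (f x) \<le> 1 + (norm (f x))\<^sup>2" for x
      using sum_squares_bound[of "norm (f x)" 1] norm_ge_zero[of "f x"] unfolding power_one by linarith
    then show "AE x in lborel. norm (indicator A x *\<^sub>R f x) \<le> norm (indicator A x + (norm (f x))\<^sup>2)"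
      by (auto simp: indicator_def)
  qed simp
  moreover have "square_integrable (\<lambda>x. indicator A x *\<^sub>R f x)"
    by (rule square_integrable_bound[of _ "\<lambda>x. (norm (f x))\<^sup>2"]) (use f in \<open>auto simp: square_integrable_def indicator_def\<close>)
  ultimately show ?thesis by (simp add: L1_L2_def)
qed

definition ball_cutoff :: "nat \<Rightarrow> 'a::euclidean_space L2 \<Rightarrow> 'a \<Rightarrow> complex" where
  "ball_cutoff n f x = indicator (cball 0 (real n)) x *\<^sub>R rep_L2 f x"

lemma L1_L2_ball_cutoff: "L1_L2 (ball_cutoff n f)"
  unfolding ball_cutoff_def[abs_def]
  by (rule L1_L2_bounded_support) (use emeasure_bounded_finite[OF bounded_cball] in auto)

lemma truncated_fourier_eq: "truncated_fourier \<sigma> n f = fourier_integral \<sigma> (ball_cutoff n f)"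
  by (simp add: truncated_fourier_def fourier_integral_def ball_cutoff_def fourier_const_def set_lebesgue_integral_def fun_eq_iff)

lemma ball_cutoff_tendsto: "(\<lambda>n. L2_of (ball_cutoff n f)) \<longlonglongrightarrow> f"
proof -
  have sq: "square_integrable (ball_cutoff n f)" for n using L1_L2_ball_cutoff[of n f] by (simp add: L1_L2_def)
  have "(\<lambda>n. abs_L2 (ball_cutoff n f)) \<longlonglongrightarrow> abs_L2 (rep_L2 f)"
  proof (rule L2_tendsto_dominated(1)[where w="\<lambda>x. (norm (rep_L2 f x))\<^sup>2"])
    show "integrable lborel (\<lambda>x. (norm (rep_L2 f x))\<^sup>2)"
      using square_integrable_rep[of f] by (simp add: square_integrable_def)
    show "AE x in lborel. (\<lambda>n. ball_cutoff n f x) \<longlonglongrightarrow> rep_L2 f x"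
    proof (intro AE_I2)
      fix x :: 'a
      obtain k :: nat where k: "norm x < real k" using reals_Archimedean2 by blast
      have "\<forall>\<^sub>F i in sequentially. rep_L2 f x = ball_cutoff i f x"
        using eventually_ge_at_top[of k] by eventually_elim (use k in \<open>auto simp: indicator_def ball_cutoff_def\<close>)
      then show "(\<lambda>n. ball_cutoff n f x) \<longlonglongrightarrow> rep_L2 f x" by (rule Lim_transform_eventually[rotated]) simp
    qed
  qed (use sq in \<open>auto simp: ball_cutoff_def indicator_def dest: square_integrable_borel\<close>)
  then show ?thesis using sq by (simp add: L2_of_def)
qed

text \<open>One operator for both signs: \<open>\<sigma>\<close> = -1 is \<open>fourier_L2\<close>
  and \<open>\<sigma>\<close> = 1 is \<open>inverse_fourier_L2\<close>, so each fact is proved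
  once.\<close>

definition fourier_op :: "real \<Rightarrow> 'a::euclidean_space L2 \<Rightarrow> 'a L2" where
  "fourier_op \<sigma> f = lim (\<lambda>n. L2_of (truncated_fourier \<sigma> n f))"

lemma fourier_L2_eq: "fourier_L2 = fourier_op (- 1)"
  by (simp add: fun_eq_iff fourier_L2_def fourier_op_def)

lemma inverse_fourier_L2_eq: "inverse_fourier_L2 = fourier_op 1"
  by (simp add: fun_eq_iff inverse_fourier_L2_def fourier_op_def)

context
  fixes \<sigma> :: real
  assumes \<sigma>: "\<sigma> = 1 \<or> \<sigma> = - 1"
begin

lemma square_integrable_fourier_integral:
  assumes "L1_L2 f" shows "square_integrable (fourier_integral \<sigma> f)"
proof (rule square_integrable_nn)
  show "fourier_integral \<sigma> f \<in> borel_measurable borel" using assms by (auto simp: L1_L2_def)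
  have "L2_mass (fourier_integral \<sigma> f) \<le> L2_mass f"
    using fourier_integral_contraction[OF _ \<sigma>, of f] assms by (simp add: L1_L2_def)
  also have "\<dots> < \<infinity>" using assms by (simp add: L1_L2_def norm_L2_of_nn)
  finally show "L2_mass (fourier_integral \<sigma> f) < \<infinity>" .
qed

lemma norm_fourier_integral_L2_le:
  assumes "L1_L2 f" shows "norm (L2_of (fourier_integral \<sigma> f)) \<le> norm (L2_of f)"
  using assms by (intro norm_L2_of_le square_integrable_fourier_integral fourier_integral_contraction[OF _ \<sigma>])
    (auto simp: L1_L2_def)

lemma fourier_integral_L2_diff:
  assumes "L1_L2 f" "L1_L2 g"
  shows "L2_of (fourier_integral \<sigma> f) - L2_of (fourier_integral \<sigma> g) = L2_of (fourier_integral \<sigma> (\<lambda>x. f x - g x))"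
proof -
  have "fourier_integral \<sigma> (\<lambda>x. f x - g x) = (\<lambda>\<xi>. fourier_integral \<sigma> f \<xi> - fourier_integral \<sigma> g \<xi>)"
    using assms by (intro ext fourier_integral_diff) (auto simp: L1_L2_def)
  then show ?thesis using assms by (simp add: L2_of_diff square_integrable_fourier_integral)
qed

lemma norm_fourier_integral_L2_diff_le:
  assumes "L1_L2 f" "L1_L2 g"
  shows "norm (L2_of (fourier_integral \<sigma> f) - L2_of (fourier_integral \<sigma> g)) \<le> norm (L2_of f - L2_of g)"
  unfolding fourier_integral_L2_diff[OF assms]
  using norm_fourier_integral_L2_le[OF L1_L2_diff[OF assms]] assms by (simp add: L2_of_diff L1_L2_def)

text \<open>The truncations are Cauchy in L2 and the transform contracts distances, so the
  \<open>lim\<close> in the definition is a genuine limit and not an arbitrary value.\<close>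

lemma fourier_op_tendsto: "(\<lambda>n. L2_of (fourier_integral \<sigma> (ball_cutoff n f))) \<longlonglongrightarrow> fourier_op \<sigma> f"
proof -
  have "Cauchy (\<lambda>n. L2_of (ball_cutoff n f))"
    using ball_cutoff_tendsto[of f] by (rule LIMSEQ_imp_Cauchy)
  then have "Cauchy (\<lambda>n. L2_of (fourier_integral \<sigma> (ball_cutoff n f)))"
    unfolding Cauchy_iff
    by (meson norm_fourier_integral_L2_diff_le[OF L1_L2_ball_cutoff L1_L2_ball_cutoff] le_less_trans)
  then have "convergent (\<lambda>n. L2_of (truncated_fourier \<sigma> n f))"
    unfolding truncated_fourier_eq by (rule Cauchy_convergent)
  then show ?thesis unfolding fourier_op_def convergent_LIMSEQ_iff truncated_fourier_eq .
qed

text \<open>By the contraction bound the transforms of the truncations converge to the transform of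
  f, so the extension to L2 agrees with the integral.\<close>

lemma fourier_op_L2_of:
  assumes "L1_L2 f" shows "fourier_op \<sigma> (L2_of f) = L2_of (fourier_integral \<sigma> f)"
proof (rule LIMSEQ_unique[OF fourier_op_tendsto])
  have "(\<lambda>n. norm (L2_of (ball_cutoff n (L2_of f)) - L2_of f)) \<longlonglongrightarrow> 0"
    by (rule tendsto_norm_zero[OF LIM_zero[OF ball_cutoff_tendsto]])
  then have "(\<lambda>n. L2_of (fourier_integral \<sigma> (ball_cutoff n (L2_of f))) - L2_of (fourier_integral \<sigma> f)) \<longlonglongrightarrow> 0"
    by (rule Lim_null_comparison[rotated]) (simp add: norm_fourier_integral_L2_diff_le L1_L2_ball_cutoff assms)
  then show "(\<lambda>n. L2_of (fourier_integral \<sigma> (ball_cutoff n (L2_of f)))) \<longlonglongrightarrow> L2_of (fourier_integral \<sigma> f)"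
    by (rule LIM_zero_cancel)
qed

lemma norm_fourier_op_le: "norm (fourier_op \<sigma> f) \<le> norm f"
  by (rule LIMSEQ_le[OF tendsto_norm[OF fourier_op_tendsto] tendsto_norm[OF ball_cutoff_tendsto]])
    (use norm_fourier_integral_L2_le[OF L1_L2_ball_cutoff] in auto)

lemma fourier_op_add: "fourier_op \<sigma> (f + g) = fourier_op \<sigma> f + fourier_op \<sigma> g"
proof (rule LIMSEQ_unique[OF fourier_op_tendsto])
  have "L2_of (fourier_integral \<sigma> (ball_cutoff n (f + g)))
      = L2_of (fourier_integral \<sigma> (ball_cutoff n f)) + L2_of (fourier_integral \<sigma> (ball_cutoff n g))" for n
  proof -
    have ae: "AE x in lborel. ball_cutoff n (f + g) x = ball_cutoff n f x + ball_cutoff n g x"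
      using rep_L2_add[of f g] by eventually_elim (simp add: ball_cutoff_def indicator_def)
    have m: "ball_cutoff n h \<in> borel_measurable borel" for h :: "'b::euclidean_space L2"
      using L1_L2_ball_cutoff[of n h] by (auto simp: L1_L2_def)
    have "fourier_integral \<sigma> (ball_cutoff n (f + g)) = fourier_integral \<sigma> (\<lambda>x. ball_cutoff n f x + ball_cutoff n g x)"
      using m by (intro ext fourier_integral_cong_AE ae borel_measurable_add) auto
    also have "\<dots> = (\<lambda>\<xi>. fourier_integral \<sigma> (ball_cutoff n f) \<xi> + fourier_integral \<sigma> (ball_cutoff n g) \<xi>)"
      using L1_L2_ball_cutoff by (intro ext fourier_integral_add) (auto simp: L1_L2_def)
    finally show ?thesis by (simp add: L2_of_add square_integrable_fourier_integral L1_L2_ball_cutoff)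
  qed
  then show "(\<lambda>n. L2_of (fourier_integral \<sigma> (ball_cutoff n (f + g)))) \<longlonglongrightarrow> fourier_op \<sigma> f + fourier_op \<sigma> g"
    by (simp add: tendsto_add fourier_op_tendsto)
qed

lemma tendsto_scaleC_L2: "X \<longlonglongrightarrow> f \<Longrightarrow> (\<lambda>n. c *\<^sub>C X n) \<longlonglongrightarrow> c *\<^sub>C f" for X :: "nat \<Rightarrow> 'b::euclidean_space L2"
proof -
  assume X: "X \<longlonglongrightarrow> f"
  have "c *\<^sub>C (r *\<^sub>R h) = r *\<^sub>R (c *\<^sub>C h)" for r and h :: "'b L2"
    by transfer (auto simp: L2_rel_def square_integrable_cmult square_integrable_scaleR)
  then have "bounded_linear (\<lambda>f::'b L2. c *\<^sub>C f)"
    by (intro bounded_linear_intro[where K="norm c"]) (auto simp: scaleC_L2_add norm_scaleC_L2)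
  then show ?thesis using X by (rule bounded_linear.tendsto)
qed

lemma fourier_op_scaleC: "fourier_op \<sigma> (c *\<^sub>C f) = c *\<^sub>C fourier_op \<sigma> f"
proof (rule LIMSEQ_unique[OF fourier_op_tendsto])
  have "L2_of (fourier_integral \<sigma> (ball_cutoff n (c *\<^sub>C f))) = c *\<^sub>C L2_of (fourier_integral \<sigma> (ball_cutoff n f))" for n
  proof -
    have ae: "AE x in lborel. ball_cutoff n (c *\<^sub>C f) x = c * ball_cutoff n f x"
      using rep_scaleC_L2[of c f] by eventually_elim (simp add: ball_cutoff_def indicator_def)
    have m: "ball_cutoff n h \<in> borel_measurable borel" for h :: "'b::euclidean_space L2"
      using L1_L2_ball_cutoff[of n h] by (auto simp: L1_L2_def)
    have "fourier_integral \<sigma> (ball_cutoff n (c *\<^sub>C f)) = fourier_integral \<sigma> (\<lambda>x. c * ball_cutoff n f x)"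
      using m by (intro ext fourier_integral_cong_AE ae borel_measurable_times) auto
    also have "\<dots> = (\<lambda>\<xi>. c * fourier_integral \<sigma> (ball_cutoff n f) \<xi>)"
      by (intro ext fourier_integral_cmult)
    finally show ?thesis by (simp add: scaleC_L2_of square_integrable_fourier_integral L1_L2_ball_cutoff)
  qed
  then show "(\<lambda>n. L2_of (fourier_integral \<sigma> (ball_cutoff n (c *\<^sub>C f)))) \<longlonglongrightarrow> c *\<^sub>C fourier_op \<sigma> f"
    by (simp add: tendsto_scaleC_L2 fourier_op_tendsto)
qed

lemma bounded_linear_fourier_op: "bounded_linear (fourier_op \<sigma> :: 'b::euclidean_space L2 \<Rightarrow> _)"
  by (rule bounded_linear_intro[where K=1])
    (auto simp: fourier_op_add fourier_op_scaleC scaleR_scaleC_L2 norm_fourier_op_le)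

end

lemma cnj_inner_eq: "z \<bullet> w = Re (z * cnj w)"
  by (simp add: inner_complex_def)

text \<open>The multiplication formula with one argument conjugated, on truncations, passed to the
  limit. The inner product of \<open>L2\<close> is real, namely the real part of the integral of f
  times the conjugate of g, and adjoints are meant in this sense.\<close>

lemma fourier_op_adjoint:
  fixes f g :: "'a::euclidean_space L2"
  assumes \<sigma>: "\<sigma> = 1 \<or> \<sigma> = - 1"
  shows "fourier_op \<sigma> f \<bullet> g = f \<bullet> fourier_op (- \<sigma>) g"
proof -
  have \<sigma>': "- \<sigma> = 1 \<or> - \<sigma> = - 1" using \<sigma> by auto
  have L1: "L2_of (fourier_integral \<sigma> f) \<bullet> L2_of g = L2_of f \<bullet> L2_of (fourier_integral (- \<sigma>) g)"
    if f: "L1_L2 f" and g: "L1_L2 g" for f g :: "'a \<Rightarrow> complex"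
  proof -
    have sq: "square_integrable f" "square_integrable g" using f g by (auto simp: L1_L2_def)
    have cint: "integrable lborel (\<lambda>x. a x * cnj (b x))" if "square_integrable a" "square_integrable b" for a b :: "'a \<Rightarrow> complex"
    proof (rule Bochner_Integration.integrable_bound)
      show "integrable lborel (\<lambda>x. (norm (a x))\<^sup>2 + (norm (b x))\<^sup>2)"
        using that by (simp add: square_integrable_def)
      show "AE x in lborel. norm (a x * cnj (b x)) \<le> norm ((norm (a x))\<^sup>2 + (norm (b x))\<^sup>2)"
      proof (intro AE_I2)
        fix x
        have "norm (a x) * norm (b x) \<le> 2 * norm (a x) * norm (b x)" by simp
        also have "\<dots> \<le> (norm (a x))\<^sup>2 + (norm (b x))\<^sup>2"
          using sum_squares_bound[of "norm (a x)" "norm (b x)"] by simp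
        finally show "norm (a x * cnj (b x)) \<le> norm ((norm (a x))\<^sup>2 + (norm (b x))\<^sup>2)" by (simp add: norm_mult)
      qed
      show "(\<lambda>x. a x * cnj (b x)) \<in> borel_measurable lborel"
        using that[THEN square_integrable_borel]
        by (auto intro!: borel_measurable_times borel_measurable_continuous_on[where f=cnj] continuous_intros)
    qed
    have g': "integrable lborel (\<lambda>x. cnj (g x))" using g by (simp add: L1_L2_def)
    have "L2_of (fourier_integral \<sigma> f) \<bullet> L2_of g = (LBINT x. Re (fourier_integral \<sigma> f x * cnj (g x)))"
      by (simp add: inner_L2_of sq square_integrable_fourier_integral[OF \<sigma>] f cnj_inner_eq)
    also have "\<dots> = Re (LBINT x. fourier_integral \<sigma> f x * cnj (g x))"
      by (intro integral_Re cint sq square_integrable_fourier_integral[OF \<sigma>] f)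
    also have "(LBINT x. fourier_integral \<sigma> f x * cnj (g x)) = (LBINT x. f x * cnj (fourier_integral (- \<sigma>) g x))"
      using fourier_integral_mult_formula[OF _ g', of f \<sigma>] f by (simp add: cnj_fourier_integral L1_L2_def)
    also have "Re \<dots> = (LBINT x. Re (f x * cnj (fourier_integral (- \<sigma>) g x)))"
      by (intro integral_Re[symmetric] cint sq square_integrable_fourier_integral[OF \<sigma>'] g)
    also have "\<dots> = L2_of f \<bullet> L2_of (fourier_integral (- \<sigma>) g)"
      by (simp add: inner_L2_of sq square_integrable_fourier_integral[OF \<sigma>'] g cnj_inner_eq)
    finally show ?thesis .
  qed
  have "(\<lambda>n. L2_of (fourier_integral \<sigma> (ball_cutoff n f)) \<bullet> L2_of (ball_cutoff n g)) \<longlonglongrightarrow> fourier_op \<sigma> f \<bullet> g"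
    by (intro tendsto_inner fourier_op_tendsto[OF \<sigma>] ball_cutoff_tendsto)
  moreover have "(\<lambda>n. L2_of (ball_cutoff n f) \<bullet> L2_of (fourier_integral (- \<sigma>) (ball_cutoff n g))) \<longlonglongrightarrow> f \<bullet> fourier_op (- \<sigma>) g"
    by (intro tendsto_inner fourier_op_tendsto[OF \<sigma>'] ball_cutoff_tendsto)
  ultimately show ?thesis
    unfolding L1[OF L1_L2_ball_cutoff L1_L2_ball_cutoff] by (rule LIMSEQ_unique)
qed

text \<open>
  A contraction \<open>A\<close> with adjoint \<open>A\<^sup>*\<close> satisfies \<open>A\<^sup>* A f = f\<close> as soon as \<open>\<parallel>A f\<parallel> = \<parallel>f\<parallel>\<close>, and this
  is a closed linear condition on \<open>f\<close>. So Plancherel's theorem only needs the lower bound on a total set.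
\<close>

lemma fourier_op_inverse_indicator:
  fixes W :: "'a::euclidean_space set"
  assumes \<sigma>: "\<sigma> = 1 \<or> \<sigma> = - 1" and W: "open W" "bounded W"
  shows "fourier_op (- \<sigma>) (fourier_op \<sigma> (L2_of (indicator W))) = L2_of (indicator W)"
proof -
  let ?f = "L2_of (indicator W) :: 'a L2"
  have \<sigma>': "- \<sigma> = 1 \<or> - \<sigma> = - 1" using \<sigma> by auto
  have fin: "emeasure lborel W < \<infinity>" using emeasure_bounded_finite[OF W(2)] by simp
  have eq: "(\<lambda>x. indicator W x *\<^sub>R (1::complex)) = indicator W" by (auto simp: indicator_def fun_eq_iff)
  have sq1: "square_integrable (indicator W :: 'a \<Rightarrow> complex)"
    using square_integrable_indicator[of W "1::complex"] W fin unfolding eq by simp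
  have eq2: "(\<lambda>x. indicator W x *\<^sub>R indicator W x) = (indicator W :: 'a \<Rightarrow> complex)"
    by (auto simp: indicator_def fun_eq_iff)
  have L: "L1_L2 (indicator W :: 'a \<Rightarrow> complex)"
    using L1_L2_bounded_support[OF sq1, of W] W(1) fin unfolding eq2 by simp
  have "norm ?f \<le> norm (L2_of (fourier_integral \<sigma> (indicator W)) :: 'a L2)"
  proof (rule norm_L2_of_le[OF sq1 square_integrable_fourier_integral[OF \<sigma> L]])
    have "L2_mass (\<lambda>x. indicator W x :: complex) = (\<integral>\<^sup>+x. indicator W x \<partial>lborel)"
      by (intro nn_integral_cong) (auto simp: indicator_def)
    also have "\<dots> = emeasure lborel W" using W by simp
    also have "\<dots> \<le> L2_mass (fourier_integral \<sigma> (indicator W))"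
      by (rule fourier_integral_indicator_lower_bound[OF W \<sigma>])
    finally show "L2_mass (\<lambda>x. indicator W x :: complex)
       \<le> L2_mass (fourier_integral \<sigma> (indicator W))" .
  qed
  then have n: "norm (fourier_op \<sigma> ?f) = norm ?f"
    using norm_fourier_op_le[OF \<sigma>, of ?f] by (simp add: fourier_op_L2_of[OF \<sigma> L])
  let ?g = "fourier_op (- \<sigma>) (fourier_op \<sigma> ?f)"
  have "?f \<bullet> ?g = fourier_op \<sigma> ?f \<bullet> fourier_op \<sigma> ?f"
    using fourier_op_adjoint[OF \<sigma>, of ?f "fourier_op \<sigma> ?f"] by simp
  then have i: "?f \<bullet> ?g = (norm ?f)\<^sup>2" by (simp add: n flip: power2_norm_eq_inner)
  have "norm ?g \<le> norm ?f" using norm_fourier_op_le[OF \<sigma>', of "fourier_op \<sigma> ?f"] n by simp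
  then have "(norm ?g)\<^sup>2 \<le> (norm ?f)\<^sup>2" by (intro power_mono) auto
  \<comment> \<open>With |\<open>?g\<close>| <= |\<open>?f\<close>| and inner product
    |\<open>?f\<close>|^2, the right-hand side is at most 0.\<close>
  moreover have "(norm (?g - ?f))\<^sup>2 = (norm ?g)\<^sup>2 - 2 * (?f \<bullet> ?g) + (norm ?f)\<^sup>2"
    by (simp add: power2_norm_eq_inner inner_diff_left inner_diff_right inner_commute)
  ultimately have "(norm (?g - ?f))\<^sup>2 \<le> 0" using i by simp
  then show ?thesis by simp
qed

text \<open>The difference \<open>?T\<close> between the round trip and the identity is bounded and
  linear. It kills the indicators of finite intersections of basic open sets with balls, which are
  open and bounded, and complex linearity covers their multiples by \<open>\<i>\<close>. The span of
  these is dense.\<close>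

lemma fourier_op_inverse:
  fixes f :: "'a::euclidean_space L2"
  assumes \<sigma>: "\<sigma> = 1 \<or> \<sigma> = - 1"
  shows "fourier_op (- \<sigma>) (fourier_op \<sigma> f) = f"
proof -
  have \<sigma>': "- \<sigma> = 1 \<or> - \<sigma> = - 1" using \<sigma> by auto
  obtain B :: "'a set set" where B: "countable B" "topological_basis B"
    using ex_countable_basis by blast
  define E where "E = (\<lambda>(G, n::nat, c). abs_L2 (\<lambda>x. indicator (\<Inter>G \<inter> ball 0 (real n)) x *\<^sub>R c)) `
      ({G. finite G \<and> G \<subseteq> B} \<times> UNIV \<times> {1, \<i>})"
  have dense: "closure (span E) = UNIV" unfolding E_def using B by (intro L2_dense_span)
  let ?T = "\<lambda>f::'a L2. fourier_op (- \<sigma>) (fourier_op \<sigma> f) - f"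
  have bl: "bounded_linear ?T"
    using bounded_linear_sub[OF bounded_linear_compose[OF bounded_linear_fourier_op[OF \<sigma>'] bounded_linear_fourier_op[OF \<sigma>]]
       bounded_linear_ident] by simp
  have "?T e = 0" if e: "e \<in> E" for e
  proof -
    obtain G n c where G: "finite G" "G \<subseteq> B" "e = abs_L2 (\<lambda>x. indicator (\<Inter>G \<inter> ball 0 (real n)) x *\<^sub>R c)"
      using e by (auto simp: E_def)
    let ?W = "\<Inter>G \<inter> ball 0 (real n)"
    have W: "open ?W" "bounded ?W"
      using G B topological_basis_open by (auto intro!: open_Int open_Inter)
    have fin: "emeasure lborel ?W < \<infinity>" using emeasure_bounded_finite[OF W(2)] by simp
    have "square_integrable (\<lambda>x. indicator ?W x *\<^sub>R (1::complex))"
      using W fin by (intro square_integrable_indicator) auto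
    moreover have "(\<lambda>x. indicator ?W x *\<^sub>R (1::complex)) = indicator ?W" by (auto simp: indicator_def fun_eq_iff)
    ultimately have sq: "square_integrable (indicator ?W :: 'a \<Rightarrow> complex)" by simp
    have "e = L2_of (\<lambda>x. c * indicator ?W x)"
      unfolding G(3) L2_of_def using square_integrable_cmult[OF sq, of c]
      by (auto intro!: arg_cong[where f=abs_L2] simp: indicator_def fun_eq_iff)
    also have "\<dots> = c *\<^sub>C L2_of (indicator ?W)" by (simp add: scaleC_L2_of[OF sq])
    finally show ?thesis
      by (simp add: fourier_op_scaleC[OF \<sigma>] fourier_op_scaleC[OF \<sigma>'] fourier_op_inverse_indicator[OF \<sigma> W])
  qed
  then have "?T e = 0" if "e \<in> span E" for e
    by (rule linear_eq_0_on_span[OF bounded_linear.linear[OF bl] _ that])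
  then have "?T f = 0"
    using continuous_constant_on_closure[of "span E" ?T 0 f] dense linear_continuous_on[OF bl] by auto
  then show ?thesis by simp
qed

lemma norm_fourier_op:
  assumes \<sigma>: "\<sigma> = 1 \<or> \<sigma> = - 1" shows "norm (fourier_op \<sigma> f) = norm f"
proof (rule antisym[OF norm_fourier_op_le[OF \<sigma>]])
  have \<sigma>': "- \<sigma> = 1 \<or> - \<sigma> = - 1" using \<sigma> by auto
  show "norm f \<le> norm (fourier_op \<sigma> f)"
    using norm_fourier_op_le[OF \<sigma>', of "fourier_op \<sigma> f"] by (simp add: fourier_op_inverse[OF \<sigma>])
qed

section \<open>The free Schroedinger group\<close>

definition mult_op :: "('a::euclidean_space \<Rightarrow> complex) \<Rightarrow> 'a L2 \<Rightarrow> 'a L2" where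
  "mult_op m f = L2_of (\<lambda>x. m x * rep_L2 f x)"

lemma square_integrable_mult_bounded:
  assumes "m \<in> borel_measurable borel" "\<And>x. norm (m x) \<le> 1" "square_integrable f"
  shows "square_integrable (\<lambda>x. m x * f x)"
proof (rule square_integrable_bound[of _ "\<lambda>x. (norm (f x))\<^sup>2"])
  have [measurable]: "f \<in> borel_measurable borel" "m \<in> borel_measurable borel"
    using assms square_integrable_borel by auto
  show "(\<lambda>x. m x * f x) \<in> borel_measurable lborel" by simp
  show "AE x in lborel. (norm (m x * f x))\<^sup>2 \<le> (norm (f x))\<^sup>2"
    using assms(2) by (auto simp: norm_mult power_mult_distrib intro!: mult_left_le_one_le power_le_one)
qed (use assms in \<open>auto simp: square_integrable_def\<close>)

lemma mult_op_L2_of: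
  assumes "m \<in> borel_measurable borel" "\<And>x. norm (m x) \<le> 1" "square_integrable f"
  shows "mult_op m (L2_of f) = L2_of (\<lambda>x. m x * f x)"
  unfolding mult_op_def
proof (rule L2_of_cong)
  show "AE x in lborel. m x * rep_L2 (L2_of f) x = m x * f x"
    using L2_of_AE[OF assms(3)] by eventually_elim simp
qed (use assms in \<open>auto intro!: square_integrable_mult_bounded\<close>)

text \<open>Fatou's lemma for |F - k n|^2 shows that F and the pointwise limit differ by mass 0.
  This needs no majorant in L2, which suits the oscillatory kernels to which it is applied.\<close>

lemma L2_limit_pointwise:
  fixes F :: "'a::euclidean_space L2"
  assumes sq: "\<And>n::nat. square_integrable (k n)" and k [measurable]: "k' \<in> borel_measurable borel"
    and lim: "(\<lambda>n. L2_of (k n)) \<longlonglongrightarrow> F" and ptw: "AE x in lborel. (\<lambda>n. k n x) \<longlonglongrightarrow> k' x"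
  shows "square_integrable k'" "F = L2_of k'"
proof -
  have [measurable]: "k n \<in> borel_measurable borel" for n using sq[of n] by (rule square_integrable_borel)
  have "L2_mass (\<lambda>x. rep_L2 F x - k' x)
      = (\<integral>\<^sup>+x. liminf (\<lambda>n. ennreal ((norm (rep_L2 F x - k n x))\<^sup>2)) \<partial>lborel)"
  proof (rule nn_integral_cong_AE)
    show "AE x in lborel. ennreal ((norm (rep_L2 F x - k' x))\<^sup>2) = liminf (\<lambda>n. ennreal ((norm (rep_L2 F x - k n x))\<^sup>2))"
      using ptw
    proof eventually_elim
      fix x assume "(\<lambda>n. k n x) \<longlonglongrightarrow> k' x"
      then have "(\<lambda>n. ennreal ((norm (rep_L2 F x - k n x))\<^sup>2)) \<longlonglongrightarrow> ennreal ((norm (rep_L2 F x - k' x))\<^sup>2)"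
        by (intro tendsto_intros)
      then show "ennreal ((norm (rep_L2 F x - k' x))\<^sup>2) = liminf (\<lambda>n. ennreal ((norm (rep_L2 F x - k n x))\<^sup>2))"
        by (intro lim_imp_Liminf[symmetric]) auto
    qed
  qed
  also have "\<dots> \<le> liminf (\<lambda>n. \<integral>\<^sup>+x. ennreal ((norm (rep_L2 F x - k n x))\<^sup>2) \<partial>lborel)"
    by (rule nn_integral_liminf) simp
  also have "(\<lambda>n. \<integral>\<^sup>+x. ennreal ((norm (rep_L2 F x - k n x))\<^sup>2) \<partial>lborel) = (\<lambda>n. ennreal ((norm (F - L2_of (k n)))\<^sup>2))"
    using sq by (intro ext) (simp add: norm_L2_of_nn square_integrable_diff L2_of_diff)
  also have "liminf \<dots> = 0"
  proof (rule lim_imp_Liminf)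
    have "(\<lambda>n. ennreal ((norm (F - L2_of (k n)))\<^sup>2)) \<longlonglongrightarrow> ennreal ((norm (F - F))\<^sup>2)"
      using lim by (intro tendsto_intros)
    then show "(\<lambda>n. ennreal ((norm (F - L2_of (k n)))\<^sup>2)) \<longlonglongrightarrow> 0" by simp
  qed simp
  finally have "L2_mass (\<lambda>x. rep_L2 F x - k' x) = 0" by simp
  then have ae: "AE x in lborel. rep_L2 F x = k' x"
    by (subst (asm) nn_integral_0_iff_AE) auto
  show sqk: "square_integrable k'"
    by (rule square_integrable_bound[of _ "\<lambda>x. (norm (rep_L2 F x))\<^sup>2"])
      (use ae square_integrable_rep[of F] in \<open>auto simp: square_integrable_def\<close>)
  have "L2_of (rep_L2 F) = L2_of k'"
    by (rule L2_of_cong[OF _ sqk ae]) simp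
  then show "F = L2_of k'" by simp
qed

lemma mult_op_tendsto:
  fixes m :: "nat \<Rightarrow> 'a::euclidean_space \<Rightarrow> complex"
  assumes m [measurable]: "\<And>n. m n \<in> borel_measurable borel" "m' \<in> borel_measurable borel"
    and m_le: "\<And>n x. norm (m n x) \<le> 1" "\<And>x. norm (m' x) \<le> 1"
    and lim: "\<And>x. (\<lambda>n. m n x) \<longlonglongrightarrow> m' x"
  shows "(\<lambda>n. mult_op (m n) f) \<longlonglongrightarrow> mult_op m' f"
proof -
  have sq: "square_integrable (\<lambda>x. m n x * rep_L2 f x)" "square_integrable (\<lambda>x. m' x * rep_L2 f x)" for n
    using m m_le by (auto intro!: square_integrable_mult_bounded)
  have "(\<lambda>n. abs_L2 (\<lambda>x. m n x * rep_L2 f x)) \<longlonglongrightarrow> abs_L2 (\<lambda>x. m' x * rep_L2 f x)"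
  proof (rule L2_tendsto_dominated(1)[where w="\<lambda>x. 4 * (norm (rep_L2 f x))\<^sup>2"])
    show "integrable lborel (\<lambda>x. 4 * (norm (rep_L2 f x))\<^sup>2)"
      using square_integrable_rep[of f] by (simp add: square_integrable_def)
    show "AE x in lborel. (norm (m' x * rep_L2 f x - m n x * rep_L2 f x))\<^sup>2 \<le> 4 * (norm (rep_L2 f x))\<^sup>2" for n
    proof (intro AE_I2)
      fix x
      have "norm (m' x * rep_L2 f x - m n x * rep_L2 f x) = norm (m' x - m n x) * norm (rep_L2 f x)"
        by (simp add: norm_mult flip: left_diff_distrib)
      also have "\<dots> \<le> 2 * norm (rep_L2 f x)"
        using norm_triangle_ineq4[of "m' x" "m n x"] m_le(1)[of n x] m_le(2)[of x] by (intro mult_right_mono) auto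
      finally have "(norm (m' x * rep_L2 f x - m n x * rep_L2 f x))\<^sup>2 \<le> (2 * norm (rep_L2 f x))\<^sup>2"
        by (intro power_mono) auto
      then show "(norm (m' x * rep_L2 f x - m n x * rep_L2 f x))\<^sup>2 \<le> 4 * (norm (rep_L2 f x))\<^sup>2"
        by (simp add: power_mult_distrib)
    qed
    show "AE x in lborel. (\<lambda>n. m n x * rep_L2 f x) \<longlonglongrightarrow> m' x * rep_L2 f x"
      using lim by (intro AE_I2 tendsto_intros)
  qed (use sq square_integrable_borel in auto)
  then show ?thesis using sq by (simp add: mult_op_def L2_of_def)
qed

context
  fixes m :: "'a::euclidean_space \<Rightarrow> complex"
  assumes m [measurable]: "m \<in> borel_measurable borel" and norm_m: "\<And>x. norm (m x) = 1"
begin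

lemma square_integrable_mult_unimodular: "square_integrable f \<Longrightarrow> square_integrable (\<lambda>x. m x * f x)"
  using norm_m by (intro square_integrable_mult_bounded) auto

lemma mult_op_add: "mult_op m (f + g) = mult_op m f + mult_op m g"
proof -
  have "mult_op m (f + g) = L2_of (\<lambda>x. m x * rep_L2 f x + m x * rep_L2 g x)"
    unfolding mult_op_def
    by (rule L2_of_cong) (use rep_L2_add[of f g] in \<open>auto simp: square_integrable_mult_unimodular square_integrable_add distrib_left elim!: eventually_mono\<close>)
  then show ?thesis by (simp add: mult_op_def L2_of_add square_integrable_mult_unimodular)
qed

lemma mult_op_scaleC: "mult_op m (c *\<^sub>C f) = c *\<^sub>C mult_op m f"
proof -
  have "mult_op m (c *\<^sub>C f) = L2_of (\<lambda>x. c * (m x * rep_L2 f x))"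
    unfolding mult_op_def
    by (rule L2_of_cong) (use rep_scaleC_L2[of c f] in \<open>auto simp: square_integrable_mult_unimodular square_integrable_cmult elim!: eventually_mono\<close>)
  then show ?thesis by (simp add: mult_op_def scaleC_L2_of square_integrable_mult_unimodular)
qed

lemma norm_mult_op: "norm (mult_op m f) = norm f"
  by (simp add: mult_op_def L2_of_def square_integrable_mult_unimodular norm_L2_abs norm_mult norm_m norm_L2_eq[of f])

lemma bounded_linear_mult_op: "bounded_linear (mult_op m)"
  by (rule bounded_linear_intro[where K=1])
    (auto simp: mult_op_add mult_op_scaleC scaleR_scaleC_L2 norm_mult_op)

end

lemma mult_op_mult_op:
  assumes m: "m \<in> borel_measurable borel" "\<And>x. norm (m x) = 1" and k: "k \<in> borel_measurable borel" "\<And>x. norm (k x) = 1"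
  shows "mult_op m (mult_op k f) = mult_op (\<lambda>x. m x * k x) f"
  unfolding mult_op_def[of k] 
  by (subst mult_op_L2_of) (use m k in \<open>auto simp: mult_op_def mult.assoc square_integrable_mult_unimodular\<close>)

definition free_phase :: "real \<Rightarrow> 'a::euclidean_space \<Rightarrow> complex" where
  "free_phase t \<xi> = exp (- \<i> * complex_of_real (t * (norm \<xi>)\<^sup>2))"

lemma free_phase_measurable [measurable]: "free_phase t \<in> borel_measurable borel"
  unfolding free_phase_def[abs_def] by measurable

lemma norm_free_phase [simp]: "norm (free_phase t x) = 1"
  by (simp add: free_phase_def norm_exp_eq_Re)

lemma schroedinger_group_eq:
  "schroedinger_group t f = fourier_op 1 (mult_op (free_phase t) (fourier_op (- 1) f))"
  by (simp add: schroedinger_group_def mult_op_def fourier_L2_eq inverse_fourier_L2_eq free_phase_def)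

lemma norm_schroedinger_group [simp]: "norm (schroedinger_group t f) = norm f"
  by (simp add: schroedinger_group_eq norm_fourier_op norm_mult_op)

lemma schroedinger_group_add: "schroedinger_group t (f + g) = schroedinger_group t f + schroedinger_group t g"
  by (simp add: schroedinger_group_eq fourier_op_add mult_op_add)

lemma schroedinger_group_scaleC: "schroedinger_group t (c *\<^sub>C f) = c *\<^sub>C schroedinger_group t f"
  by (simp add: schroedinger_group_eq fourier_op_scaleC mult_op_scaleC)

lemma bounded_linear_schroedinger_group: "bounded_linear (schroedinger_group t)"
  by (rule bounded_linear_intro[where K=1]) (auto simp: schroedinger_group_add schroedinger_group_scaleC scaleR_scaleC_L2)

lemma schroedinger_group_schroedinger_group:
  fixes f :: "'a::euclidean_space L2"
  shows "schroedinger_group s (schroedinger_group t f) = schroedinger_group (s + t) f"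
proof -
  have "fourier_op (- 1) (fourier_op 1 g) = g" for g :: "'a L2" using fourier_op_inverse[of 1 g] by simp
  moreover have "(\<lambda>x::'a. free_phase s x * free_phase t x) = free_phase (s + t)"
    by (simp add: free_phase_def mult_exp_exp algebra_simps fun_eq_iff)
  ultimately show ?thesis
    by (simp add: schroedinger_group_eq mult_op_mult_op)
qed

text \<open>Polarisation of the isometry property.\<close>

lemma inner_schroedinger_group: "schroedinger_group t f \<bullet> schroedinger_group t g = f \<bullet> g"
proof -
  have *: "f \<bullet> g = ((norm (f + g))\<^sup>2 - (norm f)\<^sup>2 - (norm g)\<^sup>2) / 2" for f g :: "'a L2"
    by (simp add: power2_norm_eq_inner inner_add_left inner_add_right inner_commute)
  show ?thesis unfolding *[of "schroedinger_group t f"] *[of f] by (simp flip: schroedinger_group_add)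
qed

section \<open>The factorisation of the free group into chirp, dilation and Fourier
  transform\<close>

definition chirp :: "real \<Rightarrow> 'a::euclidean_space \<Rightarrow> complex" where
  "chirp t x = iexp ((norm x)\<^sup>2 / (4 * t))"

lemma chirp_measurable [measurable]: "chirp t \<in> borel_measurable borel"
  unfolding chirp_def[abs_def] by measurable

lemma norm_chirp [simp]: "norm (chirp t x) = 1"
  by (simp add: chirp_def norm_exp_eq_Re)

text \<open>The operator \<open>M(t) D(t)\<close> of the factorisation \<open>U(t) = M(t) D(t) \<F> M(t)\<close>.\<close>

definition wave :: "real \<Rightarrow> ('a::euclidean_space \<Rightarrow> complex) \<Rightarrow> 'a \<Rightarrow> complex" where
  "wave t g x = csqrt (- \<i>) ^ DIM('a) * complex_of_real (sqrt (1 / (2 * t)) ^ DIM('a)) * chirp t x * g (x /\<^sub>R (2 * t))"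

lemma wave_measurable [measurable]:
  assumes [measurable]: "g \<in> borel_measurable borel"
  shows "wave t g \<in> borel_measurable borel"
  unfolding wave_def[abs_def] by measurable

lemma norm_wave: "t > 0 \<Longrightarrow> norm (wave t g x) = sqrt (1 / (2 * t)) ^ DIM('a) * norm (g (x /\<^sub>R (2 * t)))" for x :: "'a::euclidean_space"
  by (simp add: wave_def norm_mult norm_power)

lemma wave_diff: "wave t g x - wave t h x = wave t (\<lambda>y. g y - h y) x"
  by (simp add: wave_def algebra_simps)

lemma sqrt_inverse_powr: "x > 0 \<Longrightarrow> sqrt (1 / x) = x powr (- (1 / 2))"
  by (simp add: powr_minus_divide powr_half_sqrt real_sqrt_divide)

text \<open>The Jacobian (2t)^d of x = 2 t y meets the amplitude (2t)^(- d q / 2). The two cancel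
  for q = 2, and at q = 2(d+2)/d the remaining exponent d (1 - q / 2) is -2.\<close>

lemma nn_integral_wave:
  fixes g :: "'a::euclidean_space \<Rightarrow> complex"
  assumes t: "t > 0" and g [measurable]: "g \<in> borel_measurable borel"
  shows "Lp_mass q (wave t g)
     = ennreal ((2 * t) powr (real DIM('a) * (1 - q / 2))) * Lp_mass q g"
proof -
  have c: "(2 * t) ^ DIM('a) * (sqrt (1 / (2 * t)) ^ DIM('a)) powr q = (2 * t) powr (real DIM('a) * (1 - q / 2))"
  proof -
    have "sqrt (1 / (2 * t)) = (2 * t) powr (- (1 / 2))"
      using t by (intro sqrt_inverse_powr) simp
    then have "(sqrt (1 / (2 * t)) ^ DIM('a)) powr q = (2 * t) powr (- (real DIM('a) * q / 2))"
      using t by (simp add: powr_powr flip: powr_realpow)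
    moreover have "(2 * t) ^ DIM('a) = (2 * t) powr real DIM('a)" using t by (simp add: powr_realpow)
    ultimately show ?thesis by (simp add: algebra_simps flip: powr_add)
  qed
  have "Lp_mass q (wave t g)
     = ennreal (\<bar>2 * t\<bar> ^ DIM('a)) * Lp_mass q (\<lambda>x. wave t g (0 + (2 * t) *\<^sub>R x))"
    using t by (intro lborel_nn_integral_affine) auto
  also have "Lp_mass q (\<lambda>x. wave t g (0 + (2 * t) *\<^sub>R x))
      = (\<integral>\<^sup>+x. ennreal ((sqrt (1 / (2 * t)) ^ DIM('a)) powr q) * ennreal (norm (g x) powr q) \<partial>lborel)"
    using t by (intro nn_integral_cong) (simp add: norm_wave powr_mult flip: ennreal_mult)
  also have "\<dots> = ennreal ((sqrt (1 / (2 * t)) ^ DIM('a)) powr q) * Lp_mass q g"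
    by (rule nn_integral_cmult) simp
  finally show ?thesis using t by (simp add: c[symmetric] ennreal_mult mult.assoc)
qed

lemma nn_integral_wave_square:
  fixes g :: "'a::euclidean_space \<Rightarrow> complex"
  assumes t: "t > 0" and g [measurable]: "g \<in> borel_measurable borel"
  shows "L2_mass (wave t g) = L2_mass g"
  using nn_integral_wave[OF t g, of 2] t by simp

lemma square_integrable_wave:
  assumes t: "t > 0" and g: "square_integrable g"
  shows "square_integrable (wave t g)"
  using g nn_integral_wave_square[OF t, of g] norm_L2_of_nn[OF g] square_integrable_borel[OF g]
  by (intro square_integrable_nn) auto

lemma norm_wave_L2_diff:
  assumes t: "t > 0" and g: "square_integrable g" and h: "square_integrable h"
  shows "norm (L2_of (wave t g) - L2_of (wave t h)) = norm (L2_of g - L2_of h)"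
proof -
  have gh: "square_integrable (\<lambda>x. g x - h x)" using g h by (rule square_integrable_diff)
  have "L2_of (wave t g) - L2_of (wave t h) = L2_of (wave t (\<lambda>x. g x - h x))"
    using square_integrable_wave[OF t g] square_integrable_wave[OF t h]
    by (simp add: L2_of_diff[symmetric] wave_diff)
  moreover have "ennreal ((norm (L2_of (wave t (\<lambda>x. g x - h x))))\<^sup>2) = ennreal ((norm (L2_of (\<lambda>x. g x - h x)))\<^sup>2)"
    using nn_integral_wave_square[OF t square_integrable_borel[OF gh]]
    by (simp only: norm_L2_of_nn[OF square_integrable_wave[OF t gh]] norm_L2_of_nn[OF gh])
  ultimately show ?thesis using g h by (simp add: L2_of_diff)
qed

text \<open>The symbol is regularised to exp (- z |\<xi>|^2) with Re z > 0, where the Gaussian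
  convolution formula holds, and z tends to i t. The operators converge strongly on L2 and the
  convolutions converge pointwise by dominated convergence, so \<open>L2_limit_pointwise\<close>
  identifies the two limits.\<close>

lemma schroedinger_group_L1_L2:
  fixes f :: "'a::euclidean_space \<Rightarrow> complex"
  assumes t: "t > 0" and f: "L1_L2 f"
  shows "schroedinger_group t (L2_of f) = L2_of (wave t (fourier_integral (- 1) (\<lambda>x. chirp t x * f x)))"
proof -
  have fi: "integrable lborel f" and fs: "square_integrable f" using f by (auto simp: L1_L2_def)
  have [measurable]: "f \<in> borel_measurable borel" using fi by simp
  define z where "z n = complex_of_real (1 / real (Suc n)) + \<i> * complex_of_real t" for n
  have z: "Re (z n) > 0" for n by (simp add: z_def)
  have z_lim: "z \<longlonglongrightarrow> \<i> * complex_of_real t"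
  proof -
    have "(\<lambda>n. complex_of_real (1 / real (Suc n)) + \<i> * complex_of_real t) \<longlonglongrightarrow> complex_of_real 0 + \<i> * complex_of_real t"
      using LIMSEQ_inverse_real_of_nat by (intro tendsto_intros) (simp add: inverse_eq_divide)
    then show ?thesis by (simp add: z_def[abs_def])
  qed
  define m where "m n \<xi> = exp (- z n * complex_of_real ((norm (\<xi>::'a))\<^sup>2))" for n \<xi>
  have m_meas [measurable]: "m n \<in> borel_measurable borel" for n unfolding m_def[abs_def] by measurable
  have norm_m: "norm (m n \<xi>) = exp (- (1 / real (Suc n)) * (norm \<xi>)\<^sup>2)" for n \<xi>
    by (simp add: m_def norm_exp_eq_Re z_def)
  have m_le: "norm (m n \<xi>) \<le> 1" for n \<xi> unfolding norm_m by simp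
  have m_lim: "(\<lambda>n. m n \<xi>) \<longlonglongrightarrow> free_phase t \<xi>" for \<xi>
  proof -
    have "(\<lambda>n. m n \<xi>) \<longlonglongrightarrow> exp (- (\<i> * complex_of_real t) * complex_of_real ((norm \<xi>)\<^sup>2))"
      unfolding m_def by (intro tendsto_intros z_lim)
    then show ?thesis by (simp add: free_phase_def mult.assoc)
  qed
  let ?h = "fourier_integral (- 1) f"
  have hs: "square_integrable ?h" by (rule square_integrable_fourier_integral[OF _ f]) simp
  have mh: "L1_L2 (\<lambda>\<xi>. m n \<xi> * ?h \<xi>)" for n
  proof -
    have "integrable lborel (\<lambda>\<xi>. m n \<xi> * ?h \<xi>)"
    proof (rule Bochner_Integration.integrable_bound)
      show "integrable lborel (\<lambda>\<xi>::'a. exp (- (1 / real (Suc n)) * (norm \<xi>)\<^sup>2) * (fourier_const TYPE('a) * (LBINT x. norm (f x))))"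
        by (intro integrable_mult_left integrable_gaussian) simp
      show "AE \<xi> in lborel. norm (m n \<xi> * ?h \<xi>) \<le> norm (exp (- (1 / real (Suc n)) * (norm \<xi>)\<^sup>2) * (fourier_const TYPE('a) * (LBINT x. norm (f x))))"
      proof (intro AE_I2)
        fix \<xi> :: 'a
        have "norm (m n \<xi> * ?h \<xi>) \<le> exp (- (1 / real (Suc n)) * (norm \<xi>)\<^sup>2) * (fourier_const TYPE('a) * (LBINT x. norm (f x)))"
          unfolding norm_mult norm_m by (intro mult_left_mono norm_fourier_integral_le[OF fi]) simp
        also have "\<dots> \<le> norm \<dots>" by simp
        finally show "norm (m n \<xi> * ?h \<xi>) \<le> norm (exp (- (1 / real (Suc n)) * (norm \<xi>)\<^sup>2) * (fourier_const TYPE('a) * (LBINT x. norm (f x))))" .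
      qed
    qed simp
    then show ?thesis using square_integrable_mult_bounded[OF m_meas m_le hs] by (simp add: L1_L2_def)
  qed
  define k where "k n = fourier_integral 1 (\<lambda>\<xi>. m n \<xi> * ?h \<xi>)" for n
  have k_sq: "square_integrable (k n)" for n
    unfolding k_def by (rule square_integrable_fourier_integral[OF _ mh]) simp
  have k_op: "L2_of (k n) = fourier_op 1 (mult_op (m n) (fourier_op (- 1) (L2_of f)))" for n
    unfolding k_def by (simp add: fourier_op_L2_of f mh mult_op_L2_of[OF m_meas m_le hs])
  have "(\<lambda>n. fourier_op 1 (mult_op (m n) (fourier_op (- 1) (L2_of f))))
      \<longlonglongrightarrow> fourier_op 1 (mult_op (free_phase t) (fourier_op (- 1) (L2_of f)))"
    by (intro bounded_linear.tendsto[OF bounded_linear_fourier_op] mult_op_tendsto m_meas m_le m_lim) auto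
  then have k_lim: "(\<lambda>n. L2_of (k n)) \<longlonglongrightarrow> schroedinger_group t (L2_of f)"
    unfolding k_op schroedinger_group_eq .
  have k_eq: "k n x = (1 / (2 * pi)) ^ DIM('a) * csqrt (complex_of_real pi / z n) ^ DIM('a) *
       (LBINT y. exp (- complex_of_real ((norm (x - y))\<^sup>2) / (4 * z n)) * f y)" for n x
    unfolding k_def m_def using fourier_multiplier_gaussian[OF fi z, of 1 n x] by simp
  have ex_lim: "(\<lambda>n. \<integral>y. exp (- complex_of_real ((norm (x - y))\<^sup>2) / (4 * z n)) * f y \<partial>lborel)
      \<longlonglongrightarrow> (LBINT y. exp (- complex_of_real ((norm (x - y))\<^sup>2) / (4 * (\<i> * complex_of_real t))) * f y)" for x
  proof (rule integral_dominated_convergence[where w="\<lambda>y. norm (f y)"])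
    show "AE y in lborel. (\<lambda>n. exp (- complex_of_real ((norm (x - y))\<^sup>2) / (4 * z n)) * f y)
       \<longlonglongrightarrow> exp (- complex_of_real ((norm (x - y))\<^sup>2) / (4 * (\<i> * complex_of_real t))) * f y"
      using t by (intro AE_I2 tendsto_intros z_lim) auto
    show "AE y in lborel. norm (exp (- complex_of_real ((norm (x - y))\<^sup>2) / (4 * z n)) * f y) \<le> norm (f y)" for n
    proof (intro AE_I2)
      fix y
      have "Re (- complex_of_real ((norm (x - y))\<^sup>2) / (4 * z n)) = - ((norm (x - y))\<^sup>2) / 4 * Re (1 / z n)"
      proof -
        have "- complex_of_real ((norm (x - y))\<^sup>2) / (4 * z n) = complex_of_real (- ((norm (x - y))\<^sup>2) / 4) * (1 / z n)"
          by simp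
        then show ?thesis by (simp only: times_complex.sel Re_complex_of_real Im_complex_of_real)
      qed
      also have "Re (1 / z n) \<ge> 0" using z[of n] by (simp add: Re_divide)
      then have "- ((norm (x - y))\<^sup>2) / 4 * Re (1 / z n) \<le> 0" by (simp add: mult_nonneg_nonneg)
      finally have "norm (exp (- complex_of_real ((norm (x - y))\<^sup>2) / (4 * z n))) \<le> 1"
        unfolding norm_exp_eq_Re by simp
      then show "norm (exp (- complex_of_real ((norm (x - y))\<^sup>2) / (4 * z n)) * f y) \<le> norm (f y)"
        unfolding norm_mult by (rule mult_left_le_one_le[rotated 2]) auto
    qed
  qed (use fi in auto)
  have cs: "csqrt (complex_of_real pi / (\<i> * complex_of_real t)) = complex_of_real (sqrt (pi / t)) * csqrt (- \<i>)"
  proof -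
    \<comment> \<open>The candidate has the correct square, and it is the principal root because the
      real part of csqrt (- i) is positive.\<close>
    let ?w = "complex_of_real (sqrt (pi / t)) * csqrt (- \<i>)"
    have "?w\<^sup>2 = complex_of_real ((sqrt (pi / t))\<^sup>2) * (csqrt (- \<i>))\<^sup>2" by (simp add: power_mult_distrib)
    also have "\<dots> = complex_of_real pi / (\<i> * complex_of_real t)" using t by (simp add: field_simps)
    finally have "csqrt (complex_of_real pi / (\<i> * complex_of_real t)) = csqrt (?w\<^sup>2)" by simp
    also have "\<dots> = ?w" using t by (intro csqrt_square) simp
    finally show ?thesis .
  qed
  have cs_lim: "(\<lambda>n. csqrt (complex_of_real pi / z n)) \<longlonglongrightarrow> csqrt (complex_of_real pi / (\<i> * complex_of_real t))"
  proof (rule isCont_tendsto_compose[where g=csqrt])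
    have "complex_of_real pi / (\<i> * complex_of_real t) \<notin> \<real>\<^sub>\<le>\<^sub>0"
      using t by (auto simp: complex_nonpos_Reals_iff Im_divide Re_divide)
    then show "isCont csqrt (complex_of_real pi / (\<i> * complex_of_real t))" by (rule continuous_at_csqrt)
    show "(\<lambda>n. complex_of_real pi / z n) \<longlonglongrightarrow> complex_of_real pi / (\<i> * complex_of_real t)"
      using t by (intro tendsto_intros z_lim) auto
  qed
  let ?w = "wave t (fourier_integral (- 1) (\<lambda>x. chirp t x * f x))"
  have w_eq: "?w x = (1 / (2 * pi)) ^ DIM('a) * csqrt (complex_of_real pi / (\<i> * complex_of_real t)) ^ DIM('a) *
       (LBINT y. exp (- complex_of_real ((norm (x - y))\<^sup>2) / (4 * (\<i> * complex_of_real t))) * f y)" for x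
  proof -
    \<comment> \<open>In |x - y|^2 / (4 t) the two squares give the chirps, and the cross term is
      the Fourier phase at the frequency x / (2 t).\<close>
    have e: "exp (- complex_of_real ((norm (x - y))\<^sup>2) / (4 * (\<i> * complex_of_real t)))
       = chirp t x * (iexp (- 1 * (y \<bullet> (x /\<^sub>R (2 * t)))) * chirp t y)" for y
    proof -
      have "- complex_of_real ((norm (x - y))\<^sup>2) / (4 * (\<i> * complex_of_real t)) = \<i> * complex_of_real ((norm (x - y))\<^sup>2 / (4 * t))"
        using t by (simp add: field_simps)
      also have "(norm (x - y))\<^sup>2 / (4 * t) = (norm x)\<^sup>2 / (4 * t) + (- 1 * (y \<bullet> (x /\<^sub>R (2 * t)))) + (norm y)\<^sup>2 / (4 * t)"
        using t by (simp add: power2_norm_eq_inner inner_diff_left inner_diff_right inner_commute field_simps)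
      finally show ?thesis unfolding chirp_def mult_exp_exp by (simp only: of_real_add distrib_left add.assoc)
    qed
    have "(LBINT y. exp (- complex_of_real ((norm (x - y))\<^sup>2) / (4 * (\<i> * complex_of_real t))) * f y)
       = chirp t x * (LBINT y. iexp (- 1 * (y \<bullet> (x /\<^sub>R (2 * t)))) * (chirp t y * f y))"
      unfolding e by (simp only: mult.assoc integral_mult_right_zero)
    moreover have "complex_of_real (fourier_const TYPE('a)) * complex_of_real (sqrt (1 / (2 * t)) ^ DIM('a))
        = (1 / (2 * pi)) ^ DIM('a) * complex_of_real (sqrt (pi / t)) ^ DIM('a)"
    proof -
      have fc: "fourier_const TYPE('a) = sqrt (1 / (2 * pi)) ^ DIM('a)"
      proof -
        have "sqrt (1 / (2 * pi)) = (2 * pi) powr (- (1 / 2))"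
          by (intro sqrt_inverse_powr) simp
        then show ?thesis by (simp add: fourier_const_def powr_powr flip: powr_realpow)
      qed
      have "sqrt (1 / (2 * pi)) * sqrt (1 / (2 * t)) = (1 / (2 * pi)) * sqrt (pi / t)"
      proof -
        have "(1 / (2 * pi)) * sqrt (pi / t) = sqrt ((1 / (2 * pi))\<^sup>2) * sqrt (pi / t)" by simp
        also have "\<dots> = sqrt ((1 / (2 * pi))\<^sup>2 * (pi / t))" by (rule real_sqrt_mult[symmetric])
        also have "(1 / (2 * pi))\<^sup>2 * (pi / t) = 1 / (2 * pi) * (1 / (2 * t))" using t by (simp add: power2_eq_square)
        finally show ?thesis by (simp only: real_sqrt_mult)
      qed
      then have "(sqrt (1 / (2 * pi)) * sqrt (1 / (2 * t))) ^ DIM('a) = ((1 / (2 * pi)) * sqrt (pi / t)) ^ DIM('a)" by simp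
      then have "fourier_const TYPE('a) * sqrt (1 / (2 * t)) ^ DIM('a) = (1 / (2 * pi)) ^ DIM('a) * sqrt (pi / t) ^ DIM('a)"
        unfolding fc power_mult_distrib .
      then have "complex_of_real (fourier_const TYPE('a) * sqrt (1 / (2 * t)) ^ DIM('a)) = complex_of_real ((1 / (2 * pi)) ^ DIM('a) * sqrt (pi / t) ^ DIM('a))"
        by (simp only:)
      then show ?thesis by simp
    qed
    ultimately show ?thesis
      unfolding wave_def fourier_integral_def cs power_mult_distrib by (simp add: mult_ac)
  qed
  have k_ptw: "(\<lambda>n. k n x) \<longlonglongrightarrow> ?w x" for x
    unfolding k_eq w_eq by (intro tendsto_intros ex_lim cs_lim)
  show ?thesis
    by (rule L2_limit_pointwise(2)[OF k_sq _ k_lim]) (use k_ptw in auto)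
qed

text \<open>The formula for integrable functions holds on truncations, and both sides are continuous
  in L2, so it extends to all of L2 by passing to the limit.\<close>

lemma schroedinger_group_wave:
  fixes f :: "'a::euclidean_space L2"
  assumes t: "t > 0"
  shows "schroedinger_group t f = L2_of (wave t (rep_L2 (fourier_op (- 1) (mult_op (chirp t) f))))"
proof -
  let ?V = "\<lambda>f::'a L2. fourier_op (- 1) (mult_op (chirp t) f)"
  let ?W = "\<lambda>f::'a L2. L2_of (wave t (rep_L2 (?V f)))"
  let ?f = "\<lambda>n. L2_of (ball_cutoff n f)"
  have V: "bounded_linear ?V"
    by (intro bounded_linear_compose[OF bounded_linear_fourier_op] bounded_linear_mult_op) auto
  have "schroedinger_group t (?f n) = ?W (?f n)" for n
  proof -
    let ?b = "ball_cutoff n f"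
    have b: "L1_L2 ?b" by (rule L1_L2_ball_cutoff)
    then have bi: "integrable lborel ?b" and bs: "square_integrable ?b" by (auto simp: L1_L2_def)
    have cb: "L1_L2 (\<lambda>x. chirp t x * ?b x)"
      unfolding L1_L2_def using bi bs
      by (auto intro!: square_integrable_mult_bounded Bochner_Integration.integrable_bound[OF bi] simp: norm_mult)
    have V_eq: "?V (?f n) = L2_of (fourier_integral (- 1) (\<lambda>x. chirp t x * ?b x))"
      using bs by (simp add: mult_op_L2_of fourier_op_L2_of cb)
    have sq: "square_integrable (fourier_integral (- 1) (\<lambda>x. chirp t x * ?b x))"
      by (rule square_integrable_fourier_integral[OF _ cb]) simp
    \<comment> \<open>\<open>wave\<close> acts on functions rather than classes. It preserves L2
      distances, so two representatives of one class have the same image in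
      \<open>L2\<close>.\<close>
    have "norm (?W (?f n) - L2_of (wave t (fourier_integral (- 1) (\<lambda>x. chirp t x * ?b x)))) = 0"
      by (subst norm_wave_L2_diff[OF t square_integrable_rep sq]) (simp add: V_eq)
    then show ?thesis by (simp add: schroedinger_group_L1_L2[OF t b])
  qed
  moreover have "(\<lambda>n. schroedinger_group t (?f n)) \<longlonglongrightarrow> schroedinger_group t f"
    by (rule bounded_linear.tendsto[OF bounded_linear_schroedinger_group ball_cutoff_tendsto])
  moreover have "(\<lambda>n. ?W (?f n)) \<longlonglongrightarrow> ?W f"
  proof -
    have "(\<lambda>n. norm (?V (?f n) - ?V f)) \<longlonglongrightarrow> 0"
      by (rule tendsto_norm_zero[OF LIM_zero[OF bounded_linear.tendsto[OF V ball_cutoff_tendsto]]])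
    then have "(\<lambda>n. norm (?W (?f n) - ?W f)) \<longlonglongrightarrow> 0"
      by (simp add: norm_wave_L2_diff[OF t])
    then show ?thesis by (rule LIM_zero_cancel[OF tendsto_norm_zero_cancel])
  qed
  ultimately show ?thesis by (metis (no_types, lifting) LIMSEQ_unique ext)
qed

section \<open>The endpoint Sobolev inequality on the Fourier side\<close>

lemma nn_integral_powr_layer:
  fixes a p :: real
  assumes p: "p > 0" and a: "a \<ge> 0"
  shows "(\<integral>\<^sup>+x. ennreal (p * x powr (p - 1)) * indicator {0..a} x \<partial>lborel) = ennreal (a powr p)"
proof -
  have "((\<lambda>x. x powr (p - 1)) has_integral (a powr p / p)) {0..a}"
    using has_integral_powr_from_0[of "p - 1" a] p a by simp
  then have "((\<lambda>x. p * x powr (p - 1)) has_integral (p * (a powr p / p))) {0..a}"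
    by (rule has_integral_mult_right)
  then have "(\<integral>\<^sup>+x. ennreal (p * x powr (p - 1)) * indicator {0..a} x \<partial>lborel) = ennreal (p * (a powr p / p))"
    using p by (intro nn_integral_has_integral_lebesgue') auto
  then show ?thesis using p by simp
qed

lemma nn_integral_powr_tail:
  fixes a b :: real
  assumes b: "b > 0" and a: "a > 0"
  shows "(\<integral>\<^sup>+r. ennreal (b * r powr (- b - 1)) * indicator {a..} r \<partial>lborel) = ennreal (a powr (- b))"
proof -
  have "(\<integral>\<^sup>+r. ennreal (b * r powr (- b - 1)) * indicator {a..} r \<partial>lborel) = ennreal (0 - (- (a powr (- b))))"
  proof (rule nn_integral_FTC_atLeast)
    show "((\<lambda>r. - (r powr (- b))) has_real_derivative b * x powr (- b - 1)) (at x)" if "a \<le> x" for x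
      using that a by (auto intro!: derivative_eq_intros simp: algebra_simps)
    have "((\<lambda>r. r powr (- b)) \<longlongrightarrow> 0) at_top"
      using b by (intro tendsto_neg_powr filterlim_ident) simp
    then show "((\<lambda>r. - (r powr (- b))) \<longlongrightarrow> 0) at_top" using tendsto_minus by fastforce
  qed (use b in auto)
  then show ?thesis by simp
qed

text \<open>Layer-cake form of a radial integral: |x|^(-b) is the integral of b r^(-b-1) over r >=
  |x|, and Tonelli leaves the volumes of balls of radius min r R. The condition b < d is local
  integrability.\<close>

lemma nn_integral_inverse_power_cball:
  fixes b :: real
  assumes b: "0 < b" "b < real DIM('a)"
  obtains K where "K > 0"
    "\<And>R. R > 0 \<Longrightarrow> (\<integral>\<^sup>+x. ennreal (norm x powr (- b)) * indicator (cball 0 R) x \<partial>(lborel :: 'a::euclidean_space measure))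
       \<le> ennreal (K * R powr (real DIM('a) - b))"
proof
  let ?d = "real DIM('a)"
  let ?v = "unit_ball_vol ?d"
  \<comment> \<open>Radii r <= R contribute b / (d - b) and radii r >= R contribute 1, each times
    the volume of the unit ball.\<close>
  let ?K = "?v * (b / (?d - b) + 1)"
  have v: "?v > 0" by simp
  show "?K > 0" using b by (intro mult_pos_pos add_nonneg_pos) auto
  fix R :: real assume R: "R > 0"
  let ?k = "\<lambda>r. ennreal (b * r powr (- b - 1))"
  have vol: "emeasure lborel (cball 0 r :: 'a set) = ennreal (?v * r powr ?d)" if "r > 0" for r
    using that by (simp add: emeasure_cball powr_realpow)
  have "(\<integral>\<^sup>+x. ennreal (norm x powr (- b)) * indicator (cball 0 R) x \<partial>(lborel :: 'a measure))
     \<le> (\<integral>\<^sup>+x. \<integral>\<^sup>+r. ?k r * indicator {0<..} r * (indicator (cball 0 r) (x::'a) * indicator (cball 0 R) x) \<partial>lborel \<partial>lborel)"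
  proof (rule nn_integral_mono)
    fix x :: 'a
    show "ennreal (norm x powr (- b)) * indicator (cball 0 R) x
       \<le> (\<integral>\<^sup>+r. ?k r * indicator {0<..} r * (indicator (cball 0 r) x * indicator (cball 0 R) x) \<partial>lborel)"
    \<comment> \<open>At x = 0 the left side vanishes, because \<open>0 powr (- b)\<close> is
      0.\<close>
    proof (cases "x = 0")
      case False
      have "ennreal (norm x powr (- b)) * indicator (cball 0 R) x = (\<integral>\<^sup>+r. ?k r * indicator {norm x..} r * indicator (cball 0 R) x \<partial>lborel)"
        using False b by (subst nn_integral_multc) (simp_all add: nn_integral_powr_tail)
      also have "\<dots> = (\<integral>\<^sup>+r. ?k r * indicator {0<..} r * (indicator (cball 0 r) x * indicator (cball 0 R) x) \<partial>lborel)"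
      proof (intro nn_integral_cong)
        fix r :: real
        have "0 < r" if "norm x \<le> r" using that False by (meson less_le_trans zero_less_norm_iff)
        then show "?k r * indicator {norm x..} r * indicator (cball 0 R) x
            = ?k r * indicator {0<..} r * (indicator (cball 0 r) x * indicator (cball 0 R) x)"
          by (auto simp: indicator_def)
      qed
      finally show ?thesis by simp
    qed simp
  qed
  also have "\<dots> = (\<integral>\<^sup>+r. \<integral>\<^sup>+x. ?k r * indicator {0<..} r * (indicator (cball 0 r) (x::'a) * indicator (cball 0 R) x) \<partial>lborel \<partial>lborel)"
  proof (rule lborel_pair.Fubini')
    show "(\<lambda>(r, x). ?k r * indicator {0<..} r * (indicator (cball 0 r) (x::'a) * indicator (cball 0 R) x))
       \<in> borel_measurable (lborel \<Otimes>\<^sub>M lborel)"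
      unfolding indicator_def mem_cball dist_0_norm by measurable
  qed
  also have "\<dots> \<le> (\<integral>\<^sup>+r. ennreal (?v * b) * (ennreal (r powr (?d - b - 1)) * indicator {0..R} r)
       + ennreal (?v * R powr ?d) * (?k r * indicator {R..} r) \<partial>lborel)"
  proof (rule nn_integral_mono)
    fix r :: real
    have 1: "(\<integral>\<^sup>+x. ?k r * indicator {0<..} r * (indicator (cball 0 r) (x::'a) * indicator (cball 0 R) x) \<partial>lborel)
       = ?k r * indicator {0<..} r * emeasure lborel (cball 0 r \<inter> cball 0 R :: 'a set)"
      by (subst nn_integral_cmult) (auto simp: indicator_inter_arith[symmetric] intro!: borel_measurable_indicator)
    show "(\<integral>\<^sup>+x. ?k r * indicator {0<..} r * (indicator (cball 0 r) (x::'a) * indicator (cball 0 R) x) \<partial>lborel)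
      \<le> ennreal (?v * b) * (ennreal (r powr (?d - b - 1)) * indicator {0..R} r)
       + ennreal (?v * R powr ?d) * (?k r * indicator {R..} r)"
    proof (cases "r > 0")
      case True
      show ?thesis
      proof (cases "r \<le> R")
        case le: True
        have "cball 0 r \<inter> cball 0 R = (cball 0 r :: 'a set)" using le by auto
        then have "(\<integral>\<^sup>+x. ?k r * indicator {0<..} r * (indicator (cball 0 r) (x::'a) * indicator (cball 0 R) x) \<partial>lborel)
           = ennreal (b * r powr (- b - 1) * (?v * r powr ?d))"
          unfolding 1 using True b v by (simp add: vol ennreal_mult)
        also have "b * r powr (- b - 1) * (?v * r powr ?d) = (?v * b) * r powr (?d - b - 1)"
          by (simp add: algebra_simps flip: powr_add)
        also have "ennreal \<dots> = ennreal (?v * b) * (ennreal (r powr (?d - b - 1)) * indicator {0..R} r)"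
          using True le b v by (simp add: ennreal_mult)
        finally show ?thesis by simp
      next
        case False
        have "cball 0 r \<inter> cball 0 R = (cball 0 R :: 'a set)" using False by auto
        then have "(\<integral>\<^sup>+x. ?k r * indicator {0<..} r * (indicator (cball 0 r) (x::'a) * indicator (cball 0 R) x) \<partial>lborel)
           = ennreal (?v * R powr ?d) * (?k r * indicator {R..} r)"
          unfolding 1 using False True R by (simp add: vol mult.commute)
        then show ?thesis by simp
      qed
    qed simp
  qed
  also have "\<dots> = ennreal (?v * b) * (\<integral>\<^sup>+r. ennreal (r powr (?d - b - 1)) * indicator {0..R} r \<partial>lborel)
       + ennreal (?v * R powr ?d) * (\<integral>\<^sup>+r. ?k r * indicator {R..} r \<partial>lborel)"
    by (simp add: nn_integral_add nn_integral_cmult)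
  also have "(\<integral>\<^sup>+r. ?k r * indicator {R..} r \<partial>lborel) = ennreal (R powr (- b))"
    by (rule nn_integral_powr_tail[OF b(1) R])
  also have "(\<integral>\<^sup>+r. ennreal (r powr (?d - b - 1)) * indicator {0..R} r \<partial>lborel) = ennreal (R powr (?d - b) / (?d - b))"
    using has_integral_powr_from_0[of "?d - b - 1" R] b R by (intro nn_integral_has_integral_lebesgue') auto
  also have "ennreal (?v * b) * ennreal (R powr (?d - b) / (?d - b)) + ennreal (?v * R powr ?d) * ennreal (R powr (- b))
     = ennreal (?v * b * (R powr (?d - b) / (?d - b)) + ?v * R powr ?d * R powr (- b))"
    using b v by (simp add: ennreal_mult[symmetric] ennreal_plus[symmetric] del: ennreal_plus)
  also have "?v * b * (R powr (?d - b) / (?d - b)) + ?v * R powr ?d * R powr (- b) = ?K * R powr (?d - b)"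
    by (simp add: powr_diff powr_minus divide_inverse algebra_simps)
  finally show "(\<integral>\<^sup>+x. ennreal (norm x powr (- b)) * indicator (cball 0 R) x \<partial>(lborel :: 'a measure)) \<le> ennreal (?K * R powr (?d - b))" .
qed

text \<open>
  The proof of Chemin and Xu: at height \<open>2l\<close>, the part of \<open>f\<close> in a ball whose radius is chosen such that its
  transform is bounded by \<open>l\<close> does not contribute, and the rest is estimated by Plancherel's theorem.
\<close>

lemma fourier_op_Lq_bound:
  fixes q \<sigma> :: real
  assumes q: "q > 2" and \<sigma>: "\<sigma> = 1 \<or> \<sigma> = - 1"
  obtains C where "C \<ge> 0"
    "\<And>(f :: 'a::euclidean_space L2) A. A > 0 \<Longrightarrow>
       (\<integral>\<^sup>+x. ennreal (norm x powr (real DIM('a) - 2 * (real DIM('a) / q)) * (norm (rep_L2 f x))\<^sup>2) \<partial>lborel) \<le> ennreal (A\<^sup>2) \<Longrightarrow>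
       (Lp_mass q (rep_L2 (fourier_op \<sigma> f))) \<le> ennreal (C * A powr q)"
proof -
  define d where "d = real DIM('a)"
  define e where "e = d / q"
  \<comment> \<open>Half of b is d (1/2 - 1/q), the Sobolev exponent that belongs to L^q.\<close>
  define b where "b = d - 2 * e"
  have d: "d > 0" by (simp add: d_def)
  have e: "e > 0" using d q by (simp add: e_def)
  have b: "0 < b" "b < d" using d q e by (auto simp: b_def e_def field_simps)
  obtain K where K: "K > 0" and ball: "\<And>R. R > 0 \<Longrightarrow>
      (\<integral>\<^sup>+x. ennreal (norm x powr (- b)) * indicator (cball 0 R) x \<partial>(lborel :: 'a measure)) \<le> ennreal (K * R powr (2 * e))"
    using nn_integral_inverse_power_cball[of b, where 'a='a] b unfolding d_def[symmetric] by (auto simp: b_def)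
  \<comment> \<open>Comes from the L1 bound below: the transform of the part of f in the ball of
    radius R is at most c0 A R^e.\<close>
  define c0 where "c0 = fourier_const TYPE('a) * ((1 + K) / 2)"
  have c0: "c0 > 0" using K by (simp add: c0_def)
  \<comment> \<open>The factor 2^q is due to cutting at height 2l; the rest comes from integrating q
    l^(q-3) up to \<open>w x\<close>.\<close>
  define C where "C = 2 powr q * q / (q - 2) * c0 powr (q - 2)"
  show ?thesis
  proof
    show "C \<ge> 0" using q by (simp add: C_def)
    fix f :: "'a L2" and A :: real
    assume A: "A > 0" and fA: "(\<integral>\<^sup>+x. ennreal (norm x powr (real DIM('a) - 2 * (real DIM('a) / q)) * (norm (rep_L2 f x))\<^sup>2) \<partial>lborel) \<le> ennreal (A\<^sup>2)"
    define w where "w x = c0 * A * norm (x::'a) powr e" for x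
    have [measurable]: "w \<in> borel_measurable borel" unfolding w_def[abs_def] by measurable
    have w0: "w x \<ge> 0" for x using c0 A by (simp add: w_def)
    have fA': "(\<integral>\<^sup>+x. ennreal (norm x powr b * (norm (rep_L2 f x))\<^sup>2) \<partial>lborel) \<le> ennreal (A\<^sup>2)"
      using fA by (simp add: b_def e_def d_def)
    let ?h = "rep_L2 (fourier_op \<sigma> f)"
    have level: "(\<integral>\<^sup>+\<xi>. indicator {0..norm (?h \<xi>) / 2} l \<partial>lborel)
        \<le> ennreal (l powr (- 2)) * (\<integral>\<^sup>+x. ennreal ((norm (rep_L2 f x))\<^sup>2) * indicator {0..w x} l \<partial>lborel)" if l: "l > 0" for l
    proof -
      \<comment> \<open>The radius at which the bound c0 A R^e equals l. Outside this ball
        \<open>w x\<close> >= l, so the remaining part of f lives where l <=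
        \<open>w x\<close>.\<close>
      define R where "R = (l / (c0 * A)) powr (1 / e)"
      have R: "R > 0" using l c0 A by (simp add: R_def)
      have Re: "c0 * A * R powr e = l" using l c0 A e by (simp add: R_def powr_powr)
      have wR: "l \<le> w x" if "norm x > R" for x
      proof -
        have "R powr e \<le> norm x powr e" using that R e by (intro powr_mono2) auto
        then show ?thesis unfolding Re[symmetric] w_def using c0 A by (intro mult_left_mono) auto
      qed
      define f1 where "f1 x = indicator (cball 0 R) x *\<^sub>R rep_L2 f x" for x
      have f1: "L1_L2 f1"
        unfolding f1_def[abs_def] by (rule L1_L2_bounded_support) (use emeasure_bounded_finite[OF bounded_cball] in auto)
      have f1i: "integrable lborel f1" and f1s: "square_integrable f1" using f1 by (auto simp: L1_L2_def)
      have [measurable]: "f1 \<in> borel_measurable borel" using f1i by simp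
      define f2 where "f2 = f - L2_of f1"
      \<comment> \<open>Weight in the arithmetic-geometric inequality \<open>am\<close>; with this
        value both integrated terms become multiples of A R^e.\<close>
      define th where "th = R powr e / A"
      have th: "th > 0" using R A by (simp add: th_def)
      have L1: "(\<integral>\<^sup>+x. ennreal (norm (f1 x)) \<partial>lborel) \<le> ennreal (A * R powr e * ((1 + K) / 2))"
      proof -
        have "AE x in lborel. x \<noteq> (0::'a)" by (rule AE_lborel_singleton)
        then have "(\<integral>\<^sup>+x. ennreal (norm (f1 x)) \<partial>lborel)
          \<le> (\<integral>\<^sup>+x. ennreal (th / 2) * ennreal (norm x powr b * (norm (rep_L2 f x))\<^sup>2) +
               ennreal (1 / (2 * th)) * (ennreal (norm x powr (- b)) * indicator (cball 0 R) x) \<partial>lborel)"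
        proof (intro nn_integral_mono_AE, eventually_elim)
          fix x :: 'a assume x: "x \<noteq> 0"
          let ?n = "norm (rep_L2 f x)" and ?p = "norm x powr b"
          have p: "?p > 0" using x by simp
          have am: "?n \<le> th / 2 * (?p * ?n\<^sup>2) + 1 / (2 * th) * norm x powr (- b)"
          proof -
            have "0 \<le> (sqrt (th * ?p) * ?n - 1 / sqrt (th * ?p))\<^sup>2" by simp
            also have "\<dots> = th * ?p * ?n\<^sup>2 - 2 * ?n + 1 / (th * ?p)"
              using th p by (simp add: power2_diff power_mult_distrib power_divide)
            finally show ?thesis using th p by (simp add: powr_minus field_simps)
          qed
          show "ennreal (norm (f1 x)) \<le> ennreal (th / 2) * ennreal (?p * ?n\<^sup>2) +
               ennreal (1 / (2 * th)) * (ennreal (norm x powr (- b)) * indicator (cball 0 R) x)"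
          proof (cases "x \<in> cball 0 R")
            case True
            then have "norm (f1 x) = ?n" by (simp add: f1_def)
            then have "ennreal (norm (f1 x)) \<le> ennreal (th / 2 * (?p * ?n\<^sup>2) + 1 / (2 * th) * norm x powr (- b))"
              using am by (simp add: ennreal_leI)
            also have "\<dots> = ennreal (th / 2) * ennreal (?p * ?n\<^sup>2) + ennreal (1 / (2 * th)) * ennreal (norm x powr (- b))"
              using th by (simp add: ennreal_mult[symmetric] ennreal_plus[symmetric] del: ennreal_plus)
            finally show ?thesis using True by simp
          qed (simp add: f1_def)
        qed
        also have "\<dots> = ennreal (th / 2) * (\<integral>\<^sup>+x. ennreal (norm x powr b * (norm (rep_L2 f x))\<^sup>2) \<partial>lborel)
             + ennreal (1 / (2 * th)) * (\<integral>\<^sup>+x. ennreal (norm x powr (- b)) * indicator (cball 0 R) x \<partial>(lborel :: 'a measure))"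
        proof -
          have m: "(\<lambda>x. ennreal (norm x powr b * (norm (rep_L2 f x))\<^sup>2)) \<in> borel_measurable lborel"
             "(\<lambda>x::'a. ennreal (norm x powr (- b)) * indicator (cball 0 R) x) \<in> borel_measurable lborel"
            using borel_closed[OF closed_cball, of "0::'a" R] by measurable
          then show ?thesis
            by (subst nn_integral_add) (simp_all only: nn_integral_cmult borel_measurable_times_ennreal borel_measurable_const)
        qed
        also have "\<dots> \<le> ennreal (th / 2) * ennreal (A\<^sup>2) + ennreal (1 / (2 * th)) * ennreal (K * R powr (2 * e))"
          by (intro add_mono mult_left_mono fA' ball[OF R]) auto
        also have "\<dots> = ennreal (th / 2 * A\<^sup>2 + 1 / (2 * th) * (K * R powr (2 * e)))"
          using th K by (simp add: ennreal_mult[symmetric] ennreal_plus[symmetric] del: ennreal_plus)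
        also have "th / 2 * A\<^sup>2 + 1 / (2 * th) * (K * R powr (2 * e)) = A * R powr e * ((1 + K) / 2)"
        proof -
          have "R powr (2 * e) = R powr e * R powr e" by (simp flip: powr_add)
          then show ?thesis using A R by (simp add: th_def power2_eq_square field_simps)
        qed
        finally show ?thesis .
      qed
      have F1: "norm (fourier_integral \<sigma> f1 \<xi>) \<le> l" for \<xi>
      proof -
        have "ennreal (LBINT x. norm (f1 x)) \<le> ennreal (A * R powr e * ((1 + K) / 2))"
          using L1 f1i by (subst nn_integral_eq_integral[symmetric]) auto
        then have i: "(LBINT x. norm (f1 x)) \<le> A * R powr e * ((1 + K) / 2)"
          using A K by (subst (asm) ennreal_le_iff) auto
        have "norm (fourier_integral \<sigma> f1 \<xi>) \<le> fourier_const TYPE('a) * (LBINT x. norm (f1 x))"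
          by (rule norm_fourier_integral_le[OF f1i])
        also have "\<dots> \<le> fourier_const TYPE('a) * (A * R powr e * ((1 + K) / 2))"
          by (intro mult_left_mono i less_imp_le[OF fourier_const_pos])
        also have "\<dots> = l" unfolding Re[symmetric] c0_def by (simp add: mult_ac)
        finally show ?thesis .
      qed
      have h_split: "AE \<xi> in lborel. norm (?h \<xi>) \<le> l + norm (rep_L2 (fourier_op \<sigma> f2) \<xi>)"
      proof -
        have "f = L2_of f1 + f2" by (simp add: f2_def)
        then have "fourier_op \<sigma> f = L2_of (fourier_integral \<sigma> f1) + fourier_op \<sigma> f2"
          by (metis fourier_op_add[OF \<sigma>] fourier_op_L2_of[OF \<sigma> f1])
        then have "AE \<xi> in lborel. ?h \<xi> = rep_L2 (L2_of (fourier_integral \<sigma> f1)) \<xi> + rep_L2 (fourier_op \<sigma> f2) \<xi>"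
          using rep_L2_add by metis
        then show ?thesis
          using L2_of_AE[OF square_integrable_fourier_integral[OF \<sigma> f1]]
        proof eventually_elim
          fix \<xi>
          assume "?h \<xi> = rep_L2 (L2_of (fourier_integral \<sigma> f1)) \<xi> + rep_L2 (fourier_op \<sigma> f2) \<xi>"
            and "rep_L2 (L2_of (fourier_integral \<sigma> f1)) \<xi> = fourier_integral \<sigma> f1 \<xi>"
          then show "norm (?h \<xi>) \<le> l + norm (rep_L2 (fourier_op \<sigma> f2) \<xi>)"
            using F1[of \<xi>] norm_triangle_ineq[of "fourier_integral \<sigma> f1 \<xi>" "rep_L2 (fourier_op \<sigma> f2) \<xi>"] by simp
        qed
      qed
      \<comment> \<open>Where |h| >= 2l the bounded part accounts for at most l, so the rest has
        modulus at least l. Chebyshev's inequality and the isometry then give the level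
        estimate.\<close>
      have "(\<integral>\<^sup>+\<xi>. indicator {0..norm (?h \<xi>) / 2} l \<partial>lborel)
         \<le> (\<integral>\<^sup>+\<xi>. ennreal (l powr (- 2)) * ennreal ((norm (rep_L2 (fourier_op \<sigma> f2) \<xi>))\<^sup>2) \<partial>lborel)"
        using h_split
      proof (intro nn_integral_mono_AE, eventually_elim)
        fix \<xi> assume h: "norm (?h \<xi>) \<le> l + norm (rep_L2 (fourier_op \<sigma> f2) \<xi>)"
        let ?g = "norm (rep_L2 (fourier_op \<sigma> f2) \<xi>)"
        show "indicator {0..norm (?h \<xi>) / 2} l \<le> ennreal (l powr (- 2)) * ennreal (?g\<^sup>2)"
        proof (cases "l \<le> norm (?h \<xi>) / 2")
          case True
          then have "l \<le> ?g" using h by simp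
          then have "l\<^sup>2 \<le> ?g\<^sup>2" using l by (intro power_mono) auto
          then have "1 \<le> l powr (- 2) * ?g\<^sup>2" using l by (simp add: powr_minus field_simps)
          then show ?thesis by (simp add: indicator_def ennreal_mult[symmetric])
        qed (simp add: indicator_def)
      qed
      also have "\<dots> = ennreal (l powr (- 2)) * L2_mass (rep_L2 (fourier_op \<sigma> f2))"
        by (rule nn_integral_cmult) simp
      also have "L2_mass (rep_L2 (fourier_op \<sigma> f2)) = L2_mass (rep_L2 f2)"
        by (simp add: norm_rep_L2_nn norm_fourier_op[OF \<sigma>])
      also have "\<dots> \<le> (\<integral>\<^sup>+x. ennreal ((norm (rep_L2 f x))\<^sup>2) * indicator {0..w x} l \<partial>lborel)"
        using rep_L2_diff[of f "L2_of f1"] L2_of_AE[OF f1s]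
      proof (intro nn_integral_mono_AE, eventually_elim)
        fix x
        assume "rep_L2 (f - L2_of f1) x = rep_L2 f x - rep_L2 (L2_of f1) x" "rep_L2 (L2_of f1) x = f1 x"
        then have f2x: "rep_L2 f2 x = rep_L2 f x - f1 x" by (simp add: f2_def)
        show "ennreal ((norm (rep_L2 f2 x))\<^sup>2) \<le> ennreal ((norm (rep_L2 f x))\<^sup>2) * indicator {0..w x} l"
          using wR[of x] l by (cases "norm x \<le> R") (auto simp: f2x f1_def)
      qed
      finally show ?thesis by (simp add: mult_left_mono)
    qed
    \<comment> \<open>Layer-cake density for (|h| / 2)^q, multiplied by 2^q.\<close>
    let ?k = "\<lambda>l. ennreal (2 powr q * (q * l powr (q - 1)))"
    have "Lp_mass q ?h = (\<integral>\<^sup>+\<xi>. \<integral>\<^sup>+l. ?k l * indicator {0..norm (?h \<xi>) / 2} l \<partial>lborel \<partial>lborel)"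
    proof (rule nn_integral_cong)
      fix \<xi>
      have "(\<integral>\<^sup>+l. ?k l * indicator {0..norm (?h \<xi>) / 2} l \<partial>lborel)
         = (\<integral>\<^sup>+l. ennreal (2 powr q) * (ennreal (q * l powr (q - 1)) * indicator {0..norm (?h \<xi>) / 2} l) \<partial>lborel)"
        using q by (intro nn_integral_cong) (simp add: ennreal_mult mult.assoc)
      also have "\<dots> = ennreal (2 powr q) * ennreal ((norm (?h \<xi>) / 2) powr q)"
        using q by (subst nn_integral_cmult) (simp_all add: nn_integral_powr_layer)
      also have "\<dots> = ennreal (norm (?h \<xi>) powr q)"
        by (simp add: ennreal_mult[symmetric] powr_divide)
      finally show "ennreal (norm (?h \<xi>) powr q) = (\<integral>\<^sup>+l. ?k l * indicator {0..norm (?h \<xi>) / 2} l \<partial>lborel)" by simp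
    qed
    also have "\<dots> = (\<integral>\<^sup>+l. \<integral>\<^sup>+\<xi>. ?k l * indicator {0..norm (?h \<xi>) / 2} l \<partial>lborel \<partial>lborel)"
    proof (rule lborel_pair.Fubini')
      show "(\<lambda>(l, \<xi>). ?k l * indicator {0..norm (?h \<xi>) / 2} l) \<in> borel_measurable (lborel \<Otimes>\<^sub>M lborel)"
        unfolding indicator_def atLeastAtMost_iff by measurable
    qed
    also have "\<dots> \<le> (\<integral>\<^sup>+l. \<integral>\<^sup>+x. ennreal (2 powr q * q * l powr (q - 3)) * (ennreal ((norm (rep_L2 f x))\<^sup>2) * indicator {0..w x} l) \<partial>lborel \<partial>lborel)"
    proof (rule nn_integral_mono)
      fix l :: real
      have "(\<integral>\<^sup>+\<xi>. ?k l * indicator {0..norm (?h \<xi>) / 2} l \<partial>lborel) = ?k l * (\<integral>\<^sup>+\<xi>. indicator {0..norm (?h \<xi>) / 2} l \<partial>lborel)"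
      proof (rule nn_integral_cmult)
        show "(\<lambda>\<xi>. indicator {0..norm (?h \<xi>) / 2} l) \<in> borel_measurable lborel"
          unfolding indicator_def atLeastAtMost_iff by measurable
      qed
      also have "\<dots> \<le> ennreal (2 powr q * q * l powr (q - 3)) * (\<integral>\<^sup>+x. ennreal ((norm (rep_L2 f x))\<^sup>2) * indicator {0..w x} l \<partial>lborel)"
      proof (cases "l > 0")
        case True
        have "?k l * (\<integral>\<^sup>+\<xi>. indicator {0..norm (?h \<xi>) / 2} l \<partial>lborel) \<le>
          ?k l * (ennreal (l powr (- 2)) * (\<integral>\<^sup>+x. ennreal ((norm (rep_L2 f x))\<^sup>2) * indicator {0..w x} l \<partial>lborel))"
          by (intro mult_left_mono level True) simp
        also have "\<dots> = (?k l * ennreal (l powr (- 2))) * (\<integral>\<^sup>+x. ennreal ((norm (rep_L2 f x))\<^sup>2) * indicator {0..w x} l \<partial>lborel)"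
          by (simp only: mult.assoc)
        also have "?k l * ennreal (l powr (- 2)) = ennreal (2 powr q * q * (l powr (q - 1) * l powr (- 2)))"
          using q by (simp add: ennreal_mult[symmetric] mult.assoc)
        also have "l powr (q - 1) * l powr (- 2) = l powr (q - 3)" by (simp flip: powr_add)
        finally show ?thesis .
      next
        case False
        \<comment> \<open>For l < 0 the indicators vanish; at l = 0 the density does, since
          \<open>0 powr (q - 1)\<close> is 0.\<close>
        then consider "l = 0" | "l < 0" by linarith
        then show ?thesis by cases auto
      qed
      also have "\<dots> = (\<integral>\<^sup>+x. ennreal (2 powr q * q * l powr (q - 3)) * (ennreal ((norm (rep_L2 f x))\<^sup>2) * indicator {0..w x} l) \<partial>lborel)"
      proof (rule nn_integral_cmult[symmetric])
        show "(\<lambda>x. ennreal ((norm (rep_L2 f x))\<^sup>2) * indicator {0..w x} l) \<in> borel_measurable lborel"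
          unfolding indicator_def atLeastAtMost_iff by measurable
      qed
      finally show "(\<integral>\<^sup>+\<xi>. ?k l * indicator {0..norm (?h \<xi>) / 2} l \<partial>lborel)
        \<le> (\<integral>\<^sup>+x. ennreal (2 powr q * q * l powr (q - 3)) * (ennreal ((norm (rep_L2 f x))\<^sup>2) * indicator {0..w x} l) \<partial>lborel)" .
    qed
    also have "\<dots> = (\<integral>\<^sup>+x. \<integral>\<^sup>+l. ennreal (2 powr q * q * l powr (q - 3)) * (ennreal ((norm (rep_L2 f x))\<^sup>2) * indicator {0..w x} l) \<partial>lborel \<partial>lborel)"
    proof (rule lborel_pair.Fubini')
      show "(\<lambda>(x, l). ennreal (2 powr q * q * l powr (q - 3)) * (ennreal ((norm (rep_L2 f x))\<^sup>2) * indicator {0..w x} l)) \<in> borel_measurable (lborel \<Otimes>\<^sub>M lborel)"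
        unfolding indicator_def atLeastAtMost_iff by measurable
    qed
    also have "\<dots> = (\<integral>\<^sup>+x. ennreal (C * A powr (q - 2)) * ennreal (norm x powr b * (norm (rep_L2 f x))\<^sup>2) \<partial>lborel)"
    proof (rule nn_integral_cong)
      fix x :: 'a
      have "(\<integral>\<^sup>+l. ennreal (2 powr q * q * l powr (q - 3)) * (ennreal ((norm (rep_L2 f x))\<^sup>2) * indicator {0..w x} l) \<partial>lborel)
        = (\<integral>\<^sup>+l. ennreal (2 powr q * q / (q - 2) * (norm (rep_L2 f x))\<^sup>2) * (ennreal ((q - 2) * l powr (q - 2 - 1)) * indicator {0..w x} l) \<partial>lborel)"
      proof (rule nn_integral_cong)
        fix l :: real
        have "ennreal (2 powr q * q * l powr (q - 3)) * ennreal ((norm (rep_L2 f x))\<^sup>2)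
           = ennreal (2 powr q * q / (q - 2) * (norm (rep_L2 f x))\<^sup>2) * ennreal ((q - 2) * l powr (q - 2 - 1))"
          using q by (simp add: ennreal_mult[symmetric] mult_ac)
        then show "ennreal (2 powr q * q * l powr (q - 3)) * (ennreal ((norm (rep_L2 f x))\<^sup>2) * indicator {0..w x} l)
          = ennreal (2 powr q * q / (q - 2) * (norm (rep_L2 f x))\<^sup>2) * (ennreal ((q - 2) * l powr (q - 2 - 1)) * indicator {0..w x} l)"
          by (simp only: mult.assoc[symmetric])
      qed
      also have "\<dots> = ennreal (2 powr q * q / (q - 2) * (norm (rep_L2 f x))\<^sup>2) * ennreal (w x powr (q - 2))"
        using q w0[of x] by (subst nn_integral_cmult, simp) (subst nn_integral_powr_layer, auto)
      also have "\<dots> = ennreal (2 powr q * q / (q - 2) * (norm (rep_L2 f x))\<^sup>2 * w x powr (q - 2))"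
        using q by (simp add: ennreal_mult[symmetric])
      also have "w x powr (q - 2) = c0 powr (q - 2) * A powr (q - 2) * norm x powr b"
      proof -
        \<comment> \<open>The exponents close up: \<open>w x\<close> is proportional to |x|^e, so
          its power q - 2 restores exactly the weight |x|^b.\<close>
        have "e * (q - 2) = b" using q by (simp add: e_def b_def field_simps)
        then show ?thesis using c0 A by (simp add: w_def powr_mult powr_powr)
      qed
      finally show "(\<integral>\<^sup>+l. ennreal (2 powr q * q * l powr (q - 3)) * (ennreal ((norm (rep_L2 f x))\<^sup>2) * indicator {0..w x} l) \<partial>lborel)
        = ennreal (C * A powr (q - 2)) * ennreal (norm x powr b * (norm (rep_L2 f x))\<^sup>2)"
        using q by (simp add: ennreal_mult[symmetric] C_def mult_ac)
    qed
    also have "\<dots> = ennreal (C * A powr (q - 2)) * (\<integral>\<^sup>+x. ennreal (norm x powr b * (norm (rep_L2 f x))\<^sup>2) \<partial>lborel)"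
      by (rule nn_integral_cmult) simp
    also have "\<dots> \<le> ennreal (C * A powr (q - 2)) * ennreal (A\<^sup>2)"
      by (intro mult_left_mono fA') simp
    also have "\<dots> = ennreal (C * (A powr (q - 2) * A\<^sup>2))"
      using \<open>C \<ge> 0\<close> by (simp add: ennreal_mult[symmetric] mult.assoc)
    also have "A powr (q - 2) * A\<^sup>2 = A powr q"
      using A by (simp add: powr_diff)
    finally show "Lp_mass q ?h \<le> ennreal (C * A powr q)" .
  qed
qed

section \<open>The nonlinearity and its resonant mode\<close>

text \<open>The factor 1/(2s) is what the rescaling leaves in front of the pairing. Its mass on (t,
  2t) does not depend on t, so averaging against it keeps the resonant mode and washes out the
  others. The interval is open as in the interval integral of Duhamel's formula.\<close>

definition log_weight :: "real \<Rightarrow> real \<Rightarrow> real" where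
  "log_weight t s = indicator {t<..<2 * t} s / (2 * s)"

lemma log_weight_measurable [measurable]: "log_weight t \<in> borel_measurable borel"
  unfolding log_weight_def[abs_def] by measurable

lemma log_weight_nonneg: "t > 0 \<Longrightarrow> log_weight t s \<ge> 0"
  by (auto simp: log_weight_def indicator_def)

lemma log_weight_le: "t > 0 \<Longrightarrow> log_weight t s \<le> indicator {t<..<2 * t} s / (2 * t)"
  by (auto simp: log_weight_def indicator_def intro!: divide_left_mono)

lemma integrable_log_weight: "t > 0 \<Longrightarrow> integrable lborel (log_weight t)"
  by (rule Bochner_Integration.integrable_bound[of _ "\<lambda>s. indicator {t<..<2 * t} s / (2 * t)"])
    (auto simp: log_weight_nonneg intro: order_trans[OF log_weight_le])

lemma integral_Ioo_eq_Icc: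
  fixes f :: "real \<Rightarrow> 'b::{banach, second_countable_topology}"
  shows "(LBINT s. indicator {a<..<b} s *\<^sub>R f s) = (LBINT s. indicator {a..b} s *\<^sub>R f s)"
  by (rule integral_discrete_difference[where X="{a, b}"]) (auto simp: indicator_def)

lemma integral_log_weight:
  assumes t: "t > 0" shows "(LBINT s. log_weight t s) = ln 2 / 2"
proof -
  have "(LBINT s. indicator {t..2 * t} s *\<^sub>R (1 / (2 * s))) = ln (2 * t) / 2 - ln t / 2"
  proof (rule integral_FTC_Icc)
    show "((\<lambda>s. ln s / 2) has_vector_derivative 1 / (2 * x)) (at x within {t..2 * t})" if "t \<le> x" "x \<le> 2 * t" for x
      using that t by (auto intro!: derivative_eq_intros simp flip: has_real_derivative_iff_has_vector_derivative)
    show "continuous_on {t..2 * t} (\<lambda>x. 1 / (2 * x))" using t by (auto intro!: continuous_intros)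
  qed (use t in simp)
  then show ?thesis using t
    unfolding integral_Ioo_eq_Icc[symmetric] by (simp add: log_weight_def[abs_def] ln_mult diff_divide_distrib[symmetric])
qed

lemma integrable_log_weight_mult:
  fixes f :: "real \<Rightarrow> complex"
  assumes t: "t > 0" and [measurable]: "f \<in> borel_measurable borel" and b: "\<And>s. norm (f s) \<le> b"
  shows "integrable lborel (\<lambda>s. complex_of_real (log_weight t s) * f s)"
    and "norm (LBINT s. complex_of_real (log_weight t s) * f s) \<le> b * (ln 2 / 2)"
proof -
  have bd: "norm (complex_of_real (log_weight t s) * f s) \<le> b * log_weight t s" for s
    using mult_left_mono[OF b[of s] log_weight_nonneg[OF t, of s]] log_weight_nonneg[OF t, of s]
    by (simp add: norm_mult mult.commute)
  have i: "integrable lborel (\<lambda>s. b * log_weight t s)" using t by (simp add: integrable_log_weight)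
  show int: "integrable lborel (\<lambda>s. complex_of_real (log_weight t s) * f s)"
    by (rule Bochner_Integration.integrable_bound[OF i]) (auto intro!: AE_I2 order_trans[OF bd])
  have "norm (LBINT s. complex_of_real (log_weight t s) * f s) \<le> (LBINT s. b * log_weight t s)"
    using i int bd by (intro Bochner_Integration.integral_norm_bound_integral) auto
  then show "norm (LBINT s. complex_of_real (log_weight t s) * f s) \<le> b * (ln 2 / 2)"
    using t by (simp add: integral_log_weight)
qed

text \<open>Integration by parts against the antiderivative \<open>exp (i w s) / (2 i w s)\<close>.\<close>

lemma log_weight_oscillation_bound:
  fixes w t :: real
  assumes t: "t > 0" and w: "w \<noteq> 0"
  shows "norm (LBINT s. complex_of_real (log_weight t s) * iexp (w * s)) \<le> 3 / (2 * t * \<bar>w\<bar>)"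
proof -
  let ?e = "\<lambda>s. iexp (w * s)"
  let ?G = "\<lambda>s. ?e s / (2 * \<i> * w * s)"
  let ?r = "\<lambda>s. ?e s / (2 * \<i> * w * (complex_of_real s)\<^sup>2)"
  let ?f = "\<lambda>s. ?e s / (2 * s) - ?r s"
  have FTC: "(LBINT s. indicator {t..2 * t} s *\<^sub>R ?f s) = ?G (2 * t) - ?G t"
  proof (rule integral_FTC_Icc)
    fix x assume x: "t \<le> x" "x \<le> 2 * t"
    have "((\<lambda>z. exp (\<i> * (w * z)) / (2 * \<i> * w * z)) has_field_derivative ?f x) (at (complex_of_real x))"
      using x t w by (auto intro!: derivative_eq_intros simp: field_simps power2_eq_square)
    from has_vector_derivative_real_field[OF this]
    show "(?G has_vector_derivative ?f x) (at x within {t..2 * t})"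
      by (simp only: of_real_mult)
  qed (use t w in \<open>auto intro!: continuous_intros\<close>)
  have i1: "integrable lborel (\<lambda>s. indicator {t..2 * t} s *\<^sub>R (?e s / (2 * s)))"
    using t by (intro borel_integrable_compact continuous_intros) auto
  have i2: "integrable lborel (\<lambda>s. indicator {t..2 * t} s *\<^sub>R ?r s)"
    using t w by (intro borel_integrable_compact continuous_intros) auto
  let ?R = "\<integral>s. indicator {t..2 * t} s *\<^sub>R ?r s \<partial>lborel"
  have "(LBINT s. complex_of_real (log_weight t s) * ?e s) = (LBINT s. indicator {t..2 * t} s *\<^sub>R (?e s / (2 * s)))"
    unfolding integral_Ioo_eq_Icc[symmetric]
    by (intro Bochner_Integration.integral_cong refl) (auto simp: log_weight_def indicator_def)
  also have "\<dots> = (LBINT s. indicator {t..2 * t} s *\<^sub>R ?f s) + ?R"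
    using i1 i2 by (simp add: scaleR_diff_right)
  finally have 1: "(LBINT s. complex_of_real (log_weight t s) * ?e s) = ?G (2 * t) - ?G t + ?R"
    unfolding FTC .
  have "norm ?R \<le> (LBINT s. indicator {t..2 * t} s * (1 / (2 * \<bar>w\<bar> * t\<^sup>2)))"
  proof (rule Bochner_Integration.integral_norm_bound_integral[OF i2])
    show "integrable lborel (\<lambda>s. indicator {t..2 * t} s * (1 / (2 * \<bar>w\<bar> * t\<^sup>2)))"
      by (intro integrable_mult_left integrable_real_indicator) (use t in auto)
    show "norm (indicator {t..2 * t} s *\<^sub>R ?r s) \<le> indicator {t..2 * t} s * (1 / (2 * \<bar>w\<bar> * t\<^sup>2))" for s
    proof (cases "s \<in> {t..2 * t}")
      case True
      have "norm (?r s) = 1 / (2 * \<bar>w\<bar> * s\<^sup>2)"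
        by (simp add: norm_divide norm_mult norm_power norm_exp_eq_Re)
      also have "t\<^sup>2 \<le> s\<^sup>2" using True t by (intro power_mono) auto
      then have "1 / (2 * \<bar>w\<bar> * s\<^sup>2) \<le> 1 / (2 * \<bar>w\<bar> * t\<^sup>2)"
        using t w by (intro divide_left_mono mult_left_mono mult_pos_pos) (auto intro: less_le_trans[of 0 "t\<^sup>2"])
      finally show ?thesis using True by (simp only: indicator_simps scaleR_one mult_1_left)
    next
      case False
      then have "indicator {t..2 * t} s = (0::real)" by simp
      then show ?thesis by (simp only: scaleR_zero_left mult_zero_left norm_zero order_refl)
    qed
  qed
  also have "(LBINT s. indicator {t..2 * t} s * (1 / (2 * \<bar>w\<bar> * t\<^sup>2))) = 1 / (2 * \<bar>w\<bar> * t)"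
    using t by (simp add: power2_eq_square)
  finally have 2: "norm ?R \<le> 1 / (2 * \<bar>w\<bar> * t)" .
  have G: "norm (?G x) = 1 / (2 * \<bar>w\<bar> * x)" if "x > 0" for x
    using that by (simp add: norm_divide norm_mult norm_exp_eq_Re)
  have "norm (?G (2 * t) - ?G t + ?R) \<le> norm (?G (2 * t)) + norm (?G t) + norm ?R"
    using norm_triangle_ineq[of "?G (2 * t) - ?G t" ?R] norm_triangle_ineq4[of "?G (2 * t)" "?G t"] by linarith
  \<comment> \<open>The three terms add up to 5 / (4 t |w|).\<close>
  also have "\<dots> \<le> 1 / (2 * \<bar>w\<bar> * (2 * t)) + 1 / (2 * \<bar>w\<bar> * t) + 1 / (2 * \<bar>w\<bar> * t)"
    by (intro add_mono 2 eq_refl[OF G]) (use t in auto)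
  also have "\<dots> \<le> 3 / (2 * t * \<bar>w\<bar>)"
    using t w by (simp add: field_simps)
  finally show ?thesis unfolding 1 .
qed

text \<open>Without oscillation the whole mass of the weight remains for every t; with any fixed
  nonzero frequency nothing remains. This alternative selects the resonant mode.\<close>

lemma log_weight_oscillation_tendsto:
  "((\<lambda>t. \<integral>s. complex_of_real (log_weight t s) * iexp (w * s) \<partial>lborel)
     \<longlongrightarrow> (if w = 0 then complex_of_real (ln 2 / 2) else 0)) at_top"
proof (cases "w = 0")
  case True
  have "\<forall>\<^sub>F t in at_top. (LBINT s. complex_of_real (log_weight t s) * iexp (w * s)) = complex_of_real (ln 2 / 2)"
    using eventually_gt_at_top[of 0] by eventually_elim (simp add: True integral_log_weight)
  then show ?thesis using True by (auto intro: tendsto_eventually)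
next
  case False
  have "((\<lambda>t. 3 / (2 * t * \<bar>w\<bar>)) \<longlongrightarrow> 0) at_top"
    using False by real_asymp
  then have "((\<lambda>t. \<integral>s. complex_of_real (log_weight t s) * iexp (w * s) \<partial>lborel) \<longlongrightarrow> 0) at_top"
  proof (rule Lim_null_comparison[rotated])
    show "\<forall>\<^sub>F t in at_top. norm (LBINT s. complex_of_real (log_weight t s) * iexp (w * s)) \<le> 3 / (2 * t * \<bar>w\<bar>)"
      using eventually_gt_at_top[of 0] by eventually_elim (rule log_weight_oscillation_bound[OF _ False])
  qed
  then show ?thesis using False by simp
qed

section \<open>The modes and the nonlinearity that they sum to\<close>

lemma norm_nonlin_mode: "norm (nonlin_mode d n z) = norm z powr (1 + 2 / real d)"
proof (cases "z = 0")
  case False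
  then have "norm (nonlin_mode d n z) = norm z powr (1 + 2 / real d - n) * norm z powr n"
    by (simp add: nonlin_mode_def norm_mult norm_power_int powr_real_of_int')
  then show ?thesis by (simp flip: powr_add)
qed (simp add: nonlin_mode_def)

text \<open>Against the conjugate of the phase w, mode n is left with w^(n-1), which is independent
  of w only for n = 1.\<close>

lemma nonlin_mode_mult_unimodular:
  assumes "norm w = 1" shows "nonlin_mode d n (w * z) = w powi n * nonlin_mode d n z"
  using assms by (simp add: nonlin_mode_def norm_mult power_int_mult_distrib)

text \<open>Away from 0 every factor is continuous, for negative n as well. At 0 the modulus |z|^(1
  + 2/d), which is the same for all n, forces the limit 0.\<close>

lemma continuous_nonlin_mode: "continuous_on A (nonlin_mode d n)"
proof (intro continuous_at_imp_continuous_on ballI)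
  fix z :: complex
  show "isCont (nonlin_mode d n) z"
  proof (cases "z = 0")
    case False
    then show ?thesis
      unfolding continuous_within nonlin_mode_def
      by (intro tendsto_intros) auto
  next
    case True
    have "((\<lambda>z. norm z powr (1 + 2 / real d)) \<longlongrightarrow> norm (0::complex) powr (1 + 2 / real d)) (at 0)"
      by (intro tendsto_powr' tendsto_norm tendsto_ident_at tendsto_const)
        (auto intro!: add_pos_nonneg tendsto_norm_zero tendsto_ident_at)
    then have "((\<lambda>z. norm z powr (1 + 2 / real d)) \<longlongrightarrow> 0) (at (0::complex))" by simp
    then have "(nonlin_mode d n \<longlongrightarrow> 0) (at 0)"
      by (rule Lim_null_comparison[rotated]) (simp add: norm_nonlin_mode)
    then show ?thesis using True by (simp add: continuous_within nonlin_mode_def)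
  qed
qed

locale fourier_nonlinearity =
  fixes d :: nat and F :: "complex \<Rightarrow> complex"
  assumes homogeneous: "homogeneous_of_degree (1 + 2 / real d) F"
    and decomposition: "\<And>z. ((\<lambda>n::int. nonlin_coeff F n * nonlin_mode d n z) has_sum F z) UNIV"
    and l1: "(\<lambda>n::int. norm (nonlin_coeff F n)) summable_on UNIV"
begin

abbreviation "p \<equiv> 1 + 2 / real d"

definition "B = (\<Sum>\<^sub>\<infinity>n. norm (nonlin_coeff F n))"

lemma B_nonneg: "B \<ge> 0"
  unfolding B_def by (intro infsum_nonneg) auto

lemma p_pos: "p > 0"
  by (intro add_pos_nonneg) auto

lemma norm_F_le: "norm (F z) \<le> B * norm z powr p"
proof -
  have e: "norm (nonlin_coeff F n * nonlin_mode d n z) = norm (nonlin_coeff F n) * norm z powr p" for n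
    by (simp add: norm_mult norm_nonlin_mode)
  have "F z = (\<Sum>\<^sub>\<infinity>n. nonlin_coeff F n * nonlin_mode d n z)"
    using infsumI[OF decomposition[of z]] by simp
  also have "norm \<dots> \<le> (\<Sum>\<^sub>\<infinity>n. norm (nonlin_coeff F n * nonlin_mode d n z))"
    by (rule norm_infsum_bound) (unfold e, intro summable_on_cmult_left l1)
  also have "\<dots> = B * norm z powr p" unfolding e B_def by (rule infsum_cmult_left')
  finally show ?thesis .
qed

lemma F_zero [simp]: "F 0 = 0"
  using norm_F_le[of 0] by simp

text \<open>M-test: all modes have modulus |z|^p, so absolute summability of the coefficients gives
  uniform convergence on balls. This yields continuity of F and, in \<open>resonance\<close>, a
  finite truncation that is uniform in the phase.\<close>

lemma F_uniform_limit:
  "uniform_limit (cball 0 R) (\<lambda>S z. \<Sum>n\<in>S. nonlin_coeff F n * nonlin_mode d n z) F (finite_subsets_at_top UNIV)"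
proof (rule Weierstrass_m_test_general'[where M="\<lambda>n. norm (nonlin_coeff F n) * R powr p"])
  fix n :: int and z :: complex assume "z \<in> cball 0 R"
  then have "norm z powr p \<le> R powr p" using p_pos by (intro powr_mono2) auto
  then show "norm (nonlin_coeff F n * nonlin_mode d n z) \<le> norm (nonlin_coeff F n) * R powr p"
    by (simp add: norm_mult norm_nonlin_mode mult_left_mono)
qed (use decomposition l1 in \<open>auto intro!: summable_on_cmult_left\<close>)

lemma continuous_F: "continuous_on A F"
proof (intro continuous_at_imp_continuous_on ballI)
  fix z :: complex
  have "continuous_on (cball 0 (norm z + 1)) F"
    by (rule uniform_limit_theorem[OF _ F_uniform_limit])
      (auto intro!: always_eventually continuous_intros continuous_nonlin_mode)
  then show "isCont F z"
    by (rule continuous_on_interior) (simp add: interior_cball)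
qed

lemma F_measurable [measurable]: "F \<in> borel_measurable borel"
  by (intro borel_measurable_continuous_onI continuous_F)

lemma F_scale: "r > 0 \<Longrightarrow> F (complex_of_real r * z) = complex_of_real (r powr p) * F z"
  using homogeneous by (simp add: homogeneous_of_degree_def)

text \<open>Continuity alone gives no power of |a - b| as a bound, hence the extra term with the
  small factor e. Homogeneity reduces to |b| = 1. There, close points are handled by uniform
  continuity, and for distant ones |a| and |b| are both at most a constant times |a - b|, so the
  growth bound suffices.\<close>

lemma F_difference_bound:
  assumes e: "e > 0"
  obtains C where "C \<ge> 0" "\<And>a b. (norm (F a - F b))\<^sup>2 \<le> e * norm b powr (2 * p) + C * norm (a - b) powr (2 * p)"
proof -
  have sq: "(x powr p)\<^sup>2 = x powr (2 * p)" if "x \<ge> 0" for x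
  proof -
    have "(x powr p)\<^sup>2 = x powr (p + p)" by (simp only: power2_eq_square powr_add[of x p p])
    also have "p + p = 2 * p" by simp
    finally show ?thesis .
  qed
  \<comment> \<open>Radius 2 contains every a at distance at most 1 from a unit vector.\<close>
  have "uniformly_continuous_on (cball 0 2) F"
    by (intro compact_uniformly_continuous continuous_F) simp
  then obtain \<delta>0 where \<delta>0: "\<delta>0 > 0" "\<And>x y. x \<in> cball 0 2 \<Longrightarrow> y \<in> cball 0 2 \<Longrightarrow> dist y x < \<delta>0 \<Longrightarrow> dist (F y) (F x) < sqrt e"
    unfolding uniformly_continuous_on_def using e by (metis real_sqrt_gt_zero)
  define \<delta> where "\<delta> = min \<delta>0 1"
  have \<delta>: "\<delta> > 0" "\<delta> \<le> 1" "\<delta> \<le> \<delta>0" using \<delta>0(1) by (auto simp: \<delta>_def)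
  \<comment> \<open>For |a - b| >= \<delta> and |b| = 1 the constant 1 is at most |a - b| /
    \<delta>, so |a| <= |a - b| + 1 <= c |a - b|.\<close>
  define c where "c = 1 + 1 / \<delta>"
  have c: "c \<ge> 1" "1 / \<delta> \<le> c" using \<delta> by (auto simp: c_def)
  define C where "C = (2 * B * c powr p)\<^sup>2"
  have unit: "(norm (F a - F b))\<^sup>2 \<le> e + C * norm (a - b) powr (2 * p)" if b: "norm b = 1" for a b
  proof (cases "norm (a - b) < \<delta>")
    case True
    have "norm a \<le> 2" using norm_triangle_sub[of a b] True b \<delta> by simp
    then have "norm (F a - F b) < sqrt e"
      using \<delta>0(2)[of b a] True \<delta> b by (simp add: dist_norm)
    then have "(norm (F a - F b))\<^sup>2 \<le> (sqrt e)\<^sup>2" by (intro power_mono) auto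
    also have "\<dots> = e" using e by simp
    also have "e \<le> e + C * norm (a - b) powr (2 * p)" by (simp add: C_def)
    finally show ?thesis .
  next
    case False
    let ?x = "norm (a - b)"
    have 1: "1 \<le> 1 / \<delta> * ?x" using False \<delta> by (simp add: field_simps)
    have "norm a \<le> ?x + 1" using norm_triangle_sub[of a b] b by simp
    also have "\<dots> \<le> c * ?x" using 1 by (simp add: c_def algebra_simps)
    finally have a: "norm a \<le> c * ?x" .
    have b': "norm b \<le> c * ?x"
      using 1 b mult_right_mono[OF c(2), of ?x] by simp
    have "norm (F a - F b) \<le> norm (F a) + norm (F b)" by (rule norm_triangle_ineq4)
    also have "\<dots> \<le> B * norm a powr p + B * norm b powr p" by (intro add_mono norm_F_le)
    also have "\<dots> \<le> B * (c * ?x) powr p + B * (c * ?x) powr p"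
      using a b' p_pos B_nonneg by (intro add_mono mult_left_mono powr_mono2) auto
    also have "\<dots> = 2 * B * c powr p * ?x powr p" using c by (simp add: powr_mult)
    finally have "(norm (F a - F b))\<^sup>2 \<le> (2 * B * c powr p * ?x powr p)\<^sup>2" by (intro power_mono) auto
    also have "\<dots> = C * ?x powr (2 * p)"
      unfolding C_def power_mult_distrib[of _ "?x powr p"] by (simp only: sq norm_ge_zero)
    finally show ?thesis using e by simp
  qed
  \<comment> \<open>The maximum with B^2 covers b = 0, where no normalisation by |b| is possible and
    only the growth bound is available.\<close>
  define C' where "C' = max C (B\<^sup>2)"
  show ?thesis
  proof
    show "C' \<ge> 0" by (simp add: C'_def le_max_iff_disj)
    fix a b
    show "(norm (F a - F b))\<^sup>2 \<le> e * norm b powr (2 * p) + C' * norm (a - b) powr (2 * p)"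
    proof (cases "b = 0")
      case True
      have "(norm (F a))\<^sup>2 \<le> (B * norm a powr p)\<^sup>2" by (intro power_mono norm_F_le) auto
      also have "\<dots> = B\<^sup>2 * norm a powr (2 * p)"
        unfolding power_mult_distrib by (simp only: sq norm_ge_zero)
      also have "\<dots> \<le> C' * norm a powr (2 * p)" by (intro mult_right_mono) (auto simp: C'_def)
      finally show ?thesis using True by simp
    next
      case False
      let ?r = "norm b"
      have r: "?r > 0" using False by simp
      define a' where "a' = a / ?r"
      define b' where "b' = b / ?r"
      have ab: "a = complex_of_real ?r * a'" "b = complex_of_real ?r * b'" using r by (auto simp: a'_def b'_def)
      have nb: "norm b' = 1" using r by (simp add: b'_def norm_divide)
      have "norm (F a - F b) = ?r powr p * norm (F a' - F b')"
        unfolding ab[THEN arg_cong[where f=F]] F_scale[OF r] by (simp add: norm_mult flip: right_diff_distrib)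
      then have "(norm (F a - F b))\<^sup>2 = ?r powr (2 * p) * (norm (F a' - F b'))\<^sup>2"
        by (simp only: power_mult_distrib sq norm_ge_zero)
      also have "\<dots> \<le> ?r powr (2 * p) * (e + C * norm (a' - b') powr (2 * p))"
        by (intro mult_left_mono unit nb) simp
      also have "\<dots> = e * ?r powr (2 * p) + C * (?r * norm (a' - b')) powr (2 * p)"
        by (simp only: powr_mult) (simp add: algebra_simps)
      also have "?r * norm (a' - b') = norm (a - b)"
        using r by (simp add: a'_def b'_def norm_divide flip: diff_divide_distrib)
      also have "e * ?r powr (2 * p) + C * norm (a - b) powr (2 * p) \<le> e * ?r powr (2 * p) + C' * norm (a - b) powr (2 * p)"
        by (intro add_left_mono mult_right_mono) (auto simp: C'_def)
      finally show ?thesis .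
    qed
  qed
qed

text \<open>Mode n carries the phase w^(n-1) exp (i (n-1) r s), which averages out under
  \<open>log_weight\<close> unless n = 1, as r is not 0. Uniform convergence on the ball of radius
  |z| reduces the sum to finitely many modes, with an error that depends on neither s nor t.\<close>

lemma resonance:
  assumes w: "norm w = 1" and r: "r \<noteq> 0"
  shows "((\<lambda>t. \<integral>s. complex_of_real (log_weight t s) *
       (F (w * iexp (s * r) * z) * cnj (w * iexp (s * r))) \<partial>lborel)
     \<longlongrightarrow> complex_of_real (ln 2 / 2) * (nonlin_coeff F 1 * nonlin_mode d 1 z)) at_top"
    (is "((\<lambda>t. ?I t) \<longlongrightarrow> ?L) at_top")
proof (rule tendstoI)
  fix e :: real assume e: "e > 0"
  let ?E = "\<lambda>s. w * iexp (s * r)"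
  let ?g = "\<lambda>n. nonlin_coeff F n * nonlin_mode d n z"
  have nE: "norm (?E s) = 1" for s using w by (simp add: norm_mult norm_exp_eq_Re)
  have E0: "?E s \<noteq> 0" for s using nE[of s] by auto
  have cE: "cnj (?E s) = inverse (?E s)" for s
    by (rule inverse_unique[symmetric]) (use complex_norm_square[of "?E s"] nE[of s] in simp)
  have "\<forall>\<^sub>F S in finite_subsets_at_top UNIV. \<forall>x\<in>cball 0 (norm z). dist (\<Sum>n\<in>S. nonlin_coeff F n * nonlin_mode d n x) (F x) < e"
    using F_uniform_limit[of "norm z"] e by (auto simp: uniform_limit_iff)
  then obtain S0 where S0: "finite S0" "\<And>S. finite S \<Longrightarrow> S0 \<subseteq> S \<Longrightarrow> \<forall>x\<in>cball 0 (norm z). dist (\<Sum>n\<in>S. nonlin_coeff F n * nonlin_mode d n x) (F x) < e"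
    unfolding eventually_finite_subsets_at_top by auto
  \<comment> \<open>The resonant index is inserted by hand, so that the finite sum has the limit
    \<open>?L\<close> exactly.\<close>
  define S where "S = insert 1 S0"
  have S: "finite S" "1 \<in> S" and approx: "\<And>x. norm x \<le> norm z \<Longrightarrow> norm (F x - (\<Sum>n\<in>S. nonlin_coeff F n * nonlin_mode d n x)) < e"
  proof -
    show S: "finite S" "1 \<in> S" using S0(1) by (auto simp: S_def)
    have "S0 \<subseteq> S" by (auto simp: S_def)
    then show "norm (F x - (\<Sum>n\<in>S. nonlin_coeff F n * nonlin_mode d n x)) < e" if "norm x \<le> norm z" for x
      using S0(2)[OF S(1)] that by (simp add: dist_norm norm_minus_commute)
  qed
  let ?T = "\<lambda>t. \<Sum>n\<in>S. ?g n * w powi (n - 1) * (LBINT s. complex_of_real (log_weight t s) * iexp ((of_int (n - 1) * r) * s))"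
  have "(?T \<longlongrightarrow> (\<Sum>n\<in>S. ?g n * w powi (n - 1) * (if of_int (n - 1) * r = 0 then complex_of_real (ln 2 / 2) else 0))) at_top"
    by (intro tendsto_sum tendsto_mult tendsto_const log_weight_oscillation_tendsto)
  also have "(\<Sum>n\<in>S. ?g n * w powi (n - 1) * (if of_int (n - 1) * r = 0 then complex_of_real (ln 2 / 2) else 0))
      = (\<Sum>n\<in>S. if n = 1 then ?L else 0)"
    using r by (intro sum.cong) auto
  also have "\<dots> = ?L" using S by simp
  finally have "\<forall>\<^sub>F t in at_top. dist (?T t) ?L < e / 2" using e by (intro tendstoD) auto
  then show "\<forall>\<^sub>F t in at_top. dist (?I t) ?L < e"
    using eventually_gt_at_top[of 0]
  proof eventually_elim
    fix t :: real assume dT: "dist (?T t) ?L < e / 2" and t: "t > 0"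
    let ?P = "\<lambda>s. \<Sum>n\<in>S. nonlin_coeff F n * nonlin_mode d n (?E s * z)"
    have ipowi: "?g n * w powi (n - 1) * (complex_of_real (log_weight t s) * iexp ((of_int (n - 1) * r) * s))
        = complex_of_real (log_weight t s) * (nonlin_coeff F n * nonlin_mode d n (?E s * z) * cnj (?E s))" for n s
    proof -
      have "iexp ((of_int (n - 1) * r) * s) = iexp (s * r) powi (n - 1)"
        by (simp add: exp_power_int mult_ac)
      then have "w powi (n - 1) * iexp ((of_int (n - 1) * r) * s) = ?E s powi (n - 1)"
        by (simp add: power_int_mult_distrib)
      also have "\<dots> = ?E s powi n * cnj (?E s)"
        unfolding cE using E0[of s] by (simp only: power_int_diff power_int_1_right divide_inverse simp_thms)
      finally show ?thesis
        unfolding nonlin_mode_mult_unimodular[OF nE] by (simp only: mult_ac)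
    qed
    have iT: "?T t = (LBINT s. complex_of_real (log_weight t s) * (?P s * cnj (?E s)))"
    proof -
      have "integrable lborel (\<lambda>s. complex_of_real (log_weight t s) * iexp ((of_int (n - 1) * r) * s))" for n :: int
        by (rule integrable_log_weight_mult(1)[OF t, where b=1]) (auto simp: norm_exp_eq_Re)
      then have "?T t = (LBINT s. (\<Sum>n\<in>S. ?g n * w powi (n - 1) * (complex_of_real (log_weight t s) * iexp ((of_int (n - 1) * r) * s))))"
        by (subst Bochner_Integration.integral_sum) (simp_all only: integrable_mult_right integral_mult_right_zero)
      then show ?thesis unfolding ipowi by (simp only: sum_distrib_left sum_distrib_right)
    qed
    have mP [measurable]: "?P \<in> borel_measurable borel"
      by (intro borel_measurable_continuous_onI continuous_on_sum continuous_on_mult continuous_on_const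
           continuous_on_compose2[OF continuous_nonlin_mode[of UNIV]] continuous_intros) auto
    have mE [measurable]: "(\<lambda>s. cnj (?E s)) \<in> borel_measurable borel"
      by (intro borel_measurable_continuous_onI continuous_intros)
    have mF [measurable]: "(\<lambda>s. F (?E s * z)) \<in> borel_measurable borel" by measurable
    have bF: "norm (F (?E s * z) * cnj (?E s)) \<le> B * norm z powr p" for s
      using norm_F_le[of "?E s * z"] nE[of s] by (simp add: norm_mult)
    have bD: "norm ((F (?E s * z) - ?P s) * cnj (?E s)) \<le> e" for s
      using approx[of "?E s * z"] nE[of s] by (simp add: norm_mult)
    have bP: "norm (?P s * cnj (?E s)) \<le> B * norm z powr p + e" for s
    proof -
      have "?P s * cnj (?E s) = F (?E s * z) * cnj (?E s) - (F (?E s * z) - ?P s) * cnj (?E s)"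
        by (simp only: left_diff_distrib) simp
      then show ?thesis using norm_triangle_ineq4[of "F (?E s * z) * cnj (?E s)" "(F (?E s * z) - ?P s) * cnj (?E s)"] bF[of s] bD[of s]
        by (simp only:)
    qed
    have mDE: "(\<lambda>s. (F (?E s * z) - ?P s) * cnj (?E s)) \<in> borel_measurable borel"
      by (intro borel_measurable_times borel_measurable_diff mF mP mE)
    note intF = integrable_log_weight_mult(1)[OF t borel_measurable_times[OF mF mE] bF]
    note intP = integrable_log_weight_mult(1)[OF t borel_measurable_times[OF mP mE] bP]
    have "?I t - ?T t = (LBINT s. complex_of_real (log_weight t s) * ((F (?E s * z) - ?P s) * cnj (?E s)))"
      unfolding iT Bochner_Integration.integral_diff[OF intF intP, symmetric]
      by (simp only: right_diff_distrib left_diff_distrib)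
    then have "norm (?I t - ?T t) \<le> e * (ln 2 / 2)"
      using integrable_log_weight_mult(2)[OF t mDE bD] by (simp only:)
    \<comment> \<open>The mass ln 2 / 2 of the weight is below 1/2, so a truncation error of e costs
      less than e / 2.\<close>
    also have "e * (ln 2 / 2) < e * (1 / 2)"
      using e ln_2_less_1 by (intro mult_strict_left_mono) auto
    finally have "dist (?I t) (?T t) < e / 2" by (simp add: dist_norm)
    then show "dist (?I t) ?L < e" using dT dist_triangle[of "?I t" ?L "?T t"] by simp
  qed
qed

end

section \<open>Comparison with the asymptotic profile\<close>

definition Lq_mass :: "real \<Rightarrow> 'a::euclidean_space L2 \<Rightarrow> ennreal" where
  "Lq_mass q g = Lp_mass q (rep_L2 g)"

lemma ennreal_powr_ennreal: "y \<ge> 0 \<Longrightarrow> ennreal_powr (ennreal y) q = ennreal (y powr q)"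
  by (simp add: ennreal_powr_def)

text \<open>For equal exponents the outer power q undoes the inner q-th root, so only time integrals
  of q-th powers remain. The convention that powers of \<open>\<infinity>\<close> are
  \<open>\<infinity>\<close> makes this valid for infinite norms too.\<close>

lemma mixed_norm_diagonal:
  assumes q: "q > 0" and J: "J \<in> sets borel"
  shows "mixed_norm q q J v = ennreal_powr (\<integral>\<^sup>+t. Lq_mass q (v t) * indicator J t \<partial>lborel) (1 / q)"
proof -
  have inner: "Lp_norm q lborel (\<lambda>x. ennreal (norm (rep_L2 g x))) = ennreal_powr (Lq_mass q g) (1 / q)" for g :: "'a L2"
    by (simp add: Lp_norm_def Lq_mass_def ennreal_powr_ennreal)
  have outer: "ennreal_powr (ennreal_powr N (1 / q)) q = N" for N
    using q by (cases N) (auto simp: ennreal_powr_ennreal powr_powr, simp add: ennreal_powr_def)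
  show ?thesis
    unfolding mixed_norm_def inner Lp_norm_def[of q "restrict_space lborel J"] outer
    using J by (simp add: nn_integral_restrict_space)
qed

text \<open>The decay hypothesis in terms of masses: the product is (t M(t))^(1/q), and the root is
  removed by monotonicity. An infinite \<open>M t\<close> is excluded because the product would not
  lie below a finite bound.\<close>

lemma eventually_mass_le:
  fixes M :: "real \<Rightarrow> ennreal"
  assumes q: "q > 0" and c: "c > 0"
    and lim: "((\<lambda>t. ennreal (t powr (1 / q)) * ennreal_powr (M t) (1 / q)) \<longlongrightarrow> 0) at_top"
  shows "\<forall>\<^sub>F t in at_top. ennreal t * M t \<le> ennreal c"
proof -
  have "\<forall>\<^sub>F t in at_top. ennreal (t powr (1 / q)) * ennreal_powr (M t) (1 / q) < ennreal (c powr (1 / q))"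
    using c by (intro order_tendstoD(2)[OF lim]) simp
  then show ?thesis
    using eventually_gt_at_top[of 0]
  proof eventually_elim
    fix t :: real assume lt: "ennreal (t powr (1 / q)) * ennreal_powr (M t) (1 / q) < ennreal (c powr (1 / q))" and t: "t > 0"
    show "ennreal t * M t \<le> ennreal c"
    proof (cases "M t")
      case (real m)
      have "ennreal ((t * m) powr (1 / q)) < ennreal (c powr (1 / q))"
        using lt real t by (simp add: ennreal_powr_ennreal powr_mult flip: ennreal_mult)
      then have lt': "(t * m) powr (1 / q) < c powr (1 / q)" by (simp add: ennreal_less_iff)
      have "t * m \<le> c"
      proof (rule ccontr)
        assume "\<not> t * m \<le> c"
        then have "c powr (1 / q) \<le> (t * m) powr (1 / q)" using c q by (intro powr_mono2) auto
        then show False using lt' by simp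
      qed
      then show ?thesis using real t by (simp add: ennreal_leI flip: ennreal_mult)
    next
      case top
      then show ?thesis using lt t by (simp add: ennreal_powr_def ennreal_mult_top)
    qed
  qed
qed

lemma nn_integral_powr_add_le:
  fixes f g :: "'a \<Rightarrow> complex"
  assumes [measurable]: "f \<in> borel_measurable M" "g \<in> borel_measurable M" and q: "q > 0"
  shows "(\<integral>\<^sup>+x. ennreal (norm (f x + g x) powr q) \<partial>M)
    \<le> ennreal (2 powr q) * ((\<integral>\<^sup>+x. ennreal (norm (f x) powr q) \<partial>M) + (\<integral>\<^sup>+x. ennreal (norm (g x) powr q) \<partial>M))"
proof -
  have "norm (f x + g x) powr q \<le> 2 powr q * (norm (f x) powr q + norm (g x) powr q)" for x
  proof -
    let ?m = "max (norm (f x)) (norm (g x))"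
    have "norm (f x + g x) \<le> 2 * ?m" using norm_triangle_ineq[of "f x" "g x"] by linarith
    then have "norm (f x + g x) powr q \<le> (2 * ?m) powr q" using q by (intro powr_mono2) auto
    also have "\<dots> = 2 powr q * ?m powr q" by (rule powr_mult)
    also have "?m powr q \<le> norm (f x) powr q + norm (g x) powr q"
      by (cases "norm (f x) \<le> norm (g x)") (auto simp: max_def)
    finally show ?thesis by simp
  qed
  then have "(\<integral>\<^sup>+x. ennreal (norm (f x + g x) powr q) \<partial>M)
      \<le> (\<integral>\<^sup>+x. ennreal (2 powr q) * (ennreal (norm (f x) powr q) + ennreal (norm (g x) powr q)) \<partial>M)"
    by (intro nn_integral_mono) (simp add: ennreal_mult[symmetric] ennreal_plus[symmetric] ennreal_leI del: ennreal_plus)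
  also have "\<dots> = ennreal (2 powr q) * ((\<integral>\<^sup>+x. ennreal (norm (f x) powr q) \<partial>M) + (\<integral>\<^sup>+x. ennreal (norm (g x) powr q) \<partial>M))"
    by (simp add: nn_integral_cmult nn_integral_add)
  finally show ?thesis .
qed

lemma chirp_tendsto_1: "((\<lambda>s. chirp s x) \<longlongrightarrow> 1) at_top"
proof -
  have "((\<lambda>s. (norm x)\<^sup>2 / (4 * s)) \<longlongrightarrow> 0) at_top" by real_asymp
  then have "((\<lambda>s. iexp ((norm x)\<^sup>2 / (4 * s))) \<longlongrightarrow> iexp 0) at_top"
    by (intro tendsto_intros)
  then show ?thesis by (simp add: chirp_def)
qed

lemma mult_op_chirp_tendsto: "((\<lambda>s. norm (mult_op (chirp s) f - f)) \<longlongrightarrow> 0) at_top"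
proof (rule tendsto_at_topI_sequentially)
  fix X :: "nat \<Rightarrow> real" assume X: "filterlim X at_top sequentially"
  have "(\<lambda>n. mult_op (chirp (X n)) f) \<longlonglongrightarrow> mult_op (\<lambda>x. 1) f"
    by (intro mult_op_tendsto) (auto intro: filterlim_compose[OF chirp_tendsto_1 X])
  also have "mult_op (\<lambda>x. 1) f = f" by (simp add: mult_op_def)
  finally show "(\<lambda>n. norm (mult_op (chirp (X n)) f - f)) \<longlonglongrightarrow> 0"
    by (rule tendsto_norm_zero[OF LIM_zero])
qed

text \<open>Dominated convergence with |chirp - 1| <= 2. Smallness is measured in the weighted norm
  because this is what the Sobolev inequality carries to L^q on the Fourier side.\<close>

lemma weighted_mult_op_chirp_small:
  fixes f :: "'a::euclidean_space L2"
  assumes w: "integrable lborel (\<lambda>x. norm x powr b * (norm (rep_L2 f x))\<^sup>2)" and \<delta>: "\<delta> > 0"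
  shows "\<forall>\<^sub>F s in at_top. (\<integral>\<^sup>+x. ennreal (norm x powr b * (norm (rep_L2 (mult_op (chirp s) f - f) x))\<^sup>2) \<partial>lborel) \<le> ennreal \<delta>"
proof -
  let ?g = "\<lambda>s x. norm x powr b * (norm (rep_L2 f x))\<^sup>2 * (norm (chirp s x - 1))\<^sup>2"
  have w4: "integrable lborel (\<lambda>x. 4 * (norm x powr b * (norm (rep_L2 f x))\<^sup>2))" using w by simp
  have g_le: "norm (?g s x) \<le> 4 * (norm x powr b * (norm (rep_L2 f x))\<^sup>2)" for s x
  proof -
    have "norm (chirp s x - 1) \<le> 2" using norm_triangle_ineq4[of "chirp s x" 1] by simp
    then have "(norm (chirp s x - 1))\<^sup>2 \<le> 2\<^sup>2" by (intro power_mono) auto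
    then have "?g s x \<le> norm x powr b * (norm (rep_L2 f x))\<^sup>2 * 4" by (intro mult_left_mono) auto
    then show ?thesis by simp
  qed
  have gi: "integrable lborel (?g s)" for s
  proof (rule Bochner_Integration.integrable_bound[OF w4])
    show "AE x in lborel. norm (?g s x) \<le> norm (4 * (norm x powr b * (norm (rep_L2 f x))\<^sup>2))"
      by (intro AE_I2 order_trans[OF g_le]) simp
  qed simp
  have "((\<lambda>s. \<integral>x. ?g s x \<partial>lborel) \<longlongrightarrow> (\<integral>x. 0 \<partial>(lborel :: 'a measure))) at_top"
  proof (rule integral_dominated_convergence_at_top[OF _ _ w4])
    show "AE x in lborel. ((\<lambda>s. ?g s x) \<longlongrightarrow> 0) at_top"
    proof (intro AE_I2)
      fix x :: 'a
      have "((\<lambda>s. ?g s x) \<longlongrightarrow> norm x powr b * (norm (rep_L2 f x))\<^sup>2 * (norm (1 - 1 :: complex))\<^sup>2) at_top"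
        by (intro tendsto_intros chirp_tendsto_1)
      then show "((\<lambda>s. ?g s x) \<longlongrightarrow> 0) at_top" by simp
    qed
    show "\<forall>\<^sub>F s in at_top. AE x in lborel. norm (?g s x) \<le> 4 * (norm x powr b * (norm (rep_L2 f x))\<^sup>2)"
      using g_le by (intro always_eventually allI AE_I2)
  qed simp_all
  then have "\<forall>\<^sub>F s in at_top. (LBINT x. ?g s x) < \<delta>"
    using \<delta> by (intro order_tendstoD(2)) auto
  then show ?thesis
  proof eventually_elim
    fix s :: real assume lt: "(LBINT x. ?g s x) < \<delta>"
    have "AE x in lborel. rep_L2 (mult_op (chirp s) f) x = chirp s x * rep_L2 f x"
      unfolding mult_op_def by (intro L2_of_AE square_integrable_mult_unimodular) auto
    then have "(\<integral>\<^sup>+x. ennreal (norm x powr b * (norm (rep_L2 (mult_op (chirp s) f - f) x))\<^sup>2) \<partial>lborel) = (\<integral>\<^sup>+x. ennreal (?g s x) \<partial>lborel)"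
      using rep_L2_diff[of "mult_op (chirp s) f" f]
    proof (intro nn_integral_cong_AE, eventually_elim)
      fix x assume "rep_L2 (mult_op (chirp s) f) x = chirp s x * rep_L2 f x"
        "rep_L2 (mult_op (chirp s) f - f) x = rep_L2 (mult_op (chirp s) f) x - rep_L2 f x"
      then have "rep_L2 (mult_op (chirp s) f - f) x = rep_L2 f x * (chirp s x - 1)" by (simp add: algebra_simps)
      then show "ennreal (norm x powr b * (norm (rep_L2 (mult_op (chirp s) f - f) x))\<^sup>2) = ennreal (?g s x)"
        by (simp add: norm_mult power_mult_distrib)
    qed
    also have "\<dots> = ennreal (LBINT x. ?g s x)" using gi by (intro nn_integral_eq_integral) auto
    also have "\<dots> \<le> ennreal \<delta>" using lt by (intro ennreal_leI) simp
    finally show "(\<integral>\<^sup>+x. ennreal (norm x powr b * (norm (rep_L2 (mult_op (chirp s) f - f) x))\<^sup>2) \<partial>lborel) \<le> ennreal \<delta>" .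
  qed
qed

lemma Lq_mass_fourier:
  fixes f :: "'a::euclidean_space L2"
  assumes q: "q > 2"
    and w: "integrable lborel (\<lambda>x. norm x powr (real DIM('a) - 2 * (real DIM('a) / q)) * (norm (rep_L2 f x))\<^sup>2)"
  shows "Lq_mass q (fourier_op (- 1) f) < \<infinity>"
    and "\<delta> > 0 \<Longrightarrow> \<forall>\<^sub>F s in at_top. Lq_mass q (fourier_op (- 1) (mult_op (chirp s) f - f)) \<le> ennreal \<delta>"
proof -
  let ?b = "real DIM('a) - 2 * (real DIM('a) / q)"
  obtain C where C: "C \<ge> 0"
    "\<And>(f :: 'a L2) A. A > 0 \<Longrightarrow> (\<integral>\<^sup>+x. ennreal (norm x powr ?b * (norm (rep_L2 f x))\<^sup>2) \<partial>lborel) \<le> ennreal (A\<^sup>2) \<Longrightarrow>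
       (Lp_mass q (rep_L2 (fourier_op (- 1) f))) \<le> ennreal (C * A powr q)"
    by (rule fourier_op_Lq_bound[OF q, of "- 1", where 'a='a]) (simp, rule that)
  define I where "I = (LBINT x. norm x powr ?b * (norm (rep_L2 f x))\<^sup>2)"
  have I: "I \<ge> 0" unfolding I_def by (intro Bochner_Integration.integral_nonneg) auto
  have "(\<integral>\<^sup>+x. ennreal (norm x powr ?b * (norm (rep_L2 f x))\<^sup>2) \<partial>lborel) = ennreal I"
    unfolding I_def using w by (intro nn_integral_eq_integral) auto
  \<comment> \<open>The added 1 provides a positive A, as the inequality asks for.\<close>
  also have "\<dots> \<le> ennreal ((sqrt (I + 1))\<^sup>2)" using I by (intro ennreal_leI) simp
  finally have "Lp_mass q (rep_L2 (fourier_op (- 1) f)) \<le> ennreal (C * sqrt (I + 1) powr q)"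
    using I by (intro C(2)) auto
  then show "Lq_mass q (fourier_op (- 1) f) < \<infinity>"
    unfolding Lq_mass_def by (rule le_less_trans) simp
  assume \<delta>: "\<delta> > 0"
  \<comment> \<open>Gives C A^q = C \<delta> / (C + 1) <= \<delta>; the added 1 covers C =
    0.\<close>
  define A where "A = (\<delta> / (C + 1)) powr (1 / q)"
  have A: "A > 0" using \<delta> C by (simp add: A_def)
  have "A powr q = \<delta> / (C + 1)" using \<delta> C q by (simp add: A_def powr_powr)
  moreover have "C * (\<delta> / (C + 1)) \<le> \<delta>" using C(1) \<delta> by (simp add: field_simps)
  ultimately have CA: "C * A powr q \<le> \<delta>" by (simp only:)
  have "A\<^sup>2 > 0" using A by simp
  from weighted_mult_op_chirp_small[OF w this]
  show "\<forall>\<^sub>F s in at_top. Lq_mass q (fourier_op (- 1) (mult_op (chirp s) f - f)) \<le> ennreal \<delta>"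
  proof eventually_elim
    fix s assume "(\<integral>\<^sup>+x. ennreal (norm x powr ?b * (norm (rep_L2 (mult_op (chirp s) f - f) x))\<^sup>2) \<partial>lborel) \<le> ennreal (A\<^sup>2)"
    from C(2)[OF A this] have "Lq_mass q (fourier_op (- 1) (mult_op (chirp s) f - f)) \<le> ennreal (C * A powr q)"
      unfolding Lq_mass_def .
    also have "\<dots> \<le> ennreal \<delta>" by (intro ennreal_leI CA)
    finally show "Lq_mass q (fourier_op (- 1) (mult_op (chirp s) f - f)) \<le> ennreal \<delta>" .
  qed
qed

section \<open>Replacing the solution by the profile inside the pairing\<close>

context fourier_nonlinearity
begin

abbreviation "q \<equiv> 2 * p"

lemma norm_F_square_le: "(norm (F z))\<^sup>2 \<le> B\<^sup>2 * norm z powr q"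
proof -
  have "(norm (F z))\<^sup>2 \<le> (B * norm z powr p)\<^sup>2" by (intro power_mono norm_F_le) auto
  also have "\<dots> = B\<^sup>2 * (norm z powr p * norm z powr p)" by (simp only: power2_eq_square mult_ac)
  also have "norm z powr p * norm z powr p = norm z powr (p + p)" by (simp only: powr_add)
  also have "p + p = q" by simp
  finally show ?thesis .
qed

lemma
  fixes f :: "'a::euclidean_space \<Rightarrow> complex"
  assumes f [measurable]: "f \<in> borel_measurable borel"
  shows nn_integral_F_le: "L2_mass (\<lambda>x. F (f x)) \<le> ennreal (B\<^sup>2) * Lp_mass q f"
    and square_integrable_F: "Lp_mass q f < \<infinity> \<Longrightarrow> square_integrable (\<lambda>x. F (f x))"
proof -
  have m: "(\<lambda>x. ennreal (norm (f x) powr q)) \<in> borel_measurable lborel" by measurable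
  have "L2_mass (\<lambda>x. F (f x)) \<le> (\<integral>\<^sup>+x. ennreal (B\<^sup>2) * ennreal (norm (f x) powr q) \<partial>lborel)"
    using norm_F_square_le by (intro nn_integral_mono) (simp only: ennreal_mult[symmetric] zero_le_power2 powr_ge_zero ennreal_leI)
  then show le: "L2_mass (\<lambda>x. F (f x)) \<le> ennreal (B\<^sup>2) * Lp_mass q f"
    unfolding nn_integral_cmult[OF m] .
  assume "Lp_mass q f < \<infinity>"
  then show "square_integrable (\<lambda>x. F (f x))"
    by (intro square_integrable_nn le_less_trans[OF le]) (auto simp: ennreal_mult_less_top)
qed

text \<open>The factor 2s is affordable because the profile has L^q mass of order s^(-2), so F of it
  has L2 norm of order 1/s. Only the distance of v to the free wave is not yet known to be small;
  its mass enters with the factor s^2. Uniformity in v allows v = u s at each time s, and extended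
  nonnegative reals are used because that mass may be infinite at some times.\<close>

lemma comparison:
  fixes u_plus \<eta> :: "'a::euclidean_space L2"
  assumes dim: "d = DIM('a)"
    and w: "integrable lborel (\<lambda>x. norm x powr (real DIM('a) - 2 * (real DIM('a) / q)) * (norm (rep_L2 u_plus x))\<^sup>2)"
    and \<epsilon>: "\<epsilon> > 0"
  obtains C where "C > 0"
    "\<forall>\<^sub>F s in at_top. \<forall>v :: 'a L2.
       ennreal (2 * s * \<bar>L2_of (\<lambda>x. F (rep_L2 v x)) \<bullet> schroedinger_group s \<eta>
          - L2_of (\<lambda>x. F (wave s (rep_L2 (fourier_op (- 1) u_plus)) x)) \<bullet> L2_of (wave s (rep_L2 (fourier_op (- 1) \<eta>)))\<bar>)
       \<le> ennreal \<epsilon> + ennreal (C * (2 * s)\<^sup>2) * Lq_mass q (v - schroedinger_group s u_plus)"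
proof -
  have d: "d > 0" using dim by simp
  have q: "q > 2" using d by simp
  have q0: "q > 0" using q by linarith
  let ?\<phi> = "rep_L2 (fourier_op (- 1) u_plus)"
  let ?\<zeta> = "rep_L2 (fourier_op (- 1) \<eta>)"
  note mass = Lq_mass_fourier[OF q w]
  define N where "N = enn2real (Lq_mass q (fourier_op (- 1) u_plus))"
  have N: "Lq_mass q (fourier_op (- 1) u_plus) = ennreal N" "N \<ge> 0"
    using mass(1) by (auto simp: N_def)
  \<comment> \<open>The coefficient in Young's inequality X |\<eta>| <= \<epsilon> / 4 + \<kappa>
    X^2.\<close>
  define \<kappa> where "\<kappa> = (norm \<eta>)\<^sup>2 / \<epsilon>"
  have \<kappa>: "\<kappa> \<ge> 0" using \<epsilon> by (simp add: \<kappa>_def)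
  \<comment> \<open>\<open>e1\<close>, \<open>\<delta>\<close> and \<open>y0\<close> are such that
    each contributes at most \<epsilon> / 4 by \<open>frac\<close>; the added 1 keeps the
    denominators positive.\<close>
  define e1 where "e1 = \<epsilon> / (4 * (\<kappa> * N + 1))"
  have e1: "e1 > 0" using \<epsilon> \<kappa> N by (simp add: e1_def add_nonneg_pos)
  obtain C1 where C1: "C1 \<ge> 0" "\<And>a b. (norm (F a - F b))\<^sup>2 \<le> e1 * norm b powr q + C1 * norm (a - b) powr q"
    using F_difference_bound[OF e1] by blast
  define Q where "Q = C1 * 2 powr q"
  have Q: "Q \<ge> 0" using C1 by (simp add: Q_def)
  define \<delta> where "\<delta> = \<epsilon> / (4 * (\<kappa> * Q + 1))"
  have \<delta>: "\<delta> > 0" using \<epsilon> \<kappa> Q by (simp add: \<delta>_def add_nonneg_pos)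
  define y0 where "y0 = \<epsilon> / (4 * (B * sqrt N + 1))"
  have y0: "y0 > 0" using \<epsilon> B_nonneg N by (simp add: y0_def add_nonneg_pos)
  have frac: "x * (\<epsilon> / (4 * (x + 1))) \<le> \<epsilon> / 4" if "x \<ge> 0" for x
    using that \<epsilon> by (simp add: field_simps)
  define C where "C = \<kappa> * Q + 1"
  show ?thesis
  proof (rule that)
    show "C > 0" using \<kappa> Q by (simp add: C_def add_nonneg_pos)
    have "\<forall>\<^sub>F s in at_top. norm (mult_op (chirp s) \<eta> - \<eta>) < y0"
      by (rule order_tendstoD(2)[OF mult_op_chirp_tendsto y0])
    then show "\<forall>\<^sub>F s in at_top. \<forall>v :: 'a L2.
       ennreal (2 * s * \<bar>L2_of (\<lambda>x. F (rep_L2 v x)) \<bullet> schroedinger_group s \<eta>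
          - L2_of (\<lambda>x. F (wave s (rep_L2 (fourier_op (- 1) u_plus)) x)) \<bullet> L2_of (wave s (rep_L2 (fourier_op (- 1) \<eta>)))\<bar>)
       \<le> ennreal \<epsilon> + ennreal (C * (2 * s)\<^sup>2) * Lq_mass q (v - schroedinger_group s u_plus)"
      using mass(2)[OF \<delta>] eventually_gt_at_top[of 0]
    proof (eventually_elim, intro allI)
      fix s :: real and v :: "'a L2"
      assume y: "norm (mult_op (chirp s) \<eta> - \<eta>) < y0"
        and m: "Lq_mass q (fourier_op (- 1) (mult_op (chirp s) u_plus - u_plus)) \<le> ennreal \<delta>" and s: "s > 0"
      let ?V = "wave s ?\<phi>"
      let ?G = "L2_of (\<lambda>x. F (rep_L2 v x))"
      let ?GV = "L2_of (\<lambda>x. F (?V x))"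
      let ?W = "L2_of (wave s ?\<zeta>)"
      have pw: "(2 * s) powr (real DIM('a) * (1 - q / 2)) = 1 / (2 * s)\<^sup>2"
      proof -
        have e: "real DIM('a) * (1 - q / 2) = - 2" using d by (simp add: dim[symmetric] field_simps)
        have "(2 * s) powr (- 2) = 1 / (2 * s) powr 2" by (rule powr_minus_divide)
        also have "(2 * s) powr 2 = (2 * s)\<^sup>2" using s by (intro powr_numeral) simp
        finally show ?thesis unfolding e .
      qed
      have wave_mass: "Lp_mass q (wave s g) = ennreal (1 / (2 * s)\<^sup>2) * Lp_mass q g"
        if "g \<in> borel_measurable borel" for g :: "'a \<Rightarrow> complex"
        using nn_integral_wave[OF s that, of q] unfolding pw .
      have V_mass: "Lp_mass q ?V = ennreal (1 / (2 * s)\<^sup>2 * N)"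
        using wave_mass[OF rep_L2_borel, of "fourier_op (- 1) u_plus"]
        unfolding Lq_mass_def[symmetric] N(1) ennreal_mult''[OF N(2)] .
      show "ennreal (2 * s * \<bar>?G \<bullet> schroedinger_group s \<eta> - ?GV \<bullet> ?W\<bar>)
         \<le> ennreal \<epsilon> + ennreal (C * (2 * s)\<^sup>2) * Lq_mass q (v - schroedinger_group s u_plus)"
      proof (cases "Lq_mass q (v - schroedinger_group s u_plus)")
        case top
        have "C * (2 * s)\<^sup>2 > 0" using \<open>C > 0\<close> s by simp
        then show ?thesis using top \<open>C > 0\<close> by (simp add: ennreal_mult_top)
      next
        case (real n)
        let ?\<phi>s = "rep_L2 (fourier_op (- 1) (mult_op (chirp s) u_plus))"
        have D_mass: "Lp_mass q (\<lambda>x. rep_L2 v x - ?V x) \<le> ennreal (2 powr q * (n + 1 / (2 * s)\<^sup>2 * \<delta>))"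
        proof -
          have "AE x in lborel. rep_L2 (schroedinger_group s u_plus) x = wave s ?\<phi>s x"
            unfolding schroedinger_group_wave[OF s] by (intro L2_of_AE square_integrable_wave s) simp
          \<comment> \<open>The error splits into the distance of v to the free wave and the error
            of dropping the inner chirp from the factorisation.\<close>
          then have "AE x in lborel. rep_L2 v x - ?V x = rep_L2 (v - schroedinger_group s u_plus) x + wave s (\<lambda>y. ?\<phi>s y - ?\<phi> y) x"
            using rep_L2_diff[of v "schroedinger_group s u_plus"]
            by eventually_elim (simp flip: wave_diff)
          then have "Lp_mass q (\<lambda>x. rep_L2 v x - ?V x)
             = Lp_mass q (\<lambda>x. rep_L2 (v - schroedinger_group s u_plus) x + wave s (\<lambda>y. ?\<phi>s y - ?\<phi> y) x)"
            by (intro nn_integral_cong_AE) (erule eventually_mono, simp only:)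
          also have "\<dots> \<le> ennreal (2 powr q) * (Lq_mass q (v - schroedinger_group s u_plus)
              + Lp_mass q (wave s (\<lambda>y. ?\<phi>s y - ?\<phi> y)))"
            unfolding Lq_mass_def by (intro nn_integral_powr_add_le q0) auto
          also have "Lp_mass q (wave s (\<lambda>y. ?\<phi>s y - ?\<phi> y))
              = ennreal (1 / (2 * s)\<^sup>2) * Lp_mass q (\<lambda>x. ?\<phi>s x - ?\<phi> x)"
            by (intro wave_mass) auto
          also have "Lp_mass q (\<lambda>x. ?\<phi>s x - ?\<phi> x)
              = Lq_mass q (fourier_op (- 1) (mult_op (chirp s) u_plus - u_plus))"
          proof -
            have "fourier_op (- 1) (mult_op (chirp s) u_plus - u_plus)
                = fourier_op (- 1) (mult_op (chirp s) u_plus) - fourier_op (- 1) u_plus"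
              by (rule linear_diff[OF bounded_linear.linear[OF bounded_linear_fourier_op]]) simp
            then show ?thesis
              unfolding Lq_mass_def
              using rep_L2_diff[of "fourier_op (- 1) (mult_op (chirp s) u_plus)" "fourier_op (- 1) u_plus"]
              by (intro nn_integral_cong_AE) (erule eventually_mono, simp only:)
          qed
          also have "ennreal (2 powr q) * (Lq_mass q (v - schroedinger_group s u_plus)
              + ennreal (1 / (2 * s)\<^sup>2) * Lq_mass q (fourier_op (- 1) (mult_op (chirp s) u_plus - u_plus)))
              \<le> ennreal (2 powr q) * (ennreal n + ennreal (1 / (2 * s)\<^sup>2) * ennreal \<delta>)"
            by (intro mult_left_mono add_mono m) (simp_all only: real zero_le order_refl)
          also have "\<dots> = ennreal (2 powr q * (n + 1 / (2 * s)\<^sup>2 * \<delta>))"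
            using real \<delta> by (simp add: ennreal_mult[symmetric] ennreal_plus[symmetric] del: ennreal_plus)
          finally show ?thesis .
        qed
        have FV: "square_integrable (\<lambda>x. F (?V x))"
        proof (rule square_integrable_F)
          show "Lp_mass q ?V < \<infinity>" unfolding V_mass by simp
        qed simp
        have Fv: "square_integrable (\<lambda>x. F (rep_L2 v x))"
        proof (rule square_integrable_F)
          have "Lp_mass q (\<lambda>x. (rep_L2 v x - ?V x) + ?V x)
            \<le> ennreal (2 powr q) * (Lp_mass q (\<lambda>x. rep_L2 v x - ?V x) + Lp_mass q ?V)"
            by (intro nn_integral_powr_add_le q0) auto
          also have "\<dots> < \<infinity>"
            unfolding V_mass using le_less_trans[OF D_mass, of \<infinity>] by (simp add: ennreal_mult_less_top)
          finally show "Lp_mass q (rep_L2 v) < \<infinity>" by simp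
        qed simp
        have X: "(2 * s * norm (?G - ?GV))\<^sup>2 \<le> e1 * N + Q * ((2 * s)\<^sup>2 * n + \<delta>)"
        proof -
          have "ennreal ((norm (?G - ?GV))\<^sup>2) = L2_mass (\<lambda>x. F (rep_L2 v x) - F (?V x))"
            using Fv FV by (simp add: norm_L2_of_nn square_integrable_diff L2_of_diff)
          also have "\<dots> \<le> (\<integral>\<^sup>+x. ennreal e1 * ennreal (norm (?V x) powr q) + ennreal C1 * ennreal (norm (rep_L2 v x - ?V x) powr q) \<partial>lborel)"
          proof (rule nn_integral_mono)
            fix x
            have "ennreal ((norm (F (rep_L2 v x) - F (?V x)))\<^sup>2) \<le> ennreal (e1 * norm (?V x) powr q + C1 * norm (rep_L2 v x - ?V x) powr q)"
              by (intro ennreal_leI C1(2))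
            also have "\<dots> = ennreal e1 * ennreal (norm (?V x) powr q) + ennreal C1 * ennreal (norm (rep_L2 v x - ?V x) powr q)"
              using e1 C1(1) by (simp add: ennreal_mult[symmetric] ennreal_plus[symmetric] del: ennreal_plus)
            finally show "ennreal ((norm (F (rep_L2 v x) - F (?V x)))\<^sup>2)
               \<le> ennreal e1 * ennreal (norm (?V x) powr q) + ennreal C1 * ennreal (norm (rep_L2 v x - ?V x) powr q)" .
          qed
          also have "\<dots> = ennreal e1 * Lp_mass q ?V + ennreal C1 * Lp_mass q (\<lambda>x. rep_L2 v x - ?V x)"
            by (simp add: nn_integral_add nn_integral_cmult)
          also have "\<dots> \<le> ennreal e1 * ennreal (1 / (2 * s)\<^sup>2 * N) + ennreal C1 * ennreal (2 powr q * (n + 1 / (2 * s)\<^sup>2 * \<delta>))"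
            unfolding V_mass by (intro add_mono mult_left_mono D_mass) auto
          also have "\<dots> = ennreal (e1 * (1 / (2 * s)\<^sup>2 * N) + C1 * (2 powr q * (n + 1 / (2 * s)\<^sup>2 * \<delta>)))"
            using e1 C1(1) N(2) real \<delta> by (simp add: ennreal_mult[symmetric] ennreal_plus[symmetric] del: ennreal_plus)
          finally have "(norm (?G - ?GV))\<^sup>2 \<le> e1 * (1 / (2 * s)\<^sup>2 * N) + C1 * (2 powr q * (n + 1 / (2 * s)\<^sup>2 * \<delta>))"
            using e1 C1(1) N(2) real \<delta> by (subst (asm) ennreal_le_iff) auto
          then have "(2 * s)\<^sup>2 * (norm (?G - ?GV))\<^sup>2 \<le> (2 * s)\<^sup>2 * (e1 * (1 / (2 * s)\<^sup>2 * N) + C1 * (2 powr q * (n + 1 / (2 * s)\<^sup>2 * \<delta>)))"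
            by (intro mult_left_mono) auto
          also have "\<dots> = e1 * N * ((2 * s)\<^sup>2 * (1 / (2 * s)\<^sup>2)) + Q * ((2 * s)\<^sup>2 * n + \<delta> * ((2 * s)\<^sup>2 * (1 / (2 * s)\<^sup>2)))"
            unfolding Q_def by (simp only: algebra_simps)
          also have "(2 * s)\<^sup>2 * (1 / (2 * s)\<^sup>2) = 1" using s by simp
          finally show ?thesis by (simp only: power_mult_distrib[of "2 * s"] mult_1_right)
        qed
        have GV: "2 * s * norm ?GV \<le> B * sqrt N"
        proof -
          have "ennreal ((norm ?GV)\<^sup>2) \<le> ennreal (B\<^sup>2) * ennreal (1 / (2 * s)\<^sup>2 * N)"
            using nn_integral_F_le[of ?V] unfolding V_mass norm_L2_of_nn[OF FV] by simp
          also have "\<dots> = ennreal (B\<^sup>2 * (1 / (2 * s)\<^sup>2 * N))" using N by (simp add: ennreal_mult[symmetric])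
          finally have "(norm ?GV)\<^sup>2 \<le> B\<^sup>2 * (1 / (2 * s)\<^sup>2 * N)" using N by (subst (asm) ennreal_le_iff) auto
          then have "(2 * s)\<^sup>2 * (norm ?GV)\<^sup>2 \<le> (2 * s)\<^sup>2 * (B\<^sup>2 * (1 / (2 * s)\<^sup>2 * N))" by (intro mult_left_mono) auto
          also have "\<dots> = B\<^sup>2 * N" using s by simp
          also have "\<dots> = (B * sqrt N)\<^sup>2" using N by (simp add: power_mult_distrib)
          finally have "(2 * s * norm ?GV)\<^sup>2 \<le> (B * sqrt N)\<^sup>2" by (simp only: power_mult_distrib)
          then show ?thesis by (rule power2_le_imp_le) (simp add: B_nonneg N)
        qed
        have UW: "norm (schroedinger_group s \<eta> - ?W) < y0"
        proof -
          have "norm (schroedinger_group s \<eta> - ?W) = norm (fourier_op (- 1) (mult_op (chirp s) \<eta>) - fourier_op (- 1) \<eta>)"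
            unfolding schroedinger_group_wave[OF s] by (subst norm_wave_L2_diff[OF s]) auto
          also have "fourier_op (- 1) (mult_op (chirp s) \<eta>) - fourier_op (- 1) \<eta> = fourier_op (- 1) (mult_op (chirp s) \<eta> - \<eta>)"
            by (rule linear_diff[OF bounded_linear.linear[OF bounded_linear_fourier_op], symmetric]) simp
          also have "norm \<dots> = norm (mult_op (chirp s) \<eta> - \<eta>)" by (simp add: norm_fourier_op)
          finally show ?thesis using y by simp
        qed
        let ?X = "2 * s * norm (?G - ?GV)"
        \<comment> \<open>In the first term only the nonlinearity changes, paired with the whole of
          U(s) \<eta>. In the second the nonlinearity is that of the profile, of norm O(1/s), and
          meets the vanishing error of U(s) \<eta>.\<close>
        have "?G \<bullet> schroedinger_group s \<eta> - ?GV \<bullet> ?W = (?G - ?GV) \<bullet> schroedinger_group s \<eta> + ?GV \<bullet> (schroedinger_group s \<eta> - ?W)"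
          by (simp add: inner_diff_left inner_diff_right)
        also have "\<bar>\<dots>\<bar> \<le> norm (?G - ?GV) * norm \<eta> + norm ?GV * norm (schroedinger_group s \<eta> - ?W)"
          using Cauchy_Schwarz_ineq2[of "?G - ?GV" "schroedinger_group s \<eta>"] Cauchy_Schwarz_ineq2[of ?GV "schroedinger_group s \<eta> - ?W"]
          by (simp only: norm_schroedinger_group)
        finally have "2 * s * \<bar>?G \<bullet> schroedinger_group s \<eta> - ?GV \<bullet> ?W\<bar>
            \<le> 2 * s * (norm (?G - ?GV) * norm \<eta> + norm ?GV * norm (schroedinger_group s \<eta> - ?W))"
          using s by (intro mult_left_mono) auto
        also have "\<dots> = ?X * norm \<eta> + (2 * s * norm ?GV) * norm (schroedinger_group s \<eta> - ?W)"
          by (simp add: algebra_simps)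
        also have "\<dots> \<le> (\<epsilon> / 4 + \<kappa> * ?X\<^sup>2) + \<epsilon> / 4"
        proof (rule add_mono)
          have "0 \<le> (sqrt \<epsilon> / 2 - ?X * norm \<eta> / sqrt \<epsilon>)\<^sup>2" by simp
          also have "\<dots> = \<epsilon> / 4 + \<kappa> * ?X\<^sup>2 - ?X * norm \<eta>"
            using \<epsilon> by (simp add: \<kappa>_def power2_diff power_divide power_mult_distrib)
          finally show "?X * norm \<eta> \<le> \<epsilon> / 4 + \<kappa> * ?X\<^sup>2" by simp
          have "(2 * s * norm ?GV) * norm (schroedinger_group s \<eta> - ?W) \<le> (B * sqrt N) * y0"
            by (rule mult_mono[OF GV less_imp_le[OF UW]]) (simp_all add: B_nonneg N)
          also have "\<dots> \<le> \<epsilon> / 4" unfolding y0_def using B_nonneg N by (intro frac) simp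
          finally show "(2 * s * norm ?GV) * norm (schroedinger_group s \<eta> - ?W) \<le> \<epsilon> / 4" .
        qed
        also have "\<kappa> * ?X\<^sup>2 \<le> \<kappa> * (e1 * N + Q * ((2 * s)\<^sup>2 * n + \<delta>))"
          by (intro mult_left_mono X \<kappa>)
        also have "\<dots> = (\<kappa> * N) * e1 + (\<kappa> * Q) * \<delta> + \<kappa> * Q * ((2 * s)\<^sup>2 * n)"
          by (simp add: algebra_simps)
        also have "(\<kappa> * N) * e1 + (\<kappa> * Q) * \<delta> + \<kappa> * Q * ((2 * s)\<^sup>2 * n) \<le> \<epsilon> / 4 + \<epsilon> / 4 + C * ((2 * s)\<^sup>2 * n)"
          unfolding e1_def \<delta>_def C_def using \<kappa> N Q real
          by (intro add_mono frac mult_right_mono mult_nonneg_nonneg) auto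
        finally have "2 * s * \<bar>?G \<bullet> schroedinger_group s \<eta> - ?GV \<bullet> ?W\<bar> \<le> \<epsilon> + C * (2 * s)\<^sup>2 * n"
          by (simp add: mult.assoc)
        then have "ennreal (2 * s * \<bar>?G \<bullet> schroedinger_group s \<eta> - ?GV \<bullet> ?W\<bar>) \<le> ennreal (\<epsilon> + C * (2 * s)\<^sup>2 * n)"
          by (rule ennreal_leI)
        also have "\<dots> = ennreal \<epsilon> + ennreal (C * (2 * s)\<^sup>2) * ennreal n"
          using \<epsilon> \<open>C > 0\<close> real by (simp add: ennreal_mult[symmetric] ennreal_plus[symmetric] del: ennreal_plus)
        finally show ?thesis using real by simp
      qed
    qed
  qed
qed

end

section \<open>The pairing along the asymptotic profile\<close>

context fourier_nonlinearity
begin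

text \<open>The phase of \<open>wave\<close> at x = 2 s y: the chirp becomes exp (i s |y|^2), so in
  the variable y the oscillation in s has the fixed frequency |y|^2.\<close>

definition modulation :: "real \<Rightarrow> 'a::euclidean_space \<Rightarrow> complex" where
  "modulation s y = csqrt (- \<i>) ^ DIM('a) * iexp (s * (norm y)\<^sup>2)"

lemma norm_modulation [simp]: "norm (modulation s y) = 1"
  by (simp add: modulation_def norm_mult norm_power norm_exp_eq_Re)

lemma modulation_measurable [measurable]:
  "(\<lambda>(s, y). modulation s (y :: 'a::euclidean_space)) \<in> borel_measurable (borel \<Otimes>\<^sub>M borel)"
  unfolding modulation_def by measurable

text \<open>The integrand of the pairing after rescaling, with all amplitudes stripped off. Its
  modulus is bounded independently of s.\<close>

definition pairing_density :: "('a::euclidean_space \<Rightarrow> complex) \<Rightarrow> ('a \<Rightarrow> complex) \<Rightarrow> real \<Rightarrow> 'a \<Rightarrow> complex" where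
  "pairing_density \<phi> \<zeta> s y = F (modulation s y * \<phi> y) * cnj (modulation s y) * cnj (\<zeta> y)"

lemma norm_pairing_density_le: "norm (pairing_density \<phi> \<zeta> s y) \<le> B * norm (\<phi> y) powr p * norm (\<zeta> y)"
proof -
  have "norm (pairing_density \<phi> \<zeta> s y) = norm (F (modulation s y * \<phi> y)) * norm (\<zeta> y)"
    by (simp add: pairing_density_def norm_mult)
  also have "\<dots> \<le> B * norm (modulation s y * \<phi> y) powr p * norm (\<zeta> y)"
    by (intro mult_right_mono norm_F_le) simp
  finally show ?thesis by (simp add: norm_mult)
qed

lemma pairing_density_measurable:
  fixes \<phi> \<zeta> :: "'a::euclidean_space \<Rightarrow> complex"
  assumes [measurable]: "\<phi> \<in> borel_measurable borel" "\<zeta> \<in> borel_measurable borel"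
  shows "(\<lambda>(s, y). pairing_density \<phi> \<zeta> s y) \<in> borel_measurable (borel \<Otimes>\<^sub>M borel)"
  unfolding pairing_density_def by measurable

text \<open>|\<phi>|^p is in L2 because |\<phi>|^q with q = 2p is integrable. The function is free
  of s and serves as the majorant in the limit t \<rightarrow> \<infinity>.\<close>

lemma integrable_pairing_bound:
  fixes \<phi> \<zeta> :: "'a::euclidean_space \<Rightarrow> complex"
  assumes \<phi> [measurable]: "\<phi> \<in> borel_measurable borel" and \<zeta>: "square_integrable \<zeta>"
    and fin: "Lp_mass q \<phi> < \<infinity>"
  shows "integrable lborel (\<lambda>y. B * norm (\<phi> y) powr p * norm (\<zeta> y))"
proof (rule Bochner_Integration.integrable_bound)
  have [measurable]: "\<zeta> \<in> borel_measurable borel" using \<zeta> by (rule square_integrable_borel)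
  have "integrable lborel (\<lambda>x. norm (\<phi> x) powr q)"
    using fin by (intro integrableI_bounded) auto
  then show "integrable lborel (\<lambda>y. B * (norm (\<phi> y) powr q + (norm (\<zeta> y))\<^sup>2))"
    using \<zeta> by (intro integrable_mult_right Bochner_Integration.integrable_add) (auto simp: square_integrable_def)
  show "(\<lambda>y. B * norm (\<phi> y) powr p * norm (\<zeta> y)) \<in> borel_measurable lborel" by measurable
  show "AE y in lborel. norm (B * norm (\<phi> y) powr p * norm (\<zeta> y)) \<le> norm (B * (norm (\<phi> y) powr q + (norm (\<zeta> y))\<^sup>2))"
  proof (intro AE_I2)
    fix y
    let ?a = "norm (\<phi> y) powr p" and ?b = "norm (\<zeta> y)"
    have "?a * ?b \<le> 2 * ?a * ?b" by (simp add: mult_nonneg_nonneg)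
    also have "\<dots> \<le> ?a\<^sup>2 + ?b\<^sup>2" by (rule sum_squares_bound)
    also have "?a\<^sup>2 = norm (\<phi> y) powr (p + p)" by (simp only: power2_eq_square powr_add)
    also have "p + p = q" by simp
    finally have "B * (?a * ?b) \<le> B * (norm (\<phi> y) powr q + ?b\<^sup>2)" by (intro mult_left_mono B_nonneg)
    then have "\<bar>B * (?a * ?b)\<bar> \<le> \<bar>B * (norm (\<phi> y) powr q + ?b\<^sup>2)\<bar>"
      using B_nonneg by (subst (1 2) abs_of_nonneg) (auto intro!: mult_nonneg_nonneg add_nonneg_nonneg)
    then show "norm (B * ?a * ?b) \<le> norm (B * (norm (\<phi> y) powr q + ?b\<^sup>2))"
      by (simp only: real_norm_def mult.assoc)
  qed
qed

text \<open>Substitute x = 2 s y. By homogeneity the amplitude (2s)^(- d/2) leaves F with the power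
  p and the second wave with the power 1; together with the Jacobian (2s)^d the exponent is d -
  (d/2)(p + 1) = -1. So the degree 1 + 2/d is what produces the scale-invariant density ds /
  (2s).\<close>

lemma inner_wave_eq:
  fixes \<phi> \<zeta> :: "'a::euclidean_space \<Rightarrow> complex"
  assumes dim: "d = DIM('a)" and s: "s > 0"
    and \<phi> [measurable]: "\<phi> \<in> borel_measurable borel" and \<zeta>: "square_integrable \<zeta>"
    and fin: "Lp_mass q \<phi> < \<infinity>"
  shows "L2_of (\<lambda>x. F (wave s \<phi> x)) \<bullet> L2_of (wave s \<zeta>) = Re ((LBINT y. pairing_density \<phi> \<zeta> s y)) / (2 * s)"
proof -
  have d: "d > 0" using dim by simp
  have \<zeta>m [measurable]: "\<zeta> \<in> borel_measurable borel" using \<zeta> by (rule square_integrable_borel)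
  let ?\<rho> = "sqrt (1 / (2 * s)) ^ DIM('a)"
  have \<rho>: "?\<rho> > 0" using s by simp
  have Fw: "square_integrable (\<lambda>x. F (wave s \<phi> x))"
  proof (rule square_integrable_F)
    show "Lp_mass q (wave s \<phi>) < \<infinity>"
      unfolding nn_integral_wave[OF s \<phi>] using fin by (simp add: ennreal_mult_less_top)
  qed simp
  have wave_eq: "wave s g (0 + (2 * s) *\<^sub>R y) = complex_of_real ?\<rho> * (modulation s y * g y)" for g :: "'a \<Rightarrow> complex" and y
  proof -
    have "(norm ((2 * s) *\<^sub>R y))\<^sup>2 / (4 * s) = s * (norm y)\<^sup>2"
      using s by (simp add: power_mult_distrib power2_eq_square)
    then have "chirp s ((2 * s) *\<^sub>R y) = iexp (s * (norm y)\<^sup>2)"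
      by (simp only: chirp_def)
    then show ?thesis using s by (simp add: wave_def modulation_def)
  qed
  have const: "(2 * s) ^ DIM('a) * (?\<rho> powr p * ?\<rho>) = 1 / (2 * s)"
  proof -
    have \<rho>_eq: "?\<rho> = (2 * s) powr (- (real d / 2))"
      using s unfolding dim by (subst sqrt_inverse_powr) (simp_all add: powr_powr flip: powr_realpow)
    have c1: "?\<rho> powr p * ?\<rho> = (2 * s) powr (- (real d / 2) * p + - (real d / 2))"
      unfolding \<rho>_eq by (simp only: powr_powr powr_add[symmetric])
    have c2: "(2 * s) ^ DIM('a) = (2 * s) powr real d" using s unfolding dim by (simp add: powr_realpow)
    have "(2 * s) ^ DIM('a) * (?\<rho> powr p * ?\<rho>) = (2 * s) powr (real d + (- (real d / 2) * p + - (real d / 2)))"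
      unfolding c1 c2 by (simp only: powr_add[symmetric])
    also have "real d + (- (real d / 2) * p + - (real d / 2)) = - 1" using d by (simp add: field_simps)
    also have "(2 * s) powr (- 1) = 1 / (2 * s)" using s by (simp add: powr_minus_divide)
    finally show ?thesis .
  qed
  have pint: "integrable lborel (pairing_density \<phi> \<zeta> s)"
  proof (rule Bochner_Integration.integrable_bound[OF integrable_pairing_bound[OF \<phi> \<zeta> fin]])
    show "pairing_density \<phi> \<zeta> s \<in> borel_measurable lborel"
      using measurable_compose[OF measurable_Pair1' pairing_density_measurable[OF \<phi> \<zeta>m], of s] by simp
    show "AE y in lborel. norm (pairing_density \<phi> \<zeta> s y) \<le> norm (B * norm (\<phi> y) powr p * norm (\<zeta> y))"
      by (intro AE_I2 order_trans[OF norm_pairing_density_le]) simp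
  qed
  have "L2_of (\<lambda>x. F (wave s \<phi> x)) \<bullet> L2_of (wave s \<zeta>) = (LBINT x. F (wave s \<phi> x) \<bullet> wave s \<zeta> x)"
    by (intro inner_L2_of Fw square_integrable_wave s \<zeta>)
  also have "\<dots> = \<bar>2 * s\<bar> ^ DIM('a) *\<^sub>R (LBINT y. F (wave s \<phi> (0 + (2 * s) *\<^sub>R y)) \<bullet> wave s \<zeta> (0 + (2 * s) *\<^sub>R y))"
    using s by (intro lborel_integral_affine) auto
  also have "(LBINT y. F (wave s \<phi> (0 + (2 * s) *\<^sub>R y)) \<bullet> wave s \<zeta> (0 + (2 * s) *\<^sub>R y))
     = (LBINT y. (?\<rho> powr p * ?\<rho>) * Re (pairing_density \<phi> \<zeta> s y))"
  proof (intro Bochner_Integration.integral_cong refl)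
    fix y
    have "F (wave s \<phi> (0 + (2 * s) *\<^sub>R y)) \<bullet> wave s \<zeta> (0 + (2 * s) *\<^sub>R y)
      = Re (complex_of_real (?\<rho> powr p) * F (modulation s y * \<phi> y) * cnj (complex_of_real ?\<rho> * (modulation s y * \<zeta> y)))"
      unfolding wave_eq F_scale[OF \<rho>] cnj_inner_eq ..
    also have "complex_of_real (?\<rho> powr p) * F (modulation s y * \<phi> y) * cnj (complex_of_real ?\<rho> * (modulation s y * \<zeta> y))
      = complex_of_real (?\<rho> powr p * ?\<rho>) * pairing_density \<phi> \<zeta> s y"
      unfolding pairing_density_def by (simp only: complex_cnj_mult complex_cnj_complex_of_real of_real_mult mult_ac)
    also have "Re \<dots> = (?\<rho> powr p * ?\<rho>) * Re (pairing_density \<phi> \<zeta> s y)"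
      by (simp only: times_complex.sel Re_complex_of_real Im_complex_of_real)
    finally show "F (wave s \<phi> (0 + (2 * s) *\<^sub>R y)) \<bullet> wave s \<zeta> (0 + (2 * s) *\<^sub>R y)
      = (?\<rho> powr p * ?\<rho>) * Re (pairing_density \<phi> \<zeta> s y)" .
  qed
  also have "\<dots> = (?\<rho> powr p * ?\<rho>) * Re (LBINT y. pairing_density \<phi> \<zeta> s y)"
    using pint by (simp only: integral_mult_right_zero integral_Re)
  finally have "L2_of (\<lambda>x. F (wave s \<phi> x)) \<bullet> L2_of (wave s \<zeta>)
      = ((2 * s) ^ DIM('a) * (?\<rho> powr p * ?\<rho>)) * Re (LBINT y. pairing_density \<phi> \<zeta> s y)"
    using s by (simp only: real_scaleR_def mult.assoc)
  then show ?thesis unfolding const by simp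
qed

text \<open>Fubini puts the average over s inside the integral over y. There
  \<open>resonance\<close> applies at each y with r = |y|^2, and the majorant of the pairing
  density, which depends on y alone, permits dominated convergence.\<close>

lemma integral_inner_wave_tendsto:
  fixes \<phi> \<zeta> :: "'a::euclidean_space \<Rightarrow> complex"
  assumes dim: "d = DIM('a)"
    and \<phi> [measurable]: "\<phi> \<in> borel_measurable borel" and \<zeta>: "square_integrable \<zeta>"
    and fin: "Lp_mass q \<phi> < \<infinity>"
  defines "b \<equiv> \<lambda>s. L2_of (\<lambda>x. F (wave s \<phi> x)) \<bullet> L2_of (wave s \<zeta>)"
  shows "t > 0 \<Longrightarrow> integrable lborel (\<lambda>s. indicator {t<..<2 * t} s * b s)"
    and "((\<lambda>t. \<integral>s. indicator {t<..<2 * t} s * b s \<partial>lborel) \<longlongrightarrow>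
       ln 2 / 2 * Re (LBINT y. nonlin_coeff F 1 * nonlin_mode d 1 (\<phi> y) * cnj (\<zeta> y))) at_top"
proof -
  have \<zeta>m [measurable]: "\<zeta> \<in> borel_measurable borel" using \<zeta> by (rule square_integrable_borel)
  note [measurable] = pairing_density_measurable[OF \<phi> \<zeta>m]
  let ?P = "pairing_density \<phi> \<zeta>"
  let ?h = "\<lambda>y. B * norm (\<phi> y) powr p * norm (\<zeta> y)"
  have h: "integrable lborel ?h" by (rule integrable_pairing_bound[OF \<phi> \<zeta> fin])
  have h0: "?h y \<ge> 0" for y using B_nonneg by simp
  have pair: "integrable (lborel \<Otimes>\<^sub>M lborel) (\<lambda>(s, y). complex_of_real (log_weight t s) * ?P s y)" if t: "t > 0" for t
  proof (rule Bochner_Integration.integrable_bound)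
    show "integrable (lborel \<Otimes>\<^sub>M lborel) (\<lambda>(s, y). complex_of_real (log_weight t s) * complex_of_real (?h y) * 1)"
      using integrable_log_weight[OF t] h by (intro integrable_pair_mult_bounded integrable_of_real) auto
    show "(\<lambda>(s, y). complex_of_real (log_weight t s) * ?P s y) \<in> borel_measurable (lborel \<Otimes>\<^sub>M lborel)"
      by measurable
    show "AE z in lborel \<Otimes>\<^sub>M lborel. norm (case z of (s, y) \<Rightarrow> complex_of_real (log_weight t s) * ?P s y)
       \<le> norm (case z of (s, y) \<Rightarrow> complex_of_real (log_weight t s) * complex_of_real (?h y) * 1)"
    proof (intro AE_I2, clarify)
      fix s y
      have "norm (?P s y) \<le> norm (complex_of_real (?h y))"
        using norm_pairing_density_le[of \<phi> \<zeta> s y] h0[of y] by (simp only: norm_of_real abs_of_nonneg)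
      then show "norm (complex_of_real (log_weight t s) * ?P s y) \<le> norm (complex_of_real (log_weight t s) * complex_of_real (?h y) * 1)"
        unfolding norm_mult norm_one mult_1_right by (rule mult_left_mono) simp
    qed
  qed
  have ib: "indicator {t<..<2 * t} s * b s = Re (LBINT y. complex_of_real (log_weight t s) * ?P s y)" if t: "t > 0" for t s
  proof (cases "s \<in> {t<..<2 * t}")
    case True
    then have s: "s > 0" using t by simp
    have "Re (LBINT y. complex_of_real (log_weight t s) * ?P s y) = log_weight t s * Re (LBINT y. ?P s y)"
      by simp
    then show ?thesis using True unfolding b_def inner_wave_eq[OF dim s \<phi> \<zeta> fin] by (simp add: log_weight_def)
  next
    case False
    then have "log_weight t s = 0" by (simp add: log_weight_def)
    then show ?thesis using False by simp
  qed
  show "integrable lborel (\<lambda>s. indicator {t<..<2 * t} s * b s)" if t: "t > 0"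
    unfolding ib[OF t] using lborel_pair.integrable_fst[OF pair[OF t]] by (intro integrable_Re) simp
  let ?K = "\<lambda>t y. \<integral>s. complex_of_real (log_weight t s) * ?P s y \<partial>lborel"
  have K_eq: "?K t y = (LBINT s. complex_of_real (log_weight t s) * (F (modulation s y * \<phi> y) * cnj (modulation s y))) * cnj (\<zeta> y)" for t y
    unfolding pairing_density_def by (simp only: mult.assoc[symmetric] integral_mult_left_zero)
  \<comment> \<open>At y = 0 the phase does not depend on s and no mode averages out; this single
    point is a null set.\<close>
  have K_lim: "((\<lambda>t. ?K t y) \<longlongrightarrow> complex_of_real (ln 2 / 2) * (nonlin_coeff F 1 * nonlin_mode d 1 (\<phi> y)) * cnj (\<zeta> y)) at_top"
    if y: "y \<noteq> 0" for y
    unfolding K_eq modulation_def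
    by (intro tendsto_mult tendsto_const resonance) (use y in \<open>auto simp: norm_power\<close>)
  have K_bound: "norm (?K t y) \<le> ?h y" if t: "t > 0" for t y
  proof -
    have m: "(\<lambda>s. ?P s y) \<in> borel_measurable borel" by measurable
    have "norm (?K t y) \<le> ?h y * (ln 2 / 2)"
      by (rule integrable_log_weight_mult(2)[OF t m norm_pairing_density_le])
    also have "\<dots> \<le> ?h y" using h0[of y] ln_2_less_1 by (intro mult_left_le) auto
    finally show ?thesis .
  qed
  have "((\<lambda>t. \<integral>y. ?K t y \<partial>lborel) \<longlongrightarrow> (LBINT y. complex_of_real (ln 2 / 2) * (nonlin_coeff F 1 * nonlin_mode d 1 (\<phi> y)) * cnj (\<zeta> y))) at_top"
  proof (rule integral_dominated_convergence_at_top[OF _ _ h])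
    have [measurable]: "nonlin_mode d 1 \<in> borel_measurable borel"
      by (intro borel_measurable_continuous_onI continuous_nonlin_mode)
    show "(\<lambda>y. complex_of_real (ln 2 / 2) * (nonlin_coeff F 1 * nonlin_mode d 1 (\<phi> y)) * cnj (\<zeta> y)) \<in> borel_measurable lborel"
      by measurable
    show "(\<lambda>y. ?K t y) \<in> borel_measurable lborel" for t by measurable
    have "AE y in lborel. y \<noteq> (0::'a)" by (rule AE_lborel_singleton)
    then show "AE y in lborel. ((\<lambda>t. ?K t y) \<longlongrightarrow> complex_of_real (ln 2 / 2) * (nonlin_coeff F 1 * nonlin_mode d 1 (\<phi> y)) * cnj (\<zeta> y)) at_top"
      by eventually_elim (rule K_lim)
    show "\<forall>\<^sub>F t in at_top. AE y in lborel. norm (?K t y) \<le> ?h y"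
      using eventually_gt_at_top[of 0] by eventually_elim (use K_bound in auto)
  qed
  then have "((\<lambda>t. Re (LBINT y. ?K t y)) \<longlongrightarrow> Re (LBINT y. complex_of_real (ln 2 / 2) * (nonlin_coeff F 1 * nonlin_mode d 1 (\<phi> y)) * cnj (\<zeta> y))) at_top"
    by (rule tendsto_Re)
  also have "(LBINT y. complex_of_real (ln 2 / 2) * (nonlin_coeff F 1 * nonlin_mode d 1 (\<phi> y)) * cnj (\<zeta> y))
     = complex_of_real (ln 2 / 2) * (LBINT y. nonlin_coeff F 1 * nonlin_mode d 1 (\<phi> y) * cnj (\<zeta> y))"
    by (simp only: mult.assoc integral_mult_right_zero)
  also have "Re \<dots> = ln 2 / 2 * Re (LBINT y. nonlin_coeff F 1 * nonlin_mode d 1 (\<phi> y) * cnj (\<zeta> y))"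
    by (simp only: times_complex.sel Re_complex_of_real Im_complex_of_real)
  finally have lim: "((\<lambda>t. Re (LBINT y. ?K t y)) \<longlongrightarrow> ln 2 / 2 * Re (LBINT y. nonlin_coeff F 1 * nonlin_mode d 1 (\<phi> y) * cnj (\<zeta> y))) at_top" .
  have eq: "Re (LBINT y. ?K t y) = (LBINT s. indicator {t<..<2 * t} s * b s)" if t: "t > 0" for t
  proof -
    have "(LBINT s. indicator {t<..<2 * t} s * b s) = Re (LBINT s. (LBINT y. complex_of_real (log_weight t s) * ?P s y))"
      unfolding ib[OF t] using lborel_pair.integrable_fst[OF pair[OF t]] by (intro integral_Re) simp
    also have "(LBINT s. (LBINT y. complex_of_real (log_weight t s) * ?P s y)) = (LBINT y. ?K t y)"
      using lborel_pair.Fubini_integral[OF pair[OF t]] by simp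
    finally show ?thesis by simp
  qed
  show "((\<lambda>t. \<integral>s. indicator {t<..<2 * t} s * b s \<partial>lborel) \<longlongrightarrow>
       ln 2 / 2 * Re (LBINT y. nonlin_coeff F 1 * nonlin_mode d 1 (\<phi> y) * cnj (\<zeta> y))) at_top"
    by (rule Lim_transform_eventually[OF lim]) (use eventually_gt_at_top[of 0] in \<open>eventually_elim, use eq in auto\<close>)
qed

end

text \<open>Unitarity rewrites the integrand at time s as the pairing of U(2t - s) F(u(s)) with the
  vector U(2t) \<eta>, which does not depend on s and so comes out of the Bochner integral. What
  remains is the Duhamel term on [t, 2t], whose norm is at most the sum of the scattering errors at
  t and at 2t.\<close>

lemma asymptotic_pairing_tendsto_zero:
  fixes u :: "real \<Rightarrow> 'a::euclidean_space L2" and u_plus \<eta> :: "'a L2"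
  assumes sol: "NLS_solution F {T..} u"
    and lim: "((\<lambda>t. norm (u t - schroedinger_group t u_plus)) \<longlongrightarrow> 0) at_top"
  defines "a \<equiv> \<lambda>s. L2_of (\<lambda>x. F (rep_L2 (u s) x)) \<bullet> schroedinger_group s \<eta>"
  shows "\<forall>\<^sub>F t in at_top. integrable lborel (\<lambda>s. indicator {t<..<2 * t} s * a s)"
    and "((\<lambda>t. \<integral>s. indicator {t<..<2 * t} s * a s \<partial>lborel) \<longlongrightarrow> 0) at_top"
proof -
  let ?G = "\<lambda>s. L2_of (\<lambda>x. F (rep_L2 (u s) x))"
  let ?I = "\<lambda>t s. indicator {t<..<2 * t} s *\<^sub>R schroedinger_group (2 * t - s) (?G s)"
  have a_eq: "indicator {t<..<2 * t} s * a s = ?I t s \<bullet> schroedinger_group (2 * t) \<eta>" for t s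
  proof -
    have "schroedinger_group (2 * t) \<eta> = schroedinger_group (2 * t - s) (schroedinger_group s \<eta>)"
      by (simp add: schroedinger_group_schroedinger_group)
    then show ?thesis by (simp add: a_def inner_schroedinger_group)
  qed
  have sol': "integrable lborel (?I t) \<and>
      norm (LBINT s. ?I t s) \<le> norm (u t - schroedinger_group t u_plus) + norm (u (2 * t) - schroedinger_group (2 * t) u_plus)"
    if t: "t > 0" "t \<ge> T" for t
  proof -
    have le: "ereal t \<le> ereal (2 * t)" using t by simp
    have "t \<in> {T..}" "2 * t \<in> {T..}" using t by auto
    with sol have int: "interval_lebesgue_integrable lborel (ereal t) (ereal (2 * t)) (\<lambda>s. schroedinger_group (2 * t - s) (?G s))"
      and D: "u (2 * t) = schroedinger_group (2 * t - t) (u t) - \<i> *\<^sub>C (LBINT s=ereal t..ereal (2 * t). schroedinger_group (2 * t - s) (?G s))"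
      unfolding NLS_solution_def by blast+
    have i: "integrable lborel (?I t)"
      using int le by (simp add: interval_lebesgue_integrable_def set_integrable_def)
    have eq: "(LBINT s=ereal t..ereal (2 * t). schroedinger_group (2 * t - s) (?G s)) = (LBINT s. ?I t s)"
      using interval_lebesgue_integral_le_eq[OF le] by (simp add: set_lebesgue_integral_def)
    have "norm (LBINT s. ?I t s) = norm (\<i> *\<^sub>C (LBINT s. ?I t s))" by (simp add: norm_scaleC_L2)
    also have "\<i> *\<^sub>C (LBINT s. ?I t s) = schroedinger_group t (u t) - u (2 * t)"
      using D unfolding eq by simp
    \<comment> \<open>U(2t) u_plus = U(t) U(t) u_plus is subtracted and added.\<close>
    also have "\<dots> = schroedinger_group t (u t - schroedinger_group t u_plus) - (u (2 * t) - schroedinger_group (2 * t) u_plus)"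
      by (simp add: linear_diff[OF bounded_linear.linear[OF bounded_linear_schroedinger_group]] schroedinger_group_schroedinger_group)
    also have "norm \<dots> \<le> norm (u t - schroedinger_group t u_plus) + norm (u (2 * t) - schroedinger_group (2 * t) u_plus)"
      using norm_triangle_ineq4[of "schroedinger_group t (u t - schroedinger_group t u_plus)"] by simp
    finally show ?thesis using i by blast
  qed
  have ev: "\<forall>\<^sub>F t in at_top. t > 0 \<and> t \<ge> T"
    using eventually_gt_at_top[of 0] eventually_ge_at_top[of T] by eventually_elim simp
  show "\<forall>\<^sub>F t in at_top. integrable lborel (\<lambda>s. indicator {t<..<2 * t} s * a s)"
    using ev
  proof eventually_elim
    fix t assume "t > 0 \<and> t \<ge> T"
    then show "integrable lborel (\<lambda>s. indicator {t<..<2 * t} s * a s)"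
      unfolding a_eq using sol' by (intro integrable_inner_left) simp
  qed
  have "((\<lambda>t. (norm (u t - schroedinger_group t u_plus) + norm (u (2 * t) - schroedinger_group (2 * t) u_plus)) * norm \<eta>) \<longlongrightarrow> (0 + 0) * norm \<eta>) at_top"
    by (intro tendsto_intros lim filterlim_compose[OF lim]) real_asymp
  then have "((\<lambda>t. (norm (u t - schroedinger_group t u_plus) + norm (u (2 * t) - schroedinger_group (2 * t) u_plus)) * norm \<eta>) \<longlongrightarrow> 0) at_top"
    by simp
  then show "((\<lambda>t. \<integral>s. indicator {t<..<2 * t} s * a s \<partial>lborel) \<longlongrightarrow> 0) at_top"
  proof (rule Lim_null_comparison[rotated])
    show "\<forall>\<^sub>F t in at_top. norm (LBINT s. indicator {t<..<2 * t} s * a s)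
       \<le> (norm (u t - schroedinger_group t u_plus) + norm (u (2 * t) - schroedinger_group (2 * t) u_plus)) * norm \<eta>"
      using ev
    proof eventually_elim
      fix t assume t: "t > 0 \<and> t \<ge> T"
      have "(LBINT s. indicator {t<..<2 * t} s * a s) = (LBINT s. ?I t s) \<bullet> schroedinger_group (2 * t) \<eta>"
        unfolding a_eq using sol' t by (intro integral_inner_left) simp
      then have "norm (LBINT s. indicator {t<..<2 * t} s * a s) \<le> norm (LBINT s. ?I t s) * norm \<eta>"
        using Cauchy_Schwarz_ineq2[of "\<integral>s. ?I t s \<partial>lborel" "schroedinger_group (2 * t) \<eta>"] by simp
      also have "\<dots> \<le> (norm (u t - schroedinger_group t u_plus) + norm (u (2 * t) - schroedinger_group (2 * t) u_plus)) * norm \<eta>"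
        using sol' t by (intro mult_right_mono) auto
      finally show "norm (LBINT s. indicator {t<..<2 * t} s * a s)
       \<le> (norm (u t - schroedinger_group t u_plus) + norm (u (2 * t) - schroedinger_group (2 * t) u_plus)) * norm \<eta>" .
    qed
  qed
qed

text \<open>The Sobolev inequality takes the homogeneous weight, which the inhomogeneous one
  dominates for s >= 0.\<close>

lemma weighted_L2_imp_integrable:
  fixes f :: "'a::euclidean_space L2"
  assumes f: "f \<in> weighted_L2 s" and s: "s \<ge> 0"
  shows "integrable lborel (\<lambda>x. norm x powr (2 * s) * (norm (rep_L2 f x))\<^sup>2)"
proof (rule Bochner_Integration.integrable_bound)
  show "integrable lborel (\<lambda>x. (norm (complex_of_real (sqrt (1 + (norm x)\<^sup>2) powr s) * rep_L2 f x))\<^sup>2)"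
    using f by (simp add: weighted_L2_def square_integrable_def)
  show "AE x in lborel. norm (norm x powr (2 * s) * (norm (rep_L2 f x))\<^sup>2)
      \<le> norm ((norm (complex_of_real (sqrt (1 + (norm x)\<^sup>2) powr s) * rep_L2 f x))\<^sup>2)"
  proof (intro AE_I2)
    fix x :: 'a
    have "norm x \<le> sqrt (1 + (norm x)\<^sup>2)" by (rule real_le_rsqrt) simp
    then have "norm x powr s \<le> sqrt (1 + (norm x)\<^sup>2) powr s" using s by (intro powr_mono2) auto
    then have "(norm x powr s)\<^sup>2 \<le> (sqrt (1 + (norm x)\<^sup>2) powr s)\<^sup>2" by (intro power_mono) auto
    also have "(norm x powr s)\<^sup>2 = norm x powr (2 * s)" by (simp add: power2_eq_square flip: powr_add)
    finally have "norm x powr (2 * s) * (norm (rep_L2 f x))\<^sup>2 \<le> (sqrt (1 + (norm x)\<^sup>2) powr s)\<^sup>2 * (norm (rep_L2 f x))\<^sup>2"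
      by (rule mult_right_mono) simp
    then show "norm (norm x powr (2 * s) * (norm (rep_L2 f x))\<^sup>2)
      \<le> norm ((norm (complex_of_real (sqrt (1 + (norm x)\<^sup>2) powr s) * rep_L2 f x))\<^sup>2)"
      by (simp add: norm_mult power_mult_distrib)
  qed
qed simp

text \<open>No measurability of \<open>N\<close> is assumed: only the measurable minorant \<open>g - \<epsilon> / (2 t)\<close> is integrated.\<close>

lemma integral_dyadic_le:
  fixes g :: "real \<Rightarrow> real" and N :: "real \<Rightarrow> ennreal"
  assumes t: "t > 0" and e: "e > 0" and C: "C > 0" and c: "c \<ge> 0"
    and g: "integrable lborel (\<lambda>s. indicator {t<..<2 * t} s * g s)"
    and bound: "\<And>s. s > t \<Longrightarrow> ennreal (2 * s * \<bar>g s\<bar>) \<le> ennreal e + ennreal (C * (2 * s)\<^sup>2) * N s"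
    and mass: "ennreal t * (\<integral>\<^sup>+s. N s * indicator {t..} s \<partial>lborel) \<le> ennreal c"
  shows "\<bar>\<integral>s. indicator {t<..<2 * t} s * g s \<partial>lborel\<bar> \<le> e + 4 * C * c"
proof -
  let ?J = "{t<..<2 * t}"
  define k where "k s = max 0 (\<bar>indicator ?J s * g s\<bar> - e / (2 * t) * indicator ?J s)" for s
  have gm [measurable]: "(\<lambda>s. indicator ?J s * g s) \<in> borel_measurable borel" using g by simp
  have km [measurable]: "k \<in> borel_measurable borel"
    unfolding k_def[abs_def] by measurable
  have k_le: "ennreal (k s / (4 * C * t)) \<le> N s * indicator {t..} s" for s
  proof (cases "s \<in> ?J")
    case True
    then have s: "s > t" "s < 2 * t" "s > 0" using t by auto
    show ?thesis
    proof (cases "N s")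
      case top
      then show ?thesis using s by simp
    next
      case (real n)
      have "ennreal (2 * s * \<bar>g s\<bar>) \<le> ennreal (e + C * (2 * s)\<^sup>2 * n)"
        using bound[OF s(1)] real e C s by (simp add: ennreal_mult[symmetric] ennreal_plus[symmetric] del: ennreal_plus)
      then have "2 * s * \<bar>g s\<bar> \<le> e + C * (2 * s)\<^sup>2 * n"
        using e C real by (subst (asm) ennreal_le_iff) auto
      then have "\<bar>g s\<bar> \<le> (e + C * (2 * s)\<^sup>2 * n) / (2 * s)"
        using s by (simp add: pos_le_divide_eq mult.commute)
      also have "\<dots> = e / (2 * s) + 2 * s * (C * n)"
        using s by (simp add: field_simps power2_eq_square)
      \<comment> \<open>Since t < s < 2t, each s is replaced by the less favourable
        endpoint.\<close>
      also have "\<dots> \<le> e / (2 * t) + 2 * (2 * t) * (C * n)"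
        using s t e C real by (intro add_mono divide_left_mono mult_right_mono) auto
      finally have "k s \<le> 4 * C * t * n" using True C t real by (simp add: k_def mult_ac)
      then have "k s / (4 * C * t) \<le> n" using C t by (simp add: pos_divide_le_eq mult_ac)
      then show ?thesis using real s by (simp add: ennreal_leI)
    qed
  next
    case False
    then show ?thesis by (simp add: k_def)
  qed
  have "(\<integral>\<^sup>+s. ennreal (k s) \<partial>lborel) = (\<integral>\<^sup>+s. ennreal (4 * C * t) * ennreal (k s / (4 * C * t)) \<partial>lborel)"
    using C t by (intro nn_integral_cong) (simp flip: ennreal_mult')
  also have "\<dots> = ennreal (4 * C * t) * (\<integral>\<^sup>+s. ennreal (k s / (4 * C * t)) \<partial>lborel)"
    by (rule nn_integral_cmult) simp
  also have "\<dots> \<le> ennreal (4 * C * t) * (\<integral>\<^sup>+s. N s * indicator {t..} s \<partial>lborel)"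
    by (intro mult_left_mono nn_integral_mono k_le) simp
  also have "\<dots> = ennreal (4 * C) * (ennreal t * (\<integral>\<^sup>+s. N s * indicator {t..} s \<partial>lborel))"
    using C t by (simp add: ennreal_mult mult.assoc)
  also have "\<dots> \<le> ennreal (4 * C) * ennreal c" by (intro mult_left_mono mass) simp
  also have "\<dots> = ennreal (4 * C * c)" using C c by (simp flip: ennreal_mult)
  finally have k_int: "(\<integral>\<^sup>+s. ennreal (k s) \<partial>lborel) \<le> ennreal (4 * C * c)" .
  have "ennreal \<bar>\<integral>s. indicator ?J s * g s \<partial>lborel\<bar> \<le> (\<integral>\<^sup>+s. ennreal (norm (indicator ?J s * g s)) \<partial>lborel)"
    using norm_integral_le_nn_integral[of lborel "\<lambda>s. indicator ?J s * g s"] by simp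
  also have "\<dots> \<le> (\<integral>\<^sup>+s. ennreal (k s) + ennreal (e / (2 * t)) * indicator ?J s \<partial>lborel)"
  proof (rule nn_integral_mono)
    fix s :: real
    have "norm (indicator ?J s * g s) \<le> k s + e / (2 * t) * indicator ?J s" by (simp add: k_def)
    then have "ennreal (norm (indicator ?J s * g s)) \<le> ennreal (k s + e / (2 * t) * indicator ?J s)" by (rule ennreal_leI)
    also have "\<dots> = ennreal (k s) + ennreal (e / (2 * t)) * indicator ?J s"
      using e t by (subst ennreal_plus) (auto simp: k_def indicator_def)
    finally show "ennreal (norm (indicator ?J s * g s)) \<le> ennreal (k s) + ennreal (e / (2 * t)) * indicator ?J s" .
  qed
  \<comment> \<open>The interval has length t, so the part cut off from |g| contributes e /
    2.\<close>
  also have "\<dots> = (\<integral>\<^sup>+s. ennreal (k s) \<partial>lborel) + ennreal (e / (2 * t)) * ennreal t"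
    using t by (simp add: nn_integral_add nn_integral_cmult)
  also have "\<dots> \<le> ennreal (4 * C * c) + ennreal (e / (2 * t)) * ennreal t"
    by (intro add_right_mono k_int)
  also have "\<dots> = ennreal (4 * C * c + e / 2)"
    using t e C c by (simp add: ennreal_mult[symmetric] ennreal_plus[symmetric] del: ennreal_plus)
  finally have "\<bar>\<integral>s. indicator ?J s * g s \<partial>lborel\<bar> \<le> 4 * C * c + e / 2"
    using e C c by (subst (asm) ennreal_le_iff) auto
  then show ?thesis using e by simp
qed

section \<open>Identification of the resonant limit and vanishing of the profile\<close>

theorem theorem1p7:
  fixes F :: "complex \<Rightarrow> complex"
    and T :: real
    and u :: "real \<Rightarrow> 'a::euclidean_space L2"
    and u_plus :: "'a L2"
  assumes homogeneous: "homogeneous_of_degree (1 + 2 / real DIM('a)) F"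
    and decomposition:
      "\<And>z. ((\<lambda>n::int. nonlin_coeff F n * nonlin_mode DIM('a) n z) has_sum F z) UNIV"
    and l1: "(\<lambda>n::int. norm (nonlin_coeff F n)) summable_on UNIV"
    and g0: "nonlin_coeff F 0 = 0"
    and g1: "nonlin_coeff F 1 \<noteq> 0"
    and sol: "NLS_solution F {T..} u"
    and u_plus: "u_plus \<in> weighted_L2 (real DIM('a) / (real DIM('a) + 2))"
    and lim_L2: "((\<lambda>t. norm (u t - schroedinger_group t u_plus)) \<longlongrightarrow> 0) at_top"
    and lim_Lq:
      "((\<lambda>t. ennreal (t powr (real DIM('a) / (2 * (real DIM('a) + 2)))) *
           mixed_norm (2 * (real DIM('a) + 2) / real DIM('a)) (2 * (real DIM('a) + 2) / real DIM('a)) {t..}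
             (\<lambda>s. u s - schroedinger_group s u_plus)) \<longlongrightarrow> 0) at_top"
  shows "u_plus = 0"
proof -
  interpret fourier_nonlinearity "DIM('a)" F
    using homogeneous decomposition l1 by unfold_locales
  let ?d = "real DIM('a)"
  have d: "?d > 0" by simp
  have q_eq: "2 * (?d + 2) / ?d = q" by (simp add: field_simps)
  have q_inv: "?d / (2 * (?d + 2)) = 1 / q" unfolding q_eq[symmetric] by simp
  have q_pos: "q > 0" by (intro mult_pos_pos add_pos_nonneg) auto
  have q2: "q > 2" by simp
  \<comment> \<open>The squared weight |x|^(2d/(d+2)) of the hypothesis is the weight of the Sobolev
    inequality at q = 2(d+2)/d.\<close>
  have w_eq: "2 * (?d / (?d + 2)) = ?d - 2 * (?d / q)"
    unfolding q_eq[symmetric] using d by (simp add: field_simps)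
  have w: "integrable lborel (\<lambda>x. norm x powr (?d - 2 * (?d / q)) * (norm (rep_L2 u_plus x))\<^sup>2)"
    using weighted_L2_imp_integrable[OF u_plus] unfolding w_eq by simp
  define \<phi> where "\<phi> = rep_L2 (fourier_op (- 1) u_plus)"
  have \<phi> [measurable]: "\<phi> \<in> borel_measurable borel" unfolding \<phi>_def by simp
  have fin: "Lp_mass q \<phi> < \<infinity>"
    using Lq_mass_fourier(1)[OF q2 w] unfolding Lq_mass_def \<phi>_def .
  \<comment> \<open>The total L^q mass of the error after time t; its q-th root is the mixed norm in
    \<open>lim_Lq\<close>.\<close>
  define M where "M t = (\<integral>\<^sup>+s. Lq_mass q (u s - schroedinger_group s u_plus) * indicator {t..} s \<partial>lborel)" for t
  have M_small: "\<forall>\<^sub>F t in at_top. ennreal t * M t \<le> ennreal c" if "c > 0" for c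
  proof (rule eventually_mass_le[OF q_pos that])
    show "((\<lambda>t. ennreal (t powr (1 / q)) * ennreal_powr (M t) (1 / q)) \<longlongrightarrow> 0) at_top"
      using lim_Lq unfolding q_inv unfolding q_eq mixed_norm_diagonal[OF q_pos borel_closed[OF closed_atLeast]] M_def .
  qed
  have zero: "Re (LBINT y. nonlin_coeff F 1 * nonlin_mode DIM('a) 1 (\<phi> y) * cnj (rep_L2 (fourier_op (- 1) \<eta>) y)) = 0"
    for \<eta> :: "'a L2"
  proof -
    let ?\<zeta> = "rep_L2 (fourier_op (- 1) \<eta>)"
    define a where "a s = L2_of (\<lambda>x. F (rep_L2 (u s) x)) \<bullet> schroedinger_group s \<eta>" for s
    define b where "b s = L2_of (\<lambda>x. F (wave s \<phi> x)) \<bullet> L2_of (wave s ?\<zeta>)" for s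
    let ?L = "ln 2 / 2 * Re (LBINT y. nonlin_coeff F 1 * nonlin_mode DIM('a) 1 (\<phi> y) * cnj (?\<zeta> y))"
    note a_int = asymptotic_pairing_tendsto_zero[OF sol lim_L2, of \<eta>, folded a_def]
    note b_int = integral_inner_wave_tendsto[OF refl \<phi> square_integrable_rep[of "fourier_op (- 1) \<eta>"] fin, folded b_def]
    have diff: "((\<lambda>t. (LBINT s. indicator {t<..<2 * t} s * a s) - (LBINT s. indicator {t<..<2 * t} s * b s)) \<longlongrightarrow> 0) at_top"
    proof (rule tendstoI)
      fix e :: real assume e: "e > 0"
      then have "e / 4 > 0" by simp
      from comparison[OF refl w this, of \<eta>] obtain C where C: "C > 0"
        and ev: "\<forall>\<^sub>F s in at_top. \<forall>v :: 'a L2.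
           ennreal (2 * s * \<bar>L2_of (\<lambda>x. F (rep_L2 v x)) \<bullet> schroedinger_group s \<eta> - b s\<bar>)
           \<le> ennreal (e / 4) + ennreal (C * (2 * s)\<^sup>2) * Lq_mass q (v - schroedinger_group s u_plus)"
        unfolding b_def \<phi>_def .
      from ev obtain s0 where s0: "\<And>s v. s \<ge> s0 \<Longrightarrow>
           ennreal (2 * s * \<bar>L2_of (\<lambda>x. F (rep_L2 (v :: 'a L2) x)) \<bullet> schroedinger_group s \<eta> - b s\<bar>)
           \<le> ennreal (e / 4) + ennreal (C * (2 * s)\<^sup>2) * Lq_mass q (v - schroedinger_group s u_plus)"
        unfolding eventually_at_top_linorder by blast
      \<comment> \<open>Makes 4 C c = e / 4, which together with the e / 4 from
        \<open>comparison\<close> leaves e / 2.\<close>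
      define c where "c = e / (16 * C)"
      have c: "c > 0" using e C by (simp add: c_def)
      show "\<forall>\<^sub>F t in at_top. dist ((LBINT s. indicator {t<..<2 * t} s * a s) - (LBINT s. indicator {t<..<2 * t} s * b s)) 0 < e"
        using M_small[OF c] a_int(1) eventually_ge_at_top[of s0] eventually_gt_at_top[of 0]
      proof eventually_elim
        fix t :: real
        assume M: "ennreal t * M t \<le> ennreal c" and ai: "integrable lborel (\<lambda>s. indicator {t<..<2 * t} s * a s)"
          and t: "t \<ge> s0" "t > 0"
        note bi = b_int(1)[OF t(2)]
        have "(LBINT s. indicator {t<..<2 * t} s * a s) - (LBINT s. indicator {t<..<2 * t} s * b s)
            = (LBINT s. indicator {t<..<2 * t} s * (a s - b s))"
          using ai bi by (simp add: right_diff_distrib)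
        moreover have "\<bar>\<integral>s. indicator {t<..<2 * t} s * (a s - b s) \<partial>lborel\<bar> \<le> e / 4 + 4 * C * c"
        proof (rule integral_dyadic_le[OF t(2) \<open>e / 4 > 0\<close> C less_imp_le[OF c]])
          show "integrable lborel (\<lambda>s. indicator {t<..<2 * t} s * (a s - b s))"
            using ai bi by (simp add: right_diff_distrib)
          show "ennreal (2 * s * \<bar>a s - b s\<bar>)
             \<le> ennreal (e / 4) + ennreal (C * (2 * s)\<^sup>2) * Lq_mass q (u s - schroedinger_group s u_plus)" if "s > t" for s
            unfolding a_def using that t by (intro s0) simp
          show "ennreal t * (\<integral>\<^sup>+s. Lq_mass q (u s - schroedinger_group s u_plus) * indicator {t..} s \<partial>lborel) \<le> ennreal c"
            using M unfolding M_def .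
        qed
        moreover have "e / 4 + 4 * C * c < e" using e C by (simp add: c_def)
        ultimately show "dist ((LBINT s. indicator {t<..<2 * t} s * a s) - (LBINT s. indicator {t<..<2 * t} s * b s)) 0 < e"
          by (simp only: dist_real_def diff_0_right)
      qed
    qed
    \<comment> \<open>The pairing of the solution tends to 0 and that of the profile to
      \<open>?L\<close>, while their difference tends to 0; uniqueness of limits gives
      \<open>?L\<close> = 0.\<close>
    have "((\<lambda>t. (LBINT s. indicator {t<..<2 * t} s * a s) - (LBINT s. indicator {t<..<2 * t} s * b s)) \<longlongrightarrow> 0 - ?L) at_top"
      by (intro tendsto_diff a_int(2) b_int(2))
    then have "0 - ?L = 0" using diff by (rule tendsto_unique[OF trivial_limit_at_top_linorder])
    then show ?thesis by simp
  qed
  \<comment> \<open>The resonant term. Its square is a multiple of |\<phi>|^q, so it lies in L2 and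
    can itself be the transform of a test vector.\<close>
  define k where "k y = nonlin_coeff F 1 * nonlin_mode DIM('a) 1 (\<phi> y)" for y
  have [measurable]: "nonlin_mode DIM('a) 1 \<in> borel_measurable borel"
    by (intro borel_measurable_continuous_onI continuous_nonlin_mode)
  have [measurable]: "k \<in> borel_measurable borel" unfolding k_def[abs_def] by measurable
  have norm_k: "(norm (k y))\<^sup>2 = (norm (nonlin_coeff F 1))\<^sup>2 * norm (\<phi> y) powr q" for y
  proof -
    have "(norm (\<phi> y) powr p)\<^sup>2 = norm (\<phi> y) powr (p + p)" by (simp only: power2_eq_square powr_add)
    also have "p + p = q" by simp
    finally show ?thesis unfolding k_def norm_mult norm_nonlin_mode power_mult_distrib by simp
  qed
  have k: "square_integrable k"
  proof (rule square_integrable_nn)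
    have m: "(\<lambda>y. ennreal (norm (\<phi> y) powr q)) \<in> borel_measurable lborel" by measurable
    have "L2_mass k = ennreal ((norm (nonlin_coeff F 1))\<^sup>2) * Lp_mass q \<phi>"
      unfolding norm_k nn_integral_cmult[OF m, symmetric] by (intro nn_integral_cong ennreal_mult) auto
    then show "L2_mass k < \<infinity>"
      using fin by (simp only: infinity_ennreal_def ennreal_mult_less_top ennreal_less_top) simp
  qed simp
  \<comment> \<open>With \<eta> = \<open>fourier_op 1 (L2_of k)\<close> the vanishing pairing is the
    integral of |k|^2. The information concerns the real part only, and this integral is
    real.\<close>
  have "fourier_op (- 1) (fourier_op 1 (L2_of k)) = L2_of k"
    using fourier_op_inverse[of 1 "L2_of k"] by simp
  then have "Re (LBINT y. k y * cnj (rep_L2 (L2_of k) y)) = 0"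
    using zero[of "fourier_op 1 (L2_of k)"] unfolding k_def by (simp only:)
  also have "(LBINT y. k y * cnj (rep_L2 (L2_of k) y)) = (LBINT y. complex_of_real ((norm (k y))\<^sup>2))"
  proof (rule integral_cong_AE)
    show "AE y in lborel. k y * cnj (rep_L2 (L2_of k) y) = complex_of_real ((norm (k y))\<^sup>2)"
      using L2_of_AE[OF k] by eventually_elim (simp only: complex_norm_square)
  qed (measurable, measurable)
  finally have "(LBINT y. (norm (k y))\<^sup>2) = 0" by (simp only: integral_complex_of_real Re_complex_of_real)
  then have "AE y in lborel. (norm (k y))\<^sup>2 = 0"
    using k by (subst (asm) integral_nonneg_eq_0_iff_AE) (auto simp: square_integrable_def)
  then have "AE y in lborel. rep_L2 (fourier_op (- 1) u_plus) y = rep_L2 0 y"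
    using L2_of_AE[OF square_integrable_zero]
  proof eventually_elim
    fix y assume "(norm (k y))\<^sup>2 = 0" and 0: "rep_L2 (L2_of (\<lambda>x. 0)) y = 0"
    then have "\<phi> y = 0" unfolding norm_k using g1 by simp
    then show "rep_L2 (fourier_op (- 1) u_plus) y = rep_L2 0 y"
      using 0 by (simp add: \<phi>_def L2_of_def square_integrable_zero abs_L2_zero)
  qed
  then have "fourier_op (- 1) u_plus = 0" by (rule L2_eqI)
  then have "norm u_plus = 0" using norm_fourier_op[of "- 1" u_plus] by simp
  then show "u_plus = 0" by simp
qed

end
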